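(* Let $\tau=\delta\varphi$ be the torsion of a closed $G_2$-structure $\varphi$. Then the symmetric tensor $-\mathrm j_\tau\tau=\tau_i{}^{l}\tau_{lj}\,e^i\otimes e^j$ is negative semi-definite with maximal eigenvalue $0$, and its minimal eigenvalue $\lambda_{\min}$ satisfies $$\lambda_{\min}\ge-\tfrac23|\tau|^2.$$ Moreover $\tau_i{}^{l}\tau_{lj}\tau^{ir}\tau_r{}^{j}=4|\tau|^4$.
   Context: $M$ is a compact oriented smooth 7-manifold. A 3-form $\varphi$ on $M$ is positive (a $G_2$-structure) if the $\Lambda^7T^*M$-valued quadratic form $Q_\varphi(a,b)=(a\lrcorner\varphi)\wedge(b\lrcorner\varphi)\wedge\varphi$ is positive definite; it determines a unique Riemannian metric $g=g_\varphi$ with $6g_\varphi=*_\varphi Q_\varphi$, with Hodge star $*$ and codifferential $\delta=(-1)^k*d*$ on $k$-forms. The structure is closed if $d\varphi=0$; then $\tau=\delta\varphi$ is a 2-form lying in $\Omega^2_{14}=\{\beta\in\Omega^2: *(\varphi\wedge\beta)=-\beta\}$. A 2-form is written $\tau=\frac12\tau_{ij}dx^{ij}$, the inner product of $k$-forms is $g(\omega,\bar\omega)=\frac1{k!}\omega_{i_1\cdots i_k}\bar\omega_{j_1\cdots j_k}g^{i_1j_1}\cdots g^{i_kj_k}$, and $|\tau|^2=g(\tau,\tau)$. Indices are raised with $g$, eigenvalues are taken with respect to $g$, and $\mathrm j_\tau\tau=\tau_{ia}\tau_j{}^{a}\,dx^i\otimes dx^j$.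
   Formalization: The constant in the last identity is corrected: with |τ|² = ½ τ_ij τ^ij the printed value 4|τ|⁴ is false wherever τ ≠ 0, and the identity proved is τ_i^l τ_lj τ^ir τ_r^j = |τ|⁴. *)

theory Defs
  imports "HOL-Analysis.Analysis"
begin

section \<open>Smooth functions and oriented smooth 7-manifolds\<close>

type_synonym R7 = "real ^ 7"

definition partial :: "7 \<Rightarrow> (R7 \<Rightarrow> 'b::real_normed_vector) \<Rightarrow> R7 \<Rightarrow> 'b" where
  "partial i f x = frechet_derivative f (at x) (axis i 1)"

primrec Ck_on :: "nat \<Rightarrow> R7 set \<Rightarrow> (R7 \<Rightarrow> 'b::real_normed_vector) \<Rightarrow> bool" where
  "Ck_on 0 S f \<longleftrightarrow> continuous_on S f"
| "Ck_on (Suc k) S f \<longleftrightarrow> f differentiable_on S \<and> (\<forall>i. Ck_on k S (partial i f))"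

text \<open>Only used for open sets \<open>S\<close>.\<close>

definition smooth_fun_on :: "R7 set \<Rightarrow> (R7 \<Rightarrow> 'b::real_normed_vector) \<Rightarrow> bool" where
  "smooth_fun_on S f \<longleftrightarrow> (\<forall>k. Ck_on k S f)"

type_synonym 'a chart = "'a set \<times> ('a \<Rightarrow> R7)"

abbreviation chart_dom :: "'a chart \<Rightarrow> 'a set" where "chart_dom c \<equiv> fst c"
abbreviation chart_map :: "'a chart \<Rightarrow> 'a \<Rightarrow> R7" where "chart_map c \<equiv> snd c"

definition chart_image :: "'a chart \<Rightarrow> R7 set" where
  "chart_image c = chart_map c ` chart_dom c"

definition is_chart :: "'a topology \<Rightarrow> 'a chart \<Rightarrow> bool" where
  "is_chart X c \<longleftrightarrow> openin X (chart_dom c) \<and> open (chart_image c) \<and>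
     homeomorphic_map (subtopology X (chart_dom c)) (top_of_set (chart_image c)) (chart_map c)"

definition transition :: "'a chart \<Rightarrow> 'a chart \<Rightarrow> R7 \<Rightarrow> R7" where
  "transition c d x = chart_map d (inv_into (chart_dom c) (chart_map c) x)"

definition oriented_atlas :: "'a topology \<Rightarrow> 'a chart set \<Rightarrow> bool" where
  "oriented_atlas X \<A> \<longleftrightarrow>
     (\<forall>c\<in>\<A>. is_chart X c) \<and> (\<Union>c\<in>\<A>. chart_dom c) = topspace X \<and>
     (\<forall>c\<in>\<A>. \<forall>d\<in>\<A>.
        smooth_fun_on (chart_map c ` (chart_dom c \<inter> chart_dom d)) (transition c d) \<and>
        (\<forall>p \<in> chart_dom c \<inter> chart_dom d.
           det (jacobian (transition c d) (at (chart_map c p))) > 0))"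

definition oriented_manifold7 :: "'a topology \<Rightarrow> 'a chart set \<Rightarrow> bool" where
  "oriented_manifold7 X \<A> \<longleftrightarrow> Hausdorff_space X \<and> second_countable X \<and> oriented_atlas X \<A>"


section \<open>Exterior algebra in components\<close>

text \<open>
  A \<open>k\<close>-covector \<open>\<omega> = 1/k! \<omega>_{i_1...i_k} dx^{i_1...i_k}\<close> on \<open>R^7\<close> is represented by its components
  \<open>\<omega> [i_1,...,i_k]\<close>; components at lists of any other length are \<open>0\<close>.
  The orientation of \<open>R^7\<close> is the one given by the order of the index type.
\<close>

type_synonym covector = "7 list \<Rightarrow> real"

definition kcovector :: "nat \<Rightarrow> covector \<Rightarrow> bool" where
  "kcovector k \<omega> \<longleftrightarrow> (\<forall>l. length l \<noteq> k \<longrightarrow> \<omega> l = 0) \<and>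
     (\<forall>l a b. length l = k \<and> a < b \<and> b < k \<longrightarrow> \<omega> (l[a := l ! b, b := l ! a]) = - \<omega> l)"

definition eps :: "7 list \<Rightarrow> real" where
  "eps l = (\<Prod>b<length l. \<Prod>a<b. if l ! a < l ! b then 1 else if l ! b < l ! a then -1 else 0)"

text \<open>\<open>[0,...,6]\<close>: evaluation at this list is the coefficient of \<open>dx^0 \<and> ... \<and> dx^6\<close> of a 7-covector.\<close>

definition idx7 :: "7 list" where
  "idx7 = sorted_list_of_set UNIV"

definition wedge :: "nat \<Rightarrow> nat \<Rightarrow> covector \<Rightarrow> covector \<Rightarrow> covector" where
  "wedge p q \<alpha> \<beta> l = (if length l = p + q then
     (\<Sum>\<sigma> | \<sigma> permutes {..<p+q}. real_of_int (sign \<sigma>) *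
        \<alpha> (map (\<lambda>a. l ! \<sigma> a) [0..<p]) * \<beta> (map (\<lambda>a. l ! \<sigma> a) [p..<p+q])) / (fact p * fact q)
   else 0)"

definition interior_prod :: "R7 \<Rightarrow> covector \<Rightarrow> covector" where
  "interior_prod v \<omega> l = (\<Sum>i\<in>UNIV. v $ i * \<omega> (i # l))"

definition pullback :: "real ^ 7 ^ 7 \<Rightarrow> nat \<Rightarrow> covector \<Rightarrow> covector" where
  "pullback J k \<omega> l = (if length l = k then
     (\<Sum>m | length m = k. \<omega> m * (\<Prod>a<k. J $ (m ! a) $ (l ! a))) else 0)"

definition inner_product_matrix :: "real ^ 7 ^ 7 \<Rightarrow> bool" where
  "inner_product_matrix g \<longleftrightarrow> transpose g = g \<and> (\<forall>v. v \<noteq> 0 \<longrightarrow> v \<bullet> (g *v v) > 0)"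

definition raise_all :: "real ^ 7 ^ 7 \<Rightarrow> nat \<Rightarrow> covector \<Rightarrow> covector" where
  "raise_all g k \<omega> l = (\<Sum>m | length m = k. (\<Prod>a<k. matrix_inv g $ (l ! a) $ (m ! a)) * \<omega> m)"

definition form_inner :: "real ^ 7 ^ 7 \<Rightarrow> nat \<Rightarrow> covector \<Rightarrow> covector \<Rightarrow> real" where
  "form_inner g k \<omega> \<omega>' = (\<Sum>l | length l = k. \<omega> l * raise_all g k \<omega>' l) / fact k"

definition form_norm :: "real ^ 7 ^ 7 \<Rightarrow> nat \<Rightarrow> covector \<Rightarrow> real" where
  "form_norm g k \<omega> = sqrt (form_inner g k \<omega> \<omega>)"

text \<open>
  The Hodge star with \<open>\<alpha> \<and> *\<omega> = g(\<alpha>,\<omega>) vol_g\<close>, where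
  \<open>vol_g = sqrt(det g) dx^0 \<and> ... \<and> dx^6\<close>.
\<close>

definition hodge :: "real ^ 7 ^ 7 \<Rightarrow> nat \<Rightarrow> covector \<Rightarrow> covector" where
  "hodge g k \<omega> l = (if length l + k = 7 then
     (\<Sum>m | length m = k. raise_all g k \<omega> m * (sqrt (det g) * eps (m @ l))) / fact k else 0)"


section \<open>Differential forms\<close>

text \<open>A differential form is the family of its coordinate expressions, one for each chart of the atlas.\<close>

type_synonym 'a diff_form = "'a chart \<Rightarrow> R7 \<Rightarrow> covector"

definition smooth_form :: "'a chart set \<Rightarrow> nat \<Rightarrow> 'a diff_form \<Rightarrow> bool" where
  "smooth_form \<A> k \<omega> \<longleftrightarrow>
     (\<forall>c\<in>\<A>. (\<forall>x\<in>chart_image c. kcovector k (\<omega> c x)) \<and>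
        (\<forall>l. smooth_fun_on (chart_image c) (\<lambda>x. \<omega> c x l))) \<and>
     (\<forall>c\<in>\<A>. \<forall>d\<in>\<A>. \<forall>p \<in> chart_dom c \<inter> chart_dom d.
        \<omega> c (chart_map c p) =
          pullback (jacobian (transition c d) (at (chart_map c p))) k (\<omega> d (chart_map d p)))"

definition ext_d :: "nat \<Rightarrow> (R7 \<Rightarrow> covector) \<Rightarrow> R7 \<Rightarrow> covector" where
  "ext_d k \<omega> x l = (if length l = Suc k then
     (\<Sum>a\<le>k. (-1) ^ a * partial (l ! a) (\<lambda>y. \<omega> y (take a l @ drop (Suc a) l)) x) else 0)"

definition codiff :: "(R7 \<Rightarrow> real ^ 7 ^ 7) \<Rightarrow> nat \<Rightarrow> (R7 \<Rightarrow> covector) \<Rightarrow> R7 \<Rightarrow> covector" where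
  "codiff g k \<omega> x l = (-1) ^ k * hodge (g x) (8 - k) (ext_d (7 - k) (\<lambda>y. hodge (g y) k (\<omega> y)) x) l"


section \<open>Closed G2-structures and their torsion\<close>

definition Q_form :: "covector \<Rightarrow> R7 \<Rightarrow> R7 \<Rightarrow> covector" where
  "Q_form \<phi> a b = wedge 4 3 (wedge 2 2 (interior_prod a \<phi>) (interior_prod b \<phi>)) \<phi>"

definition positive_covector :: "covector \<Rightarrow> bool" where
  "positive_covector \<phi> \<longleftrightarrow> kcovector 3 \<phi> \<and> (\<forall>a. a \<noteq> 0 \<longrightarrow> Q_form \<phi> a a idx7 > 0)"

text \<open>The metric determined by \<open>6 g_\<phi> = *_\<phi> Q_\<phi>\<close>; the star on the right is the one of \<open>g_\<phi>\<close> itself.\<close>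

definition G2_metric :: "covector \<Rightarrow> real ^ 7 ^ 7" where
  "G2_metric \<phi> = (THE g. inner_product_matrix g \<and>
     (\<forall>a b. 6 * (a \<bullet> (g *v b)) = hodge g 7 (Q_form \<phi> a b) []))"

definition closed_G2_structure :: "'a chart set \<Rightarrow> 'a diff_form \<Rightarrow> bool" where
  "closed_G2_structure \<A> \<phi> \<longleftrightarrow> smooth_form \<A> 3 \<phi> \<and>
     (\<forall>c\<in>\<A>. \<forall>x\<in>chart_image c. positive_covector (\<phi> c x)) \<and>
     (\<forall>c\<in>\<A>. \<forall>x\<in>chart_image c. \<forall>l. ext_d 3 (\<phi> c) x l = 0)"

definition G2_torsion :: "'a diff_form \<Rightarrow> 'a diff_form" where
  "G2_torsion \<phi> c = codiff (\<lambda>y. G2_metric (\<phi> c y)) 3 (\<phi> c)"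


section \<open>Index manipulation and eigenvalues\<close>

text \<open>For a 2-covector \<open>\<tau>\<close>: \<open>\<tau>_{ij}\<close>, \<open>\<tau>_i^j\<close> and \<open>\<tau>^{ij}\<close>.\<close>

definition comp_dd :: "covector \<Rightarrow> 7 \<Rightarrow> 7 \<Rightarrow> real" where
  "comp_dd \<tau> i j = \<tau> [i, j]"

definition comp_du :: "real ^ 7 ^ 7 \<Rightarrow> covector \<Rightarrow> 7 \<Rightarrow> 7 \<Rightarrow> real" where
  "comp_du g \<tau> i j = (\<Sum>b\<in>UNIV. comp_dd \<tau> i b * matrix_inv g $ b $ j)"

definition comp_uu :: "real ^ 7 ^ 7 \<Rightarrow> covector \<Rightarrow> 7 \<Rightarrow> 7 \<Rightarrow> real" where
  "comp_uu g \<tau> i j = (\<Sum>a\<in>UNIV. \<Sum>b\<in>UNIV. matrix_inv g $ a $ i * comp_dd \<tau> a b * matrix_inv g $ b $ j)"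

definition j_op :: "real ^ 7 ^ 7 \<Rightarrow> covector \<Rightarrow> real ^ 7 ^ 7" where
  "j_op g \<tau> = (\<chi> i j. \<Sum>a\<in>UNIV. comp_dd \<tau> i a * comp_du g \<tau> j a)"

definition neg_semidefinite :: "real ^ 7 ^ 7 \<Rightarrow> bool" where
  "neg_semidefinite h \<longleftrightarrow> transpose h = h \<and> (\<forall>v. v \<bullet> (h *v v) \<le> 0)"

definition eigenvalues_wrt :: "real ^ 7 ^ 7 \<Rightarrow> real ^ 7 ^ 7 \<Rightarrow> real set" where
  "eigenvalues_wrt g h = {\<mu>. \<exists>v. v \<noteq> 0 \<and> h *v v = \<mu> *\<^sub>R (g *v v)}"

end

theory Submission
  imports Defs
begin

text \<open>
  In a frame orthonormal for the metric of a positive 3-form \<open>\<phi>\<close>, skew-symmetrisation over eight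
  indices, applied to \<open>\<epsilon>\<close> times a cubic in \<open>\<phi>\<close>, shows that \<open>x \<times> (x \<times> y) = - |x|\<^sup>2 y + \<langle>x,y\<rangle> x\<close> for
  the cross product of \<open>\<phi>\<close>; hence \<open>\<phi>\<^sub>m\<^sub>i\<^sub>j \<phi>\<^sup>k\<^sup>i\<^sup>j = 6 \<delta>\<^sub>m\<^sup>k\<close>.
  Differentiating the trace of this identity gives \<open>d log vol = \<phi>\<^sup>i\<^sup>j\<^sup>k d\<phi>\<^sub>i\<^sub>j\<^sub>k / 18\<close>. Taking the divergence
  of the identity itself and contracting \<open>d\<phi> = 0\<close> with \<open>\<phi>\<close> then gives \<open>\<phi>\<^sub>m\<^sub>i\<^sub>j \<tau>\<^sup>i\<^sup>j = 0\<close>, so \<open>\<tau>\<close> is a derivation of the cross product.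
  Being skew in odd dimension, \<open>\<tau>\<close> kills a unit vector \<open>a\<close>. It commutes with the complex structure
  \<open>a \<times> -\<close> on the complement of \<open>a\<close> and has complex trace 0, hence lies in \<open>su(3)\<close>, where the claims
  are explicit polynomial (in)equalities.
\<close>

text \<open>Positivity of \<phi> is only the definiteness of a cubic expression in \<phi>, so no
  standard model of \<phi> is at hand; the 8-index identity takes the place of the classification of
  positive 3-forms. It yields the cross product relation only up to a scale, which a separate volume
  comparison fixes. The metric is differentiated without a connection: the raised 3-form weighted by
  the volume density has a divergence that involves coordinate derivatives alone. On su(3) the
  claims have a simple origin. If the nonzero eigenvalues of \<tau> are the conjugate pairs of ic,
  id, ie, then c + d + e = 0, |\<tau>|^2 = c^2 + d^2 + e^2 because of the factor 1/2! in the norm of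
  2-forms, and the symmetric tensor has the eigenvalue 0 and the doubled -c^2, -d^2, -e^2. A zero
  sum forces c^2 \<le> 2/3 (c^2 + d^2 + e^2), with equality for (2,-1,-1), and 2 (c^4 + d^4 + e^4) =
  (c^2 + d^2 + e^2)^2. With this norm the quartic contraction is therefore |\<tau>|^4: the constant
  is 1, not 4.\<close>

abbreviation (input) sum7 :: "(7 \<Rightarrow> 'b::comm_monoid_add) \<Rightarrow> 'b"  (binder "\<Sum>\<^sub>7 " 10) where
  "sum7 f \<equiv> sum f UNIV"

section \<open>The Levi-Civita symbol in dimension seven\<close>

lemma UNIV_7: "(UNIV::7 set) = {0,1,2,3,4,5,6}"
proof -
  have "card {0,1,2,3,4,5,6::7} = 7" by simp
  then show ?thesis by (intro card_seteq[symmetric]) auto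
qed

lemma idx7_eq: "idx7 = [0,1,2,3,4,5,6]"
  unfolding idx7_def UNIV_7
  using sorted_list_of_set.idem_if_sorted_distinct[of "[0,1,2,3,4,5,6::7]"]
  by (simp add: less_eq_bit1_def bit1.Rep_numeral bit1.Rep_0 bit1.Rep_1)

section \<open>Signs of permutations acting on the alternating symbol\<close>

definition order_sgn :: "'a::linorder \<Rightarrow> 'a \<Rightarrow> real" where
  "order_sgn x y = (if x < y then 1 else if y < x then -1 else 0)"

text \<open>A sign product for functions on positions and over a single set of pairs, so that
  permuting positions is composition and products can be reindexed pair by pair.\<close>

definition seq_eps :: "nat \<Rightarrow> (nat \<Rightarrow> 'a::linorder) \<Rightarrow> real" where
  "seq_eps n h = (\<Prod>(a,b)\<in>{(a,b). a < b \<and> b < n}. order_sgn (h a) (h b))"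

lemma finite_pairs: "finite {(a,b). a < b \<and> b < (n::nat)}"
  by (rule finite_subset[of _ "{..<n} \<times> {..<n}"]) auto

lemma eps_eq_seq_eps: "eps l = seq_eps (length l) ((!) l)"
proof -
  have "seq_eps (length l) ((!) l)
      = (\<Prod>(b,a)\<in>(SIGMA b:{..<length l}. {..<b}). order_sgn (l ! a) (l ! b))"
    unfolding seq_eps_def
    by (rule prod.reindex_bij_witness[of _ "\<lambda>(b,a). (a,b)" "\<lambda>(a,b). (b,a)"]) auto
  then show ?thesis
    by (simp add: eps_def order_sgn_def prod.Sigma)
qed

lemma order_sgn_swap: "order_sgn y x = - order_sgn x y"
  by (auto simp: order_sgn_def)

text \<open>Exchanging two neighbouring positions maps every other ordered pair to an ordered pair,
  so only the factor of the pair itself changes sign.\<close>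

lemma seq_eps_adjacent:
  assumes "Suc p < n"
  shows "seq_eps n (h \<circ> Transposition.transpose p (Suc p)) = - seq_eps n h"
proof -
  let ?t = "Transposition.transpose p (Suc p)"
  let ?S = "{(a,b). a < b \<and> b < n}"
  let ?F = "\<lambda>h (a,b). order_sgn (h a) (h b)"
  have pin: "(p, Suc p) \<in> ?S" using assms by auto
  have rest: "prod (?F (h \<circ> ?t)) (?S - {(p, Suc p)}) = prod (?F h) (?S - {(p, Suc p)})"
    by (rule prod.reindex_bij_witness[of _ "\<lambda>(a,b). (?t a, ?t b)" "\<lambda>(a,b). (?t a, ?t b)"])
      (use assms in \<open>auto simp: Transposition.transpose_def split: if_splits\<close>)
  have "seq_eps n (h \<circ> ?t) = ?F (h \<circ> ?t) (p, Suc p) * prod (?F (h \<circ> ?t)) (?S - {(p, Suc p)})"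
    unfolding seq_eps_def using pin by (subst prod.remove[OF finite_pairs pin]) auto
  also have "?F (h \<circ> ?t) (p, Suc p) = - ?F h (p, Suc p)"
    by (simp add: order_sgn_swap[of "h p"])
  finally show ?thesis
    unfolding seq_eps_def rest by (subst prod.remove[OF finite_pairs pin]) auto
qed

text \<open>Induction on the distance: conjugation by an adjacent transposition shortens it by one,
  and the three sign changes amount to one.\<close>

lemma seq_eps_transpose:
  assumes "a < n" "b < n" "a \<noteq> b"
  shows "seq_eps n (h \<circ> Transposition.transpose a b) = - seq_eps n h"
proof -
  have *: "seq_eps n (h \<circ> Transposition.transpose a (Suc (a + d))) = - seq_eps n h"
    if "Suc (a + d) < n" for a d h
    using that
  proof (induction d arbitrary: h)
    case 0
    then show ?case using seq_eps_adjacent[of a n h] by (simp add: comp_def)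
  next
    case (Suc d)
    let ?b = "Suc (a + d)" and ?c = "Suc (Suc (a + d))"
    have t: "Transposition.transpose a ?c
        = Transposition.transpose ?b ?c \<circ> Transposition.transpose a ?b \<circ> Transposition.transpose ?b ?c"
      using transpose_comp_triple[of ?c a ?b] by (simp add: transpose_commute)
    have "seq_eps n (h \<circ> Transposition.transpose a ?c) = - seq_eps n h"
      using Suc.IH[of "h \<circ> Transposition.transpose ?b ?c"] Suc.prems seq_eps_adjacent[of ?b n h]
        seq_eps_adjacent[of ?b n "h \<circ> Transposition.transpose ?b ?c \<circ> Transposition.transpose a ?b"]
      unfolding t by (simp add: comp_def)
    then show ?case by (simp add: comp_def)
  qed
  show ?thesis
  proof (cases "a < b")
    case True
    then show ?thesis using *[of a "b - a - 1" h] assms by simp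
  next
    case False
    then show ?thesis using *[of b "a - b - 1" h] assms by (simp add: transpose_commute)
  qed
qed

lemma seq_eps_permute:
  assumes "\<sigma> permutes {..<n}"
  shows "seq_eps n (h \<circ> \<sigma>) = sign \<sigma> * seq_eps n h"
  using assms(1) finite_lessThan
proof (induction arbitrary: h rule: permutes_induct)
  case id
  then show ?case by simp
next
  case (swap a b p)
  have "permutation p" using swap permutation_permutes finite_lessThan by blast
  then show ?case
    using swap swap.IH[of "h \<circ> Transposition.transpose a b"] seq_eps_transpose[of a n b h] sign_compose[of "Transposition.transpose a b" p]
    by (simp add: comp_def permutation_swap_id sign_swap_id)
qed

lemma seq_eps_cong: "(\<And>k. k < n \<Longrightarrow> h k = h' k) \<Longrightarrow> seq_eps n h = seq_eps n h'"
  unfolding seq_eps_def by (rule prod.cong) auto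

lemma eps_permute_list:
  assumes "\<sigma> permutes {..<length l}"
  shows "eps (permute_list \<sigma> l) = sign \<sigma> * eps l"
proof -
  have "seq_eps (length l) ((!) (permute_list \<sigma> l)) = seq_eps (length l) ((!) l \<circ> \<sigma>)"
    by (rule seq_eps_cong) (simp add: permute_list_nth[OF assms])
  then show ?thesis
    by (simp add: eps_eq_seq_eps seq_eps_permute[OF assms])
qed

lemma eps_eq_0_iff: "eps l = 0 \<longleftrightarrow> \<not> distinct l"
proof
  assume "eps l = 0"
  then obtain a b where "a < b" "b < length l" "order_sgn (l ! a) (l ! b) = 0"
    unfolding eps_eq_seq_eps seq_eps_def prod_zero_iff[OF finite_pairs] by auto
  then show "\<not> distinct l"
    by (auto simp: order_sgn_def distinct_conv_nth split: if_splits) (metis less_trans neq_iff)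
next
  assume "\<not> distinct l"
  then obtain a b where "a < b" "b < length l" "l ! a = l ! b"
    unfolding distinct_conv_nth by (metis nat_neq_iff)
  then show "eps l = 0"
    unfolding eps_eq_seq_eps seq_eps_def prod_zero_iff[OF finite_pairs]
    by (intro bexI[of _ "(a,b)"]) (auto simp: order_sgn_def)
qed

lemma eps_square: "eps l * eps l = (if distinct l then 1 else 0)"
proof (cases "distinct l")
  case True
  have "(\<Prod>(a,b)\<in>{(a,b). a < b \<and> b < length l}. order_sgn (l ! a) (l ! b) * order_sgn (l ! a) (l ! b)) = 1"
    using True by (intro prod.neutral) (auto simp: order_sgn_def distinct_conv_nth)
  then show ?thesis
    using True by (simp add: eps_eq_seq_eps seq_eps_def prod.distrib[symmetric] case_prod_unfold)
next
  case False
  then show ?thesis using eps_eq_0_iff by simp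
qed

lemma eps_idx7: "eps idx7 = 1"
proof -
  have "sorted_wrt (<) idx7" unfolding idx7_def by simp
  then show ?thesis
    unfolding eps_eq_seq_eps seq_eps_def
    by (intro prod.neutral) (auto simp: order_sgn_def sorted_wrt_nth_less)
qed

lemma length_idx7 [simp]: "length idx7 = 7" by (simp add: idx7_eq)

lemma finite_lists7 [simp]: "finite {l::7 list. length l = n}"
  using finite_lists_length_eq[of "UNIV::7 set" n] by simp

lemma distinct7_set: "length l = 7 \<Longrightarrow> distinct l \<Longrightarrow> set (l::7 list) = UNIV"
  using distinct_card[of l] by (intro card_subset_eq) auto

lemma permute_list_surj7:
  assumes "length l = 7" "distinct (l::7 list)" "length m = 7" "distinct m"
  obtains \<sigma> where "\<sigma> permutes {..<7}" "l = permute_list \<sigma> m"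
proof -
  have "mset l = mset m"
    using assms distinct7_set by (metis set_eq_iff_mset_eq_distinct)
  then obtain \<sigma> where "\<sigma> permutes {..<length m}" "permute_list \<sigma> m = l"
    by (rule mset_eq_permutation)
  then show ?thesis using that assms by auto
qed

text \<open>Alternating 7-tensors in dimension seven form a line: a list without repetition is a
  rearrangement of \<open>idx7\<close>, and at a repetition some transposition fixes the list but
  flips the sign.\<close>

lemma alternating_eq_eps:
  assumes alt: "\<And>l \<sigma>. length l = 7 \<Longrightarrow> \<sigma> permutes {..<7} \<Longrightarrow> G (permute_list \<sigma> l) = sign \<sigma> * (G l :: real)"
    and l: "length l = 7"
  shows "G l = eps l * G idx7"
proof (cases "distinct l")
  case True
  have "distinct idx7" using eps_idx7 eps_eq_0_iff[of idx7] by auto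
  then obtain \<sigma> where "\<sigma> permutes {..<7}" "l = permute_list \<sigma> idx7"
    using permute_list_surj7[OF l True, of idx7] by auto
  then show ?thesis
    using alt[of idx7 \<sigma>] eps_permute_list[of \<sigma> idx7] by (simp add: eps_idx7)
next
  case False
  then obtain a b where ab: "a < 7" "b < 7" "a \<noteq> b" "l ! a = l ! b"
    unfolding distinct_conv_nth using l by auto
  let ?t = "Transposition.transpose a b"
  have t: "?t permutes {..<7}" using ab by (intro permutes_swap_id) auto
  have "permute_list ?t l = l"
    using l ab by (intro nth_equalityI)
      (auto simp: permute_list_nth[of ?t l] t Transposition.transpose_def)
  then have "G l = - G l" using alt[OF l t] ab by (simp add: sign_swap_id)
  then show ?thesis using False eps_eq_0_iff by simp
qed

section \<open>Sums weighted by the symbol, and determinants\<close>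

lemma sum_lists_permute:
  assumes "\<sigma> permutes {..<7}"
  shows "(\<Sum>l | length l = 7. F (permute_list \<sigma> l)) = (\<Sum>l :: 7 list | length l = 7. F l :: real)"
proof (rule sum.reindex_bij_betw, rule bij_betw_byWitness[where f' = "permute_list (inv \<sigma>)"])
  have inv: "inv \<sigma> permutes {..<7}" using assms by (rule permutes_inv)
  show "\<forall>l\<in>{l::7 list. length l = 7}. permute_list (inv \<sigma>) (permute_list \<sigma> l) = l"
    using assms inv by (auto simp: permute_list_compose[symmetric] permutes_inv_o)
  show "\<forall>l\<in>{l::7 list. length l = 7}. permute_list \<sigma> (permute_list (inv \<sigma>) l) = l"
    using assms inv by (auto simp: permute_list_compose[symmetric] permutes_inv_o)
qed auto

lemma sum_eps_permute:
  assumes "\<sigma> permutes {..<7}"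
  shows "(\<Sum>l | length l = 7. eps l * F (permute_list \<sigma> l)) = sign \<sigma> * (\<Sum>l | length l = 7. eps l * F l)"
proof -
  have "(\<Sum>l | length l = 7. eps l * F l)
      = (\<Sum>l | length l = 7. eps (permute_list \<sigma> l) * F (permute_list \<sigma> l))"
    by (rule sum_lists_permute[OF assms, symmetric])
  also have "\<dots> = sign \<sigma> * (\<Sum>l | length l = 7. eps l * F (permute_list \<sigma> l))"
    using assms by (simp add: eps_permute_list sum_distrib_left mult.assoc)
  finally show ?thesis by (simp add: mult.assoc[symmetric] flip: of_int_mult)
qed

text \<open>The link between sums over all lists and the permutation sums in \<open>wedge\<close>:
  lists with a repetition drop out, and the others are the rearrangements of
  \<open>idx7\<close>.\<close>

lemma sum_eps_eq_sum_permutes: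
  "(\<Sum>l | length l = 7. eps l * (F l :: real))
    = (\<Sum>\<sigma> | \<sigma> permutes {..<7}. real_of_int (sign \<sigma>) * F (map (\<lambda>a. idx7 ! \<sigma> a) [0..<7]))"
proof -
  have d: "distinct idx7" using eps_idx7 eps_eq_0_iff[of idx7] by auto
  have "(\<Sum>\<sigma> | \<sigma> permutes {..<7}. real_of_int (sign \<sigma>) * F (map (\<lambda>a. idx7 ! \<sigma> a) [0..<7]))
      = (\<Sum>\<sigma> | \<sigma> permutes {..<7}. eps (permute_list \<sigma> idx7) * F (permute_list \<sigma> idx7))"
    by (intro sum.cong refl) (simp add: eps_permute_list eps_idx7, simp add: permute_list_def)
  also have "\<dots> = (\<Sum>l | length l = 7 \<and> distinct l. eps l * F l)"
  proof (rule sum.reindex_bij_betw, rule bij_betw_imageI)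
    show "inj_on (\<lambda>\<sigma>. permute_list \<sigma> idx7) {\<sigma>. \<sigma> permutes {..<7}}"
    proof (rule inj_onI, clarify, rule ext)
      fix \<sigma> \<rho> x assume s: "\<sigma> permutes {..<7}" "\<rho> permutes {..<7}"
        and e: "permute_list \<sigma> idx7 = permute_list \<rho> idx7"
      show "\<sigma> x = \<rho> x"
      proof (cases "x < 7")
        case True
        have "idx7 ! \<sigma> x = permute_list \<rho> idx7 ! x"
          using True s e permute_list_nth[of \<sigma> idx7 x] by simp
        also have "\<dots> = idx7 ! \<rho> x"
          using True s permute_list_nth[of \<rho> idx7 x] by simp
        finally have "idx7 ! \<sigma> x = idx7 ! \<rho> x" "\<sigma> x < 7" "\<rho> x < 7"
          using s True permutes_in_image[of _ "{..<7}" x] by auto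
        then show ?thesis using d by (simp add: nth_eq_iff_index_eq)
      next
        case False
        then show ?thesis using permutes_not_in[OF s(1), of x] permutes_not_in[OF s(2), of x] by simp
      qed
    qed
    show "(\<lambda>\<sigma>. permute_list \<sigma> idx7) ` {\<sigma>. \<sigma> permutes {..<7}} = {l. length l = 7 \<and> distinct l}"
      using permute_list_surj7[OF _ _ length_idx7 d] d by (auto simp: image_iff)
  qed
  also have "\<dots> = (\<Sum>l | length l = 7. eps l * F l)"
    by (rule sum.mono_neutral_left) (auto simp: eps_eq_0_iff)
  finally show ?thesis by simp
qed

text \<open>Both sides alternate in \<open>a\<close>, so one value suffices. At \<open>idx7\<close>
  it is the determinant, whose permutations of the index type are transported to permutations of
  positions along \<open>k \<mapsto> idx7 ! k\<close>.\<close>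

lemma sum_eps_prod_matrix:
  fixes P :: "real^7^7"
  assumes "length a = 7"
  shows "(\<Sum>l | length l = 7. eps l * (\<Prod>k<7. P $ (a ! k) $ (l ! k))) = det P * eps a"
proof -
  define G where "G a = (\<Sum>l | length l = 7. eps l * (\<Prod>k<7. P $ (a ! k) $ (l ! k)))" for a
  have alt: "G (permute_list \<sigma> l) = sign \<sigma> * G l" if l: "length l = 7" and s: "\<sigma> permutes {..<7}" for l \<sigma>
  proof -
    have "G l = (\<Sum>m | length m = 7. eps m * (\<Prod>k<7. P $ (permute_list \<sigma> l ! k) $ (permute_list \<sigma> m ! k)))"
      unfolding G_def
    proof (intro sum.cong refl arg_cong2[where f = "(*)"])
      fix m :: "7 list" assume "m \<in> {m. length m = 7}"
      then show "(\<Prod>k<7. P $ (l ! k) $ (m ! k)) = (\<Prod>k<7. P $ (permute_list \<sigma> l ! k) $ (permute_list \<sigma> m ! k))"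
        using l s by (subst prod.permute[OF s]) (simp add: permute_list_nth)
    qed
    also have "\<dots> = sign \<sigma> * G (permute_list \<sigma> l)"
      unfolding G_def by (rule sum_eps_permute[OF s])
    finally have "sign \<sigma> * G l = (sign \<sigma> * sign \<sigma>) * G (permute_list \<sigma> l)"
      by (simp only: of_int_mult mult.assoc)
    then show ?thesis by simp
  qed
  have "distinct idx7" using eps_idx7 eps_eq_0_iff[of idx7] by auto
  then have bij: "bij_betw (\<lambda>k. idx7 ! k) {..<7} UNIV"
    using distinct7_set[of idx7] by (intro bij_betw_nth) auto
  let ?f = "\<lambda>k. idx7 ! k"
  let ?h = "\<lambda>\<pi> x. if x \<in> UNIV then ?f (\<pi> (inv_into {..<7} ?f x)) else x"
  have sgn: "sign (?h \<pi>) = sign \<pi>" if "\<pi> permutes {..<7}" for \<pi>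
  proof -
    have "?h \<pi> = map_permutation {..<7} ?f \<pi>"
      using bij by (auto simp: map_permutation_def restrict_id_def fun_eq_iff bij_betw_def)
    then show ?thesis
      using sign_map_permutation[of ?f "{..<7}" \<pi>] bij that by (simp add: bij_betw_def)
  qed
  have "det P = (\<Sum>\<pi> | \<pi> permutes {..<7}. of_int (sign (?h \<pi>)) * (\<Prod>i\<in>UNIV. P $ i $ ?h \<pi> i))"
    unfolding det_def using bij_betw_permutations[OF bij] by (rule sum.reindex_bij_betw[symmetric])
  also have "\<dots> = (\<Sum>\<pi> | \<pi> permutes {..<7}. of_int (sign \<pi>) * (\<Prod>k<7. P $ (idx7 ! k) $ (idx7 ! \<pi> k)))"
  proof (intro sum.cong refl arg_cong2[where f = "(*)"])
    fix \<pi> assume "\<pi> \<in> {\<pi>. \<pi> permutes {..<7::nat}}"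
    then show "real_of_int (sign (?h \<pi>)) = of_int (sign \<pi>)" using sgn by simp
    show "(\<Prod>i\<in>UNIV. P $ i $ ?h \<pi> i) = (\<Prod>k<7. P $ (idx7 ! k) $ (idx7 ! \<pi> k))"
      using bij by (subst prod.reindex_bij_betw[OF bij, symmetric]) (auto simp: bij_betw_def)
  qed
  also have "\<dots> = G idx7"
    unfolding G_def sum_eps_eq_sum_permutes by (intro sum.cong refl arg_cong2[where f = "(*)"] prod.cong) auto
  finally have "G idx7 = det P" by simp
  moreover have "G a = eps a * G idx7" by (rule alternating_eq_eps[OF alt assms])
  ultimately have "G a = det P * eps a" by (simp only: mult.commute)
  then show ?thesis unfolding G_def .
qed

lemma eps_transpose:
  assumes "a < length l" "b < length l" "a \<noteq> b"
  shows "eps (l[a := l ! b, b := l ! a]) = - eps l"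
proof -
  let ?t = "Transposition.transpose a b"
  have t: "?t permutes {..<length l}" using assms by (intro permutes_swap_id) auto
  have "permute_list ?t l = l[a := l ! b, b := l ! a]"
  proof (rule nth_equalityI)
    fix i assume i: "i < length (permute_list ?t l)"
    then show "permute_list ?t l ! i = l[a := l ! b, b := l ! a] ! i"
      using assms by (simp add: permute_list_nth[OF t] Transposition.transpose_def)
  qed simp
  then show ?thesis using eps_permute_list[OF t] assms by (simp add: sign_swap_id)
qed

text \<open>Skew-symmetrising over eight indices gives zero in dimension seven.\<close>

lemma eps_schouten:
  assumes l: "length (l::7 list) = 7"
  shows "(\<Sum>k<7. if l ! k = a then eps (l[k := b]) else 0) = (if a = b then eps l else 0)"
proof (cases "distinct l")
  case True
  then obtain i where i: "i < 7" "l ! i = a"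
    using distinct7_set[OF l True] l by (metis UNIV_I in_set_conv_nth)
  have "(\<Sum>k<7. if l ! k = a then eps (l[k := b]) else 0) = (\<Sum>k<7. if k = i then eps (l[k := b]) else 0)"
    using i l True by (intro sum.cong) (auto simp: nth_eq_iff_index_eq)
  also have "\<dots> = eps (l[i := b])" using i by simp
  also have "\<dots> = (if a = b then eps l else 0)"
  proof (cases "a = b")
    case True
    then show ?thesis using i by auto
  next
    case False
    obtain j where j: "j < 7" "l ! j = b"
      using distinct7_set[OF l True] l by (metis UNIV_I in_set_conv_nth)
    have "i \<noteq> j" using i j False by auto
    then have "\<not> distinct (l[i := b])"
      using i j l nth_eq_iff_index_eq[of "l[i := b]" i j] by auto
    then show ?thesis using False eps_eq_0_iff by simp
  qed
  finally show ?thesis .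
next
  case False
  \<comment> \<open>Replacing one entry can remove the repetition only at \<open>p\<close> or
    \<open>q\<close>; these two terms differ by a transposition and cancel.\<close>
  then obtain p q where pq: "p < 7" "q < 7" "p \<noteq> q" "l ! p = l ! q"
    unfolding distinct_conv_nth using l by auto
  have z: "(if l ! k = a then eps (l[k := b]) else 0) = 0" if "k \<in> {..<7} - {p, q}" for k
  proof -
    have "\<not> distinct (l[k := b])"
      using pq that l nth_eq_iff_index_eq[of "l[k := b]" p q] by auto
    then show ?thesis using eps_eq_0_iff by simp
  qed
  have "(\<Sum>k<7. if l ! k = a then eps (l[k := b]) else 0)
      = (\<Sum>k\<in>{p, q}. if l ! k = a then eps (l[k := b]) else 0)"
    using pq z by (intro sum.mono_neutral_right) auto
  also have "\<dots> = (if l ! p = a then eps (l[p := b]) + eps (l[q := b]) else 0)"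
    using pq by simp
  also have "eps (l[q := b]) = - eps (l[p := b])"
  proof -
    have "(l[p := b])[p := l[p := b] ! q, q := l[p := b] ! p] = l[q := b]"
      using pq l by (intro nth_equalityI) (auto simp: nth_list_update)
    then show ?thesis using eps_transpose[of p "l[p := b]" q] pq l by simp
  qed
  finally show ?thesis using False eps_eq_0_iff by simp
qed

text \<open>Where the first symbol is nonzero, \<open>m\<close> is one of the 4! orderings of the
  complement of \<open>u\<close>. The second symbol then leaves the 3! orderings of \<open>u\<close>
  for \<open>i\<close>, which contribute equally because both factors alternate. Hence 144 = 4!
  3!.\<close>

lemma eps_contraction:
  fixes \<Phi> :: "7 list \<Rightarrow> real"
  assumes alt: "\<And>i \<sigma>. length i = 3 \<Longrightarrow> \<sigma> permutes {..<3} \<Longrightarrow> \<Phi> (permute_list \<sigma> i) = sign \<sigma> * \<Phi> i"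
    and u: "length u = 3"
  shows "(\<Sum>m | length m = 4. \<Sum>i | length i = 3. eps (u @ m) * eps (i @ m) * \<Phi> i) = 144 * \<Phi> u"
proof (cases "distinct u")
  case False
  then obtain a b where ab: "a < 3" "b < 3" "a \<noteq> b" "u ! a = u ! b"
    unfolding distinct_conv_nth using u by auto
  let ?t = "Transposition.transpose a b"
  have t: "?t permutes {..<3}" using ab by (intro permutes_swap_id) auto
  have "permute_list ?t u = u"
    using u ab by (intro nth_equalityI)
      (auto simp: permute_list_nth[of ?t u] t Transposition.transpose_def)
  then have "\<Phi> u = - \<Phi> u" using alt[OF u t] ab by (simp add: sign_swap_id)
  moreover have "eps (u @ m) = 0" for m using False by (simp add: eps_eq_0_iff)
  ultimately show ?thesis by simp
next
  case True
  have inner: "(\<Sum>i | length i = 3. eps (i @ m) * \<Phi> i) = 6 * (eps (u @ m) * \<Phi> u)"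
    if m: "length m = 4" and d: "distinct (u @ m)" for m
  proof -
    have cu: "set u = - set m"
      using distinct7_set[of "u @ m"] u m d by auto
    let ?f = "\<lambda>\<sigma>. permute_list \<sigma> u"
    have im: "?f ` {\<sigma>. \<sigma> permutes {..<3}} = {i. length i = 3 \<and> distinct (i @ m)}"
    proof (intro equalityI subsetI)
      fix i assume "i \<in> ?f ` {\<sigma>. \<sigma> permutes {..<3}}"
      then show "i \<in> {i. length i = 3 \<and> distinct (i @ m)}" using u d by auto
    next
      fix i assume i: "i \<in> {i. length i = 3 \<and> distinct (i @ m)}"
      then have "set i = - set m"
        using distinct7_set[of "i @ m"] m by auto
      then have "mset i = mset u"
        using i d cu set_eq_iff_mset_eq_distinct[of i u] by auto
      then obtain \<sigma> where "\<sigma> permutes {..<length u}" "permute_list \<sigma> u = i"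
        by (rule mset_eq_permutation)
      then show "i \<in> ?f ` {\<sigma>. \<sigma> permutes {..<3}}" using u by auto
    qed
    have inj: "inj_on ?f {\<sigma>. \<sigma> permutes {..<3}}"
    proof (rule inj_onI, clarify, rule ext)
      fix \<sigma> \<rho> x assume s: "\<sigma> permutes {..<3}" "\<rho> permutes {..<3}"
        and e: "permute_list \<sigma> u = permute_list \<rho> u"
      show "\<sigma> x = \<rho> x"
      proof (cases "x < 3")
        case x: True
        have "u ! \<sigma> x = permute_list \<rho> u ! x"
          using x s e u permute_list_nth[of \<sigma> u x] by simp
        also have "\<dots> = u ! \<rho> x"
          using x s u permute_list_nth[of \<rho> u x] by simp
        finally have "u ! \<sigma> x = u ! \<rho> x" "\<sigma> x < 3" "\<rho> x < 3"
          using s x permutes_in_image[of _ "{..<3}" x] by auto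
        then show ?thesis using True u by (simp add: nth_eq_iff_index_eq)
      next
        case False
        then show ?thesis using permutes_not_in[OF s(1), of x] permutes_not_in[OF s(2), of x] by simp
      qed
    qed
    have perm: "eps (permute_list \<sigma> u @ m) * \<Phi> (permute_list \<sigma> u) = eps (u @ m) * \<Phi> u"
      if s: "\<sigma> permutes {..<3}" for \<sigma>
    proof -
      have s7: "\<sigma> permutes {..<length (u @ m)}" using s by (rule permutes_subset) (use u in auto)
      have "permute_list \<sigma> (u @ m) = permute_list \<sigma> u @ m"
        using u m s s7 permutes_in_image[OF s] permutes_not_in[OF s]
        by (intro nth_equalityI) (auto simp: permute_list_nth[OF s7] permute_list_nth[of \<sigma> u] nth_append)
      then show ?thesis
        using eps_permute_list[OF s7] alt[OF u s]
        by (simp add: mult.assoc mult.left_commute flip: of_int_mult)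
    qed
    have "(\<Sum>i | length i = 3. eps (i @ m) * \<Phi> i)
        = (\<Sum>i | length i = 3 \<and> distinct (i @ m). eps (i @ m) * \<Phi> i)"
      by (rule sum.mono_neutral_right) (auto simp: eps_eq_0_iff)
    also have "\<dots> = (\<Sum>\<sigma> | \<sigma> permutes {..<3}. eps (?f \<sigma> @ m) * \<Phi> (?f \<sigma>))"
      unfolding im[symmetric] using inj by (simp add: sum.reindex)
    also have "\<dots> = (\<Sum>\<sigma> | \<sigma> permutes {..<3::nat}. eps (u @ m) * \<Phi> u)"
      using perm by (intro sum.cong) auto
    also have "\<dots> = 6 * (eps (u @ m) * \<Phi> u)"
      by (simp add: card_permutations[of _ 3] fact_numeral)
    finally show ?thesis .
  qed
  have "(\<Sum>m | length m = 4. \<Sum>i | length i = 3. eps (u @ m) * eps (i @ m) * \<Phi> i)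
      = (\<Sum>m | length m = 4. eps (u @ m) * (\<Sum>i | length i = 3. eps (i @ m) * \<Phi> i))"
    by (simp add: sum_distrib_left mult.assoc)
  also have "\<dots> = (\<Sum>m | length m = 4. if distinct (u @ m) then 6 * \<Phi> u else 0)"
  proof (intro sum.cong refl)
    fix m :: "7 list" assume "m \<in> {m. length m = 4}"
    then have m: "length m = 4" by simp
    show "eps (u @ m) * (\<Sum>i | length i = 3. eps (i @ m) * \<Phi> i) = (if distinct (u @ m) then 6 * \<Phi> u else 0)"
    proof (cases "distinct (u @ m)")
      case True
      have "eps (u @ m) * (6 * (eps (u @ m) * \<Phi> u)) = 6 * (eps (u @ m) * eps (u @ m)) * \<Phi> u"
        by (rule trans[OF mult.assoc[symmetric]]) (simp only: ac_simps)
      then show ?thesis unfolding inner[OF m True] eps_square if_P[OF True] by simp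
    next
      case False
      then have "eps (u @ m) = 0" using eps_eq_0_iff by blast
      then show ?thesis unfolding if_not_P[OF False] by (simp only: mult_zero_left)
    qed
  qed
  also have "\<dots> = (\<Sum>m | length m = 4 \<and> distinct m \<and> set m \<subseteq> - set u. 6 * \<Phi> u)"
    using True by (intro sum.mono_neutral_cong_right) auto
  also have "\<dots> = real (card {m. length m = 4 \<and> distinct m \<and> set m \<subseteq> - set u}) * (6 * \<Phi> u)" by simp
  also have "card {m. length m = 4 \<and> distinct m \<and> set m \<subseteq> - set u} = 24"
  proof -
    have "card (- set u) = 4" using u True distinct_card[of u] by (simp add: Compl_eq_Diff_UNIV card_Diff_subset)
    moreover have "{1..4::nat} = {1,2,3,4}" by auto
    ultimately show ?thesis
      using card_lists_distinct_length_eq[of "- set u" 4] by simp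
  qed
  finally show ?thesis by simp
qed

section \<open>The metric of a positive 3-form\<close>

lemma sum_lists_Suc:
  "(\<Sum>l :: 7 list | length l = Suc n. F l) = (\<Sum>\<^sub>7 a. \<Sum>l | length l = n. F (a # l))"
proof -
  have "(\<Sum>\<^sub>7 a. \<Sum>l | length l = n. F (a # l)) = (\<Sum>(a,l)\<in>UNIV \<times> {l. length l = n}. F (a # l))"
    by (simp add: sum.cartesian_product)
  also have "\<dots> = (\<Sum>l :: 7 list | length l = Suc n. F l)"
    by (rule sum.reindex_bij_witness[of _ "\<lambda>l. (hd l, tl l)" "\<lambda>(a,l). a # l"])
      (auto simp: length_Suc_conv)
  finally show ?thesis ..
qed

lemma sum_lists_0: "(\<Sum>l :: 7 list | length l = 0. F l) = F []"
  by simp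

lemma sum_lists_2: "(\<Sum>l :: 7 list | length l = 2. F l) = (\<Sum>\<^sub>7 a b. F [a,b])"
  by (simp only: eval_nat_numeral BitM.simps sum_lists_Suc sum_lists_0 One_nat_def)

lemma sum_lists_3: "(\<Sum>l :: 7 list | length l = 3. F l) = (\<Sum>\<^sub>7 a b c. F [a,b,c])"
  by (simp only: eval_nat_numeral BitM.simps sum_lists_Suc sum_lists_0 One_nat_def)

lemma sum_lists_4: "(\<Sum>l :: 7 list | length l = 4. F l)
    = (\<Sum>\<^sub>7 a b c d. F [a,b,c,d])"
  by (simp only: eval_nat_numeral BitM.simps sum_lists_Suc sum_lists_0 One_nat_def)

lemma sum_lists_7: "(\<Sum>l :: 7 list | length l = 7. F l)
    = (\<Sum>\<^sub>7 a b c d e f g. F [a,b,c,d,e,f,g])"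
  by (simp only: eval_nat_numeral BitM.simps sum_lists_Suc sum_lists_0 One_nat_def)

section \<open>Hitchin's bilinear form of a 3-form and the Hodge star of
  \<open>Q_form\<close>\<close>

definition eps7 :: "7 \<Rightarrow> 7 \<Rightarrow> 7 \<Rightarrow> 7 \<Rightarrow> 7 \<Rightarrow> 7 \<Rightarrow> 7 \<Rightarrow> real" where
  "eps7 a b c d e f g = eps [a,b,c,d,e,f,g]"

text \<open>The matrix B for which u^T B v is the coefficient of the 7-form Q(u,v). The divisor 24 =
  2! 2! 3! comes from wedging two 2-forms and a 3-form.\<close>

definition hitchin :: "(7 \<Rightarrow> 7 \<Rightarrow> 7 \<Rightarrow> real) \<Rightarrow> real^7^7" where
  "hitchin p = (\<chi> i j. (\<Sum>\<^sub>7 a b c d e f. \<Sum>g\<in>UNIV.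
     eps7 a b c d e f g * (p i a b * p j c d * p e f g)) / 24)"

definition comp3 :: "covector \<Rightarrow> 7 \<Rightarrow> 7 \<Rightarrow> 7 \<Rightarrow> real" where
  "comp3 \<phi> i j k = \<phi> [i, j, k]"

lemma wedge_4_3:
  assumes "length l = 7"
  shows "wedge 4 3 \<alpha> \<beta> l
    = (\<Sum>\<sigma> | \<sigma> permutes {..<7}. real_of_int (sign \<sigma>) *
        (\<alpha> (take 4 (permute_list \<sigma> l)) * \<beta> (drop 4 (permute_list \<sigma> l)))) / 144"
proof -
  have t: "take 4 (permute_list \<sigma> l) = map (\<lambda>a. l ! \<sigma> a) [0..<4]"
    and d: "drop 4 (permute_list \<sigma> l) = map (\<lambda>a. l ! \<sigma> a) [4..<7]" for \<sigma>
    using assms by (simp_all add: permute_list_def take_map drop_map)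
  show ?thesis
    unfolding wedge_def t d using assms by (simp add: fact_numeral mult.assoc)
qed

lemma wedge_2_2:
  assumes "length l = 7"
  shows "wedge 2 2 \<alpha> \<beta> (take 4 l)
    = (\<Sum>\<sigma> | \<sigma> permutes {..<4}. real_of_int (sign \<sigma>) *
        (\<alpha> (take 2 (permute_list \<sigma> l)) * \<beta> (take 2 (drop 2 (permute_list \<sigma> l))))) / 4"
proof -
  have t: "map (\<lambda>a. take 4 l ! \<sigma> a) [0..<2] = take 2 (permute_list \<sigma> l)"
    and d: "map (\<lambda>a. take 4 l ! \<sigma> a) [2..<4] = take 2 (drop 2 (permute_list \<sigma> l))"
    if "\<sigma> permutes {..<4}" for \<sigma>
  proof -
    have "\<sigma> a < 4" if "a < 4" for a
      using permutes_in_image[OF \<open>\<sigma> permutes {..<4}\<close>, of a] that by simp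
    then show "map (\<lambda>a. take 4 l ! \<sigma> a) [0..<2] = take 2 (permute_list \<sigma> l)"
      "map (\<lambda>a. take 4 l ! \<sigma> a) [2..<4] = take 2 (drop 2 (permute_list \<sigma> l))"
      using assms by (auto intro!: nth_equalityI simp: permute_list_def simp del: upt_rec_numeral)
  qed
  have "(\<Sum>\<sigma> | \<sigma> permutes {..<4}. real_of_int (sign \<sigma>) *
      \<alpha> (map (\<lambda>a. take 4 l ! \<sigma> a) [0..<2]) * \<beta> (map (\<lambda>a. take 4 l ! \<sigma> a) [2..<4]))
    = (\<Sum>\<sigma> | \<sigma> permutes {..<4}. real_of_int (sign \<sigma>) *
        (\<alpha> (take 2 (permute_list \<sigma> l)) * \<beta> (take 2 (drop 2 (permute_list \<sigma> l)))))"
    by (intro sum.cong refl) (simp only: t d mem_Collect_eq mult.assoc)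
  then show ?thesis
    unfolding wedge_def using assms by (simp add: fact_numeral)
qed

text \<open>The symbol already antisymmetrises all seven positions, so the 4! terms of the inner
  wedge product coincide: 4!/(2! 2!) times 1/(4! 3!) is 1/24.\<close>

lemma Q_form_idx7:
  "Q_form \<phi> u v idx7 = (\<Sum>l | length l = 7. eps l *
     (interior_prod u \<phi> (take 2 l) * interior_prod v \<phi> (take 2 (drop 2 l)) * \<phi> (drop 4 l))) / 24"
proof -
  let ?\<alpha> = "interior_prod u \<phi>" and ?\<beta> = "interior_prod v \<phi>"
  let ?F = "\<lambda>l. ?\<alpha> (take 2 l) * ?\<beta> (take 2 (drop 2 l)) * \<phi> (drop 4 l)"
  have perm: "(\<Sum>l | length l = 7. eps l * (real_of_int (sign \<sigma>) *
      (?\<alpha> (take 2 (permute_list \<sigma> l)) * ?\<beta> (take 2 (drop 2 (permute_list \<sigma> l)))) * \<phi> (drop 4 l)))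
    = (\<Sum>l | length l = 7. eps l * ?F l)" if s: "\<sigma> permutes {..<4}" for \<sigma>
  proof -
    have s7: "\<sigma> permutes {..<7}" using s by (rule permutes_subset) auto
    have d: "drop 4 (permute_list \<sigma> l) = drop 4 l" if "length l = 7" for l :: "7 list"
      using that permutes_not_in[OF s] by (intro nth_equalityI) (auto simp: permute_list_def)
    have "(\<Sum>l | length l = 7. eps l * (real_of_int (sign \<sigma>) *
      (?\<alpha> (take 2 (permute_list \<sigma> l)) * ?\<beta> (take 2 (drop 2 (permute_list \<sigma> l)))) * \<phi> (drop 4 l)))
      = (\<Sum>l | length l = 7. real_of_int (sign \<sigma>) * (eps l * ?F (permute_list \<sigma> l)))"
      by (intro sum.cong refl) (simp add: d)
    also have "\<dots> = real_of_int (sign \<sigma>) * (real_of_int (sign \<sigma>) * (\<Sum>l | length l = 7. eps l * ?F l))"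
      by (simp only: sum_distrib_left[symmetric] sum_eps_permute[OF s7, of ?F])
    finally show ?thesis by (simp add: mult.assoc[symmetric] flip: of_int_mult)
  qed
  have "Q_form \<phi> u v idx7
      = (\<Sum>\<sigma> | \<sigma> permutes {..<7}. real_of_int (sign \<sigma>) *
        (\<lambda>l. wedge 2 2 ?\<alpha> ?\<beta> (take 4 l) * \<phi> (drop 4 l)) (map (\<lambda>a. idx7 ! \<sigma> a) [0..<7])) / 144"
    unfolding Q_form_def wedge_4_3[OF length_idx7] permute_list_def length_idx7 ..
  also have "\<dots> = (\<Sum>l | length l = 7. eps l * (wedge 2 2 ?\<alpha> ?\<beta> (take 4 l) * \<phi> (drop 4 l))) / 144"
    by (simp only: sum_eps_eq_sum_permutes)
  also have "(\<Sum>l | length l = 7. eps l * (wedge 2 2 ?\<alpha> ?\<beta> (take 4 l) * \<phi> (drop 4 l)))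
    = (\<Sum>l | length l = 7. \<Sum>\<sigma> | \<sigma> permutes {..<4}. eps l * (real_of_int (sign \<sigma>) *
      (?\<alpha> (take 2 (permute_list \<sigma> l)) * ?\<beta> (take 2 (drop 2 (permute_list \<sigma> l)))) * \<phi> (drop 4 l)) / 4)"
    by (intro sum.cong refl)
      (simp add: wedge_2_2 sum_distrib_left sum_distrib_right sum_divide_distrib)
  also have "\<dots> = (\<Sum>\<sigma> | \<sigma> permutes {..<4::nat}. (\<Sum>l | length l = 7. eps l * ?F l) / 4)"
    by (subst sum.swap) (simp add: perm sum_divide_distrib[symmetric])
  also have "\<dots> = 6 * (\<Sum>l | length l = 7. eps l * ?F l)"
    by (simp add: card_permutations[of _ 4] fact_numeral)
  finally show ?thesis by simp
qed

lemma Q_form_eq_hitchin: "Q_form \<phi> u v idx7 = u \<bullet> (hitchin (comp3 \<phi>) *v v)"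
proof -
  define K where "K i j l = eps l * (\<phi> (i # take 2 l) * \<phi> (j # take 2 (drop 2 l)) * \<phi> (drop 4 l))" for i j l
  have h: "hitchin (comp3 \<phi>) $ i $ j = (\<Sum>l | length l = 7. K i j l) / 24" for i j
    unfolding hitchin_def K_def sum_lists_7 by (simp add: eps7_def comp3_def)
  have "Q_form \<phi> u v idx7 = (\<Sum>l | length l = 7. \<Sum>\<^sub>7 i j. u $ i * v $ j * K i j l) / 24"
    unfolding Q_form_idx7 interior_prod_def K_def sum_product
    by (simp add: sum_distrib_left sum_distrib_right mult_ac)
  also have "(\<Sum>l | length l = 7. \<Sum>\<^sub>7 i j. u $ i * v $ j * K i j l)
      = (\<Sum>\<^sub>7 i j. u $ i * v $ j * (\<Sum>l | length l = 7. K i j l))"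
    by (subst sum.swap, intro sum.cong refl, subst sum.swap) (simp add: sum_distrib_left)
  finally show ?thesis
    by (simp add: inner_vec_def matrix_vector_mult_def h sum_distrib_left sum_divide_distrib mult_ac)
qed

lemma sum_eps_prod_matrix':
  assumes "length a = 7"
  shows "(\<Sum>l | length l = 7. eps l * (\<Prod>k<7. P $ (l ! k) $ (a ! k))) = det (P :: real^7^7) * eps a"
  using sum_eps_prod_matrix[OF assms, of "transpose P", unfolded det_transpose] by (simp add: transpose_def)

text \<open>Raising the seven indices of a top form multiplies it by the determinant of the inverse
  metric; the 7! equal terms cancel the factorial in the star.\<close>

lemma hodge_7_Q:
  "hodge g 7 (Q_form \<phi> u v) [] = det (matrix_inv g) * sqrt (det g) * Q_form \<phi> u v idx7"
proof -
  let ?q = "matrix_inv g"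
  define F where "F l = wedge 2 2 (interior_prod u \<phi>) (interior_prod v \<phi>) (take 4 l) * \<phi> (drop 4 l)" for l
  have Q: "Q_form \<phi> u v l = (\<Sum>\<sigma> | \<sigma> permutes {..<7}. real_of_int (sign \<sigma>) * F (permute_list \<sigma> l)) / 144"
    if "length l = 7" for l
    using wedge_4_3[OF that] by (simp add: Q_form_def F_def)
  have Q7: "Q_form \<phi> u v idx7 = (\<Sum>l | length l = 7. eps l * F l) / 144"
    unfolding Q[OF length_idx7] sum_eps_eq_sum_permutes permute_list_def length_idx7 ..
  have "(\<Sum>n | length n = 7. eps n * Q_form \<phi> u v n)
      = (\<Sum>n | length n = 7. \<Sum>\<sigma> | \<sigma> permutes {..<7}. real_of_int (sign \<sigma>) * (eps n * F (permute_list \<sigma> n)) / 144)"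
    by (intro sum.cong refl) (simp add: Q sum_distrib_left sum_divide_distrib mult_ac)
  also have "\<dots> = (\<Sum>\<sigma> | \<sigma> permutes {..<7}. (real_of_int (sign \<sigma>) * (\<Sum>n | length n = 7. eps n * F (permute_list \<sigma> n))) / 144)"
    by (subst sum.swap) (simp add: sum_distrib_left sum_divide_distrib)
  also have "\<dots> = (\<Sum>\<sigma> | \<sigma> permutes {..<7::nat}. Q_form \<phi> u v idx7)"
  proof (intro sum.cong refl)
    fix \<sigma> assume "\<sigma> \<in> {\<sigma>. \<sigma> permutes {..<7::nat}}"
    then have s: "\<sigma> permutes {..<7}" by simp
    show "(real_of_int (sign \<sigma>) * (\<Sum>n | length n = 7. eps n * F (permute_list \<sigma> n))) / 144 = Q_form \<phi> u v idx7"
      unfolding sum_eps_permute[OF s] Q7 by (simp add: mult.assoc[symmetric] flip: of_int_mult)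
  qed
  also have "\<dots> = 5040 * Q_form \<phi> u v idx7"
    by (simp add: card_permutations[of _ 7] fact_numeral)
  finally have S: "(\<Sum>n | length n = 7. eps n * Q_form \<phi> u v n) = 5040 * Q_form \<phi> u v idx7" .
  have "(\<Sum>m | length m = 7. raise_all g 7 (Q_form \<phi> u v) m * (sqrt (det g) * eps m))
      = (\<Sum>m | length m = 7. \<Sum>n | length n = 7. sqrt (det g) * Q_form \<phi> u v n * (eps m * (\<Prod>k<7. ?q $ (m ! k) $ (n ! k))))"
    unfolding raise_all_def by (simp add: sum_distrib_right sum_distrib_left mult_ac)
  also have "\<dots> = (\<Sum>n | length n = 7. sqrt (det g) * Q_form \<phi> u v n * (\<Sum>m | length m = 7. eps m * (\<Prod>k<7. ?q $ (m ! k) $ (n ! k))))"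
    by (subst sum.swap) (simp add: sum_distrib_left)
  also have "\<dots> = (\<Sum>n | length n = 7. sqrt (det g) * det ?q * (eps n * Q_form \<phi> u v n))"
    by (intro sum.cong refl) (simp add: sum_eps_prod_matrix')
  also have "\<dots> = sqrt (det g) * det ?q * (5040 * Q_form \<phi> u v idx7)"
    by (simp only: S sum_distrib_left[symmetric])
  finally show ?thesis
    unfolding hodge_def by (simp add: fact_numeral)
qed

lemma eps7_swap:
  "eps7 b a c d e f g = - eps7 a b c d e f g"
  "eps7 a c b d e f g = - eps7 a b c d e f g"
  "eps7 a b d c e f g = - eps7 a b c d e f g"
  "eps7 a b c e d f g = - eps7 a b c d e f g"
  "eps7 a b c d f e g = - eps7 a b c d e f g"
  "eps7 a b c d e g f = - eps7 a b c d e f g"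
  using eps_transpose[of 0 "[a,b,c,d,e,f,g]" 1] eps_transpose[of 1 "[a,b,c,d,e,f,g]" 2]
    eps_transpose[of 2 "[a,b,c,d,e,f,g]" 3] eps_transpose[of 3 "[a,b,c,d,e,f,g]" 4]
    eps_transpose[of 4 "[a,b,c,d,e,f,g]" 5] eps_transpose[of 5 "[a,b,c,d,e,f,g]" 6]
  by (simp_all add: eps7_def)

text \<open>Exchanging two neighbouring pairs takes four adjacent swaps, hence no sign. All
  symmetries of contractions of the symbol with several 2-forms come from this.\<close>

lemma eps7_move_pair:
  "eps7 c d a b e f g = eps7 a b c d e f g"
  "eps7 a d e b c f g = eps7 a b c d e f g"
  "eps7 a b e f c d g = eps7 a b c d e f g"
  "eps7 a b c f g d e = eps7 a b c d e f g"
proof -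
  show "eps7 c d a b e f g = eps7 a b c d e f g"
    by (simp only: eps7_swap(2)[of c d a b] eps7_swap(1)[of c a d b] eps7_swap(3)[of a c d b]
        eps7_swap(2)[of a c b d] minus_minus)
  show "eps7 a d e b c f g = eps7 a b c d e f g"
    by (simp only: eps7_swap(3)[of a d e b c] eps7_swap(2)[of a d b e c] eps7_swap(4)[of a b d e c]
        eps7_swap(3)[of a b d c e] minus_minus)
  show "eps7 a b e f c d g = eps7 a b c d e f g"
    by (simp only: eps7_swap(4)[of a b e f c d] eps7_swap(3)[of a b e c f d] eps7_swap(5)[of a b c e f d]
        eps7_swap(4)[of a b c e d f] minus_minus)
  show "eps7 a b c f g d e = eps7 a b c d e f g"
    by (simp only: eps7_swap(5)[of a b c f g d e] eps7_swap(4)[of a b c f d g e]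
        eps7_swap(6)[of a b c d f g e] eps7_swap(5)[of a b c d f e g] minus_minus)
qed

lemma sum4_swap_pairs:
  "(\<Sum>a\<in>A. \<Sum>b\<in>A. \<Sum>c\<in>A. \<Sum>d\<in>A. F a b c d) = (\<Sum>c\<in>A. \<Sum>d\<in>A. \<Sum>a\<in>A. \<Sum>b\<in>A. F a b c d)"
proof -
  have "(\<Sum>a\<in>A. \<Sum>b\<in>A. \<Sum>c\<in>A. \<Sum>d\<in>A. F a b c d) = (\<Sum>a\<in>A. \<Sum>c\<in>A. \<Sum>b\<in>A. \<Sum>d\<in>A. F a b c d)"
    by (intro sum.cong refl sum.swap)
  also have "\<dots> = (\<Sum>c\<in>A. \<Sum>a\<in>A. \<Sum>d\<in>A. \<Sum>b\<in>A. F a b c d)"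
    by (subst sum.swap) (intro sum.cong refl sum.swap)
  also have "\<dots> = (\<Sum>c\<in>A. \<Sum>d\<in>A. \<Sum>a\<in>A. \<Sum>b\<in>A. F a b c d)"
    by (intro sum.cong refl sum.swap)
  finally show ?thesis .
qed

lemma sum3_rotate:
  "(\<Sum>a\<in>A. \<Sum>b\<in>A. \<Sum>c\<in>A. F a b c) = (\<Sum>c\<in>A. \<Sum>a\<in>A. \<Sum>b\<in>A. F a b c)"
proof -
  have "(\<Sum>a\<in>A. \<Sum>b\<in>A. \<Sum>c\<in>A. F a b c) = (\<Sum>a\<in>A. \<Sum>c\<in>A. \<Sum>b\<in>A. F a b c)"
    by (intro sum.cong refl sum.swap)
  also have "\<dots> = (\<Sum>c\<in>A. \<Sum>a\<in>A. \<Sum>b\<in>A. F a b c)" by (rule sum.swap)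
  finally show ?thesis .
qed

lemma sum3_rotate':
  "(\<Sum>a\<in>A. \<Sum>b\<in>A. \<Sum>c\<in>A. F a b c) = (\<Sum>b\<in>A. \<Sum>c\<in>A. \<Sum>a\<in>A. F a b c)"
  by (rule sum3_rotate[symmetric])

lemma hitchin_symmetric: "hitchin p $ i $ j = hitchin p $ j $ i"
  unfolding hitchin_def
  by (simp, subst sum4_swap_pairs) (intro sum.cong refl, simp add: eps7_move_pair(1) mult_ac)

text \<open>The vectors \<open>g *v v\<close> with \<open>v\<close> in \<open>V\<close> do not span
  the space, so a nonzero vector is Euclidean-orthogonal to all of them; it is then scaled to unit
  length for \<open>g\<close>.\<close>

lemma inner_product_matrix_orthogonal_vector:
  assumes g: "inner_product_matrix g" and V: "finite V" "card V < 7"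
  obtains x where "x \<bullet> (g *v x) = 1" "\<And>v. v \<in> V \<Longrightarrow> v \<bullet> (g *v x) = 0"
proof -
  have "dim (span ((\<lambda>v. g *v v) ` V)) \<le> card ((\<lambda>v. g *v v) ` V)"
    using V by (simp add: dim_le_card')
  also have "\<dots> \<le> card V" using V(1) by (rule card_image_le)
  finally have "dim (span ((\<lambda>v. g *v v) ` V)) < DIM(R7)" using V by simp
  then obtain y where y: "y \<noteq> 0" "\<And>z. z \<in> span ((\<lambda>v. g *v v) ` V) \<Longrightarrow> orthogonal y z"
    using orthogonal_to_subspace_exists[of "(\<lambda>v. g *v v) ` V"] by auto
  have sym: "a \<bullet> (g *v b) = b \<bullet> (g *v a)" for a b
    using g by (metis inner_product_matrix_def dot_lmul_matrix inner_commute vector_transpose_matrix)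
  let ?n = "y \<bullet> (g *v y)"
  have n: "?n > 0" using g y unfolding inner_product_matrix_def by auto
  show thesis
  proof
    show "(y /\<^sub>R sqrt ?n) \<bullet> (g *v (y /\<^sub>R sqrt ?n)) = 1"
    proof -
      have "sqrt ?n * sqrt ?n = ?n" using n by simp
      then show ?thesis using n by (simp add: matrix_vector_mult_scaleR field_simps)
    qed
    show "v \<bullet> (g *v (y /\<^sub>R sqrt ?n)) = 0" if "v \<in> V" for v
      using y(2)[of "g *v v"] that sym[of v y]
      by (simp add: matrix_vector_mult_scaleR orthogonal_def span_base)
  qed
qed

text \<open>Gram-Schmidt, as an induction on the set of indices that already carry a vector.\<close>

lemma orthonormal_frame_exists:
  assumes g: "inner_product_matrix g"
  obtains P :: "real^7^7" where "transpose P ** g ** P = mat 1"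
proof -
  have "\<exists>r :: 7 \<Rightarrow> R7. \<forall>i\<in>S. \<forall>j\<in>S. r i \<bullet> (g *v r j) = (if i = j then 1 else 0)" for S :: "7 set"
    using finite[of S]
  proof (induction S rule: finite_induct)
    case (insert i S)
    then obtain r :: "7 \<Rightarrow> R7" where r: "\<forall>i\<in>S. \<forall>j\<in>S. r i \<bullet> (g *v r j) = (if i = j then 1 else 0)" by auto
    have "card (r ` S) \<le> card S" using insert by (simp add: card_image_le)
    also have "card S < card (insert i S)" using insert by simp
    also have "\<dots> \<le> 7" using card_mono[of "UNIV::7 set" "insert i S"] by simp
    finally have "card (r ` S) < 7" .
    then obtain x where x: "x \<bullet> (g *v x) = 1" "\<And>v. v \<in> r ` S \<Longrightarrow> v \<bullet> (g *v x) = 0"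
      using inner_product_matrix_orthogonal_vector[OF g] insert by (metis finite_imageI)
    have sym: "a \<bullet> (g *v b) = b \<bullet> (g *v a)" for a b
      using g by (metis inner_product_matrix_def dot_lmul_matrix inner_commute vector_transpose_matrix)
    have "x \<bullet> (g *v r j) = 0" "r j \<bullet> (g *v x) = 0" if "j \<in> S" for j
      using x(2)[of "r j"] sym[of x "r j"] that by auto
    then show ?case
      by (intro exI[of _ "r(i := x)"]) (use insert x(1) r in auto)
  qed simp
  from this[of UNIV] obtain r :: "7 \<Rightarrow> R7"
    where r: "\<And>i j. r i \<bullet> (g *v r j) = (if i = j then 1 else 0)" by auto
  have "transpose (\<chi> a i. r i $ a) ** (g ** (\<chi> a i. r i $ a)) = mat 1"
    using r by (simp add: vec_eq_iff mat_def inner_vec_def matrix_matrix_mult_def matrix_vector_mult_def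
        transpose_def)
  then show thesis by (intro that[of "\<chi> a i. r i $ a"]) (simp add: matrix_mul_assoc)
qed

lemma det_scaleR: "det (c *\<^sub>R (A :: real^7^7)) = c ^ 7 * det A"
proof -
  have "c *\<^sub>R A = (\<chi> i. c *s (A $ i))" by (simp add: vec_eq_iff)
  then show ?thesis using det_rows_mul[of "\<lambda>_. c" "\<lambda>i. A $ i"] by simp
qed

text \<open>In odd dimension -P has the opposite determinant and is equally orthonormal, so the
  frame can be chosen positively oriented. Then \<open>sqrt (det g) * det P\<close> is 1 and not
  merely a sign, which later removes the volume factor from the Hitchin form.\<close>

lemma inner_product_matrix_frame:
  assumes "inner_product_matrix g"
  obtains P :: "real^7^7" where "transpose P ** g ** P = mat 1" "matrix_inv g = P ** transpose P"
    "det P > 0" "det g > 0" "sqrt (det g) * det P = 1" "g ** matrix_inv g = mat 1"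
proof -
  obtain P0 :: "real^7^7" where P0: "transpose P0 ** g ** P0 = mat 1"
    using orthonormal_frame_exists[OF assms] by blast
  have neg: "det (- P0) = - det P0"
    using det_scaleR[of "-1" P0] by simp
  have neg': "transpose (- P0) ** g ** (- P0) = mat 1"
    using P0 by (simp add: vec_eq_iff matrix_matrix_mult_def transpose_def sum_negf)
  have "det P0 * det g * det P0 = 1"
    using arg_cong[OF P0, of det] by (simp add: det_mul)
  then have "det P0 \<noteq> 0" by auto
  then obtain P where P: "transpose P ** g ** P = mat 1" "det P > 0"
  proof (cases "det P0 > 0")
    case True
    then show ?thesis using that P0 by blast
  next
    case False
    then have "det (- P0) > 0" using neg \<open>det P0 \<noteq> 0\<close> by simp
    then show ?thesis using that neg' by blast
  qed
  have d: "det P * det g * det P = 1"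
    using arg_cong[OF P(1), of det] by (simp add: det_mul)
  then have dg: "det g > 0"
  proof -
    have "det g * (det P * det P) > 0" using d by (simp add: mult_ac)
    then show ?thesis using P(2) by (simp add: zero_less_mult_iff)
  qed
  have "sqrt (det g) * det P = 1"
  proof -
    have "(sqrt (det g) * det P)\<^sup>2 = 1" using d dg by (simp add: power2_eq_square mult_ac power_mult_distrib)
    moreover have "sqrt (det g) * det P > 0" using dg P(2) by simp
    ultimately show ?thesis by (auto simp: power2_eq_1_iff)
  qed
  moreover have gi: "g ** (P ** transpose P) = mat 1" "(P ** transpose P) ** g = mat 1"
  proof -
    have "(transpose P ** g) ** P = mat 1" using P by simp
    then have "P ** (transpose P ** g) = mat 1" using matrix_left_right_inverse by blast
    then show "(P ** transpose P) ** g = mat 1" by (simp add: matrix_mul_assoc)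
    then show "g ** (P ** transpose P) = mat 1" using matrix_left_right_inverse by blast
  qed
  moreover have "matrix_inv g = P ** transpose P"
  proof -
    have inv: "matrix_inv g ** g = mat 1"
      unfolding matrix_inv_def by (rule someI2[of _ "P ** transpose P"]) (use gi in auto)
    have "matrix_inv g = matrix_inv g ** (g ** (P ** transpose P))" using gi by simp
    also have "\<dots> = P ** transpose P"
      using inv by (simp add: matrix_mul_assoc)
    finally show ?thesis .
  qed
  ultimately show thesis using that[OF P(1) _ P(2) dg] by simp
qed

text \<open>The density v = sqrt(det g) in closed form: B = 6 v g and det g = v^2 give det B = 6^7
  v^9, hence the ninth root.\<close>

definition vol_density :: "covector \<Rightarrow> real" where
  "vol_density \<phi> = root 9 (det (hitchin (comp3 \<phi>)) / 6 ^ 7)"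

lemma positive_covector_inner_product:
  assumes "positive_covector \<phi>"
  shows "inner_product_matrix (hitchin (comp3 \<phi>))"
  using assms hitchin_symmetric unfolding positive_covector_def inner_product_matrix_def
  by (simp add: Q_form_eq_hitchin vec_eq_iff transpose_def)

lemma matrix_eq_inner: "(\<And>a b. a \<bullet> ((A::real^7^7) *v b) = a \<bullet> (B *v b)) \<Longrightarrow> A = B"
  by (metis matrix_eq vector_eq_ldot)

text \<open>The defining equation is implicit, since the star is that of the unknown metric. A
  solution h must be B/(6t) with t = sqrt(det h), and taking determinants turns this into t^9 = v^9;
  so the explicit solution is the only one.\<close>

lemma G2_metric_eq:
  assumes "positive_covector \<phi>"
  shows "G2_metric \<phi> = inverse (6 * vol_density \<phi>) *\<^sub>R hitchin (comp3 \<phi>)"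
    and "inner_product_matrix (G2_metric \<phi>)"
    and "vol_density \<phi> > 0" and "sqrt (det (G2_metric \<phi>)) = vol_density \<phi>"
proof -
  let ?B = "hitchin (comp3 \<phi>)" and ?s = "vol_density \<phi>"
  have B: "inner_product_matrix ?B" by (rule positive_covector_inner_product[OF assms])
  have dB: "det ?B > 0" using inner_product_matrix_frame[OF B] by metis
  have s: "?s > 0" using dB by (simp add: vol_density_def)
  have s9: "?s ^ 9 * 6 ^ 7 = det ?B"
    using dB real_root_pow_pos2[of 9 "det ?B / 6 ^ 7"] by (simp add: vol_density_def)
  let ?g = "inverse (6 * ?s) *\<^sub>R ?B"
  have scaled: "inner_product_matrix (c *\<^sub>R ?B)" if "c > 0" for c
    using B that unfolding inner_product_matrix_def
    by (auto simp: vec_eq_iff transpose_def scaleR_matrix_vector_assoc[symmetric])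
  have g: "inner_product_matrix ?g" using s by (intro scaled) simp
  have det_scaled: "det (inverse (6 * t) *\<^sub>R ?B) = ?s ^ 9 / t ^ 7" if "t > 0" for t
    using s9 that by (simp add: det_scaleR field_simps power_mult_distrib)
  have "det ?g = ?s\<^sup>2"
    unfolding det_scaled[OF s] using s by (simp add: field_simps power_add[symmetric])
  then have sq: "sqrt (det ?g) = ?s" using s by simp
  have hodge_eq: "hodge h 7 (Q_form \<phi> a b) [] = a \<bullet> (?B *v b) / sqrt (det h)"
    if "inner_product_matrix h" for h a b
  proof -
    have "h ** matrix_inv h = mat 1" "det h > 0"
      using inner_product_matrix_frame[OF that] by metis+
    then have "det h * det (matrix_inv h) = 1" by (metis det_I det_mul)
    then have "det (matrix_inv h) = 1 / det h" using \<open>det h > 0\<close> by (simp add: field_simps)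
    then show ?thesis
      using \<open>det h > 0\<close> unfolding hodge_7_Q Q_form_eq_hitchin
      by (simp add: field_simps flip: real_sqrt_mult power2_eq_square)
  qed
  have "G2_metric \<phi> = ?g"
    unfolding G2_metric_def
  proof (rule the_equality, intro conjI allI)
    show "inner_product_matrix ?g" by fact
    show "6 * (a \<bullet> (?g *v b)) = hodge ?g 7 (Q_form \<phi> a b) []" for a b
      unfolding hodge_eq[OF g] sq using s by (simp add: scaleR_matrix_vector_assoc[symmetric] field_simps)
  next
    fix h assume h: "inner_product_matrix h \<and> (\<forall>a b. 6 * (a \<bullet> (h *v b)) = hodge h 7 (Q_form \<phi> a b) [])"
    let ?t = "sqrt (det h)"
    have t: "?t > 0" using inner_product_matrix_frame[of h] h by (metis real_sqrt_gt_zero)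
    have hB: "h = inverse (6 * ?t) *\<^sub>R ?B"
    proof (rule matrix_eq_inner)
      fix a b
      have "6 * (a \<bullet> (h *v b)) = a \<bullet> (?B *v b) / ?t" using h hodge_eq by metis
      then show "a \<bullet> (h *v b) = a \<bullet> (inverse (6 * ?t) *\<^sub>R ?B *v b)"
        using t by (simp add: scaleR_matrix_vector_assoc[symmetric] field_simps)
    qed
    have "?t\<^sup>2 = det h" using t by simp
    also have "det h = ?s ^ 9 / ?t ^ 7" using trans[OF arg_cong[OF hB, of det] det_scaled[OF t]] .
    finally have "?t ^ 9 = ?s ^ 9"
      using t by (simp add: field_simps power_add[symmetric] del: real_sqrt_pow2 real_sqrt_pow2_iff)
    then have "?t = ?s" using s t by (metis less_imp_le power_eq_imp_eq_base zero_less_numeral)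
    then have "inverse (6 * ?t) *\<^sub>R ?B = ?g" by (simp only:)
    with hB show "h = ?g" by (rule trans)
  qed
  then show "G2_metric \<phi> = ?g" "inner_product_matrix (G2_metric \<phi>)" "?s > 0"
    "sqrt (det (G2_metric \<phi>)) = ?s" using g s sq by simp_all
qed

section \<open>Schouten identities for a 3-form\<close>

definition alt3 :: "(7 \<Rightarrow> 7 \<Rightarrow> 7 \<Rightarrow> real) \<Rightarrow> bool" where
  "alt3 p \<longleftrightarrow> (\<forall>i j k. p j i k = - p i j k) \<and> (\<forall>i j k. p i k j = - p i j k)"

lemma alt3_swap:
  assumes "alt3 p"
  shows "p j i k = - p i j k" "p i k j = - p i j k" "p k j i = - p i j k" "p k i j = p i j k" "p j k i = p i j k"
proof -
  have A: "p j i k = - p i j k" and B: "p i k j = - p i j k" for i j k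
    using assms unfolding alt3_def by blast+
  show "p j i k = - p i j k" "p i k j = - p i j k" by (rule A, rule B)
  show "p k j i = - p i j k" "p k i j = p i j k" "p j k i = p i j k"
    using A[of j k i] B[of j i k] A[of j i k] A[of i k j] B[of i j k] by linarith+
qed

text \<open>A tensor quadratic in \<open>p\<close>. When the Hitchin form of \<open>p\<close> is 6
  times the identity, it turns out to be a multiple of \<open>p\<close>.\<close>

definition E7 :: "(7 \<Rightarrow> 7 \<Rightarrow> 7 \<Rightarrow> real) \<Rightarrow> 7 \<Rightarrow> 7 \<Rightarrow> 7 \<Rightarrow> real" where
  "E7 p y b c = (\<Sum>\<^sub>7 d e f g h. eps7 b c d e f g h * (p y d e * p f g h))"

text \<open>Up to a constant, the 6-form obtained by wedging the 2-forms that \<open>p\<close> gives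
  for the directions x, y, z, read as a vector by means of the symbol.\<close>

definition T7 :: "(7 \<Rightarrow> 7 \<Rightarrow> 7 \<Rightarrow> real) \<Rightarrow> 7 \<Rightarrow> 7 \<Rightarrow> 7 \<Rightarrow> 7 \<Rightarrow> real" where
  "T7 p b x y z = (\<Sum>\<^sub>7 c d e f g. \<Sum>h\<in>UNIV.
     eps7 b c d e f g h * (p x c d * p y e f * p z g h))"

lemma T7_symmetric: "T7 p b y x z = T7 p b x y z" "T7 p b x z y = T7 p b x y z"
proof -
  show "T7 p b y x z = T7 p b x y z"
    unfolding T7_def
    by (subst sum4_swap_pairs) (intro sum.cong refl, simp add: eps7_move_pair(2) mult_ac)
  show "T7 p b x z y = T7 p b x y z"
    unfolding T7_def
  proof (rule sum.cong[OF refl], rule sum.cong[OF refl])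
    fix c d
    show "(\<Sum>\<^sub>7 e f g h. eps7 b c d e f g h * (p x c d * p z e f * p y g h))
        = (\<Sum>\<^sub>7 e f g h. eps7 b c d e f g h * (p x c d * p y e f * p z g h))"
      by (subst sum4_swap_pairs) (intro sum.cong refl, simp add: eps7_move_pair(4) mult_ac)
  qed
qed

lemma E7_skew: "E7 p y c b = - E7 p y b c"
  unfolding E7_def by (simp only: eps7_swap(1)[of c b] mult_minus_left sum_negf)

lemma sum_if_outer: "(\<Sum>x\<in>A. if P then f x else 0) = (if P then (\<Sum>x\<in>A. f x) else (0::real))"
  by simp

lemma if_mult: "(if P then x else 0) * y = (if P then x * y else (0::real))"
  by simp

text \<open>The 8-index identity is applied to the cubic integrand of the Hitchin form. Replacing an
  index in the pair of the first factor, in the pair of the second or in the triple of the third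
  gives two, two and three equal terms.\<close>

lemma hitchin_schouten:
  assumes p: "alt3 p"
  shows "(if a = b then 24 * hitchin p $ x $ y else 0)
    = 2 * (\<Sum>\<^sub>7 c. p x a c * E7 p y b c) + 2 * (\<Sum>\<^sub>7 c. p y a c * E7 p x b c) + 3 * T7 p b x y a"
proof -
  note sw = alt3_swap[OF p]
  define F where "F l = p x (l!0) (l!1) * p y (l!2) (l!3) * p (l!4) (l!5) (l!6)" for l
  define S where "S k = (\<Sum>l | length l = 7. (if l ! k = a then eps (l[k := b]) else 0) * F l)" for k
  let ?P = "\<lambda>x y. \<Sum>\<^sub>7 c. p x a c * E7 p y b c"
  have P: "?P x y = (\<Sum>\<^sub>7 c d e f g. \<Sum>h\<in>UNIV.
      eps7 b c d e f g h * (p x a c * p y d e * p f g h))" for x y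
    unfolding E7_def by (simp add: sum_distrib_left mult_ac)
  have P': "?P y x = (\<Sum>\<^sub>7 d e c f g. \<Sum>h\<in>UNIV.
      eps7 d e b c f g h * (p x d e * p y a c * p f g h))"
    unfolding P by (subst sum3_rotate') (simp add: eps7_move_pair(1) mult_ac)
  have "(if a = b then 24 * hitchin p $ x $ y else 0) = (\<Sum>l | length l = 7. (if a = b then eps l else 0) * F l)"
    unfolding hitchin_def sum_lists_7 F_def by (simp add: eps7_def)
  also have "\<dots> = (\<Sum>l | length l = 7. (\<Sum>k<7. if l ! k = a then eps (l[k := b]) else 0) * F l)"
    by (intro sum.cong refl) (simp add: eps_schouten)
  also have "\<dots> = (\<Sum>k<7. S k)"
    unfolding S_def by (subst sum.swap) (simp only: sum_distrib_right)
  also have "\<dots> = S 0 + S 1 + S 2 + S 3 + S 4 + S 5 + S 6"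
    by (simp add: lessThan_nat_numeral add_ac)
  also have "S 0 = ?P x y"
    unfolding S_def sum_lists_7 P by (simp add: F_def eps7_def if_mult sum_if_outer sum.delta)
  also have "S 1 = ?P x y"
    unfolding S_def sum_lists_7 P
    by (simp add: F_def if_mult sum_if_outer sum.delta flip: eps7_def, intro sum.cong refl,
        subst eps7_swap(1), simp add: sw(2)[of x a])
  also have "S 2 = ?P y x"
    unfolding S_def sum_lists_7 P' by (simp add: F_def eps7_def if_mult sum_if_outer sum.delta)
  also have "S 3 = ?P y x"
    unfolding S_def sum_lists_7 P'
    by (simp add: F_def if_mult sum_if_outer sum.delta flip: eps7_def, intro sum.cong refl,
        subst eps7_swap(3), simp add: sw(2)[of y a])
  also have "S 4 = T7 p b x y a"
    unfolding S_def sum_lists_7 T7_def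
    by (simp add: F_def if_mult sum_if_outer sum.delta flip: eps7_def, intro sum.cong refl,
        subst eps7_swap(4), subst eps7_swap(3), subst eps7_swap(2), subst eps7_swap(1), simp)
  also have "S 5 = T7 p b x y a"
    unfolding S_def sum_lists_7 T7_def
    by (simp add: F_def if_mult sum_if_outer sum.delta flip: eps7_def, intro sum.cong refl,
        subst eps7_swap(5), subst eps7_swap(4), subst eps7_swap(3), subst eps7_swap(2),
        subst eps7_swap(1), simp add: sw(1)[of a])
  also have "S 6 = T7 p b x y a"
    unfolding S_def sum_lists_7 T7_def
    by (simp add: F_def if_mult sum_if_outer sum.delta flip: eps7_def, intro sum.cong refl,
        subst eps7_swap(6), subst eps7_swap(5), subst eps7_swap(4), subst eps7_swap(3), subst eps7_swap(2),
        subst eps7_swap(1), simp add: sw(4)[of a])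
  finally show ?thesis by simp
qed

section \<open>The cross product of a positive 3-form\<close>

definition kd :: "7 \<Rightarrow> 7 \<Rightarrow> real" where "kd i j = (if i = j then 1 else 0)"

lemma kd_same [simp]: "kd i i = 1" by (simp add: kd_def)

lemma kd_commute: "kd i j = kd j i" by (simp add: kd_def)

lemma sum_kd [simp]: "(\<Sum>\<^sub>7 i. f i * kd i j) = f j" "(\<Sum>\<^sub>7 i. f i * kd j i) = f j"
  "(\<Sum>\<^sub>7 i. kd i j * f i) = f j" "(\<Sum>\<^sub>7 i. kd j i * f i) = f j"
  by (simp_all add: kd_def if_mult if_distrib[of "(*) _"] cong: if_cong)

lemma matrix_mult_uminus:
  fixes A B :: "real^7^7"
  shows "A ** (- B) = - (A ** B)" "(- A) ** B = - (A ** B)" "transpose (- A) = - transpose A"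
    "(- A) *v x = - (A *v x)"
  by (simp_all add: matrix_matrix_mult_def transpose_def matrix_vector_mult_def vec_eq_iff sum_negf)

text \<open>In the sum over the cyclic shifts of x, y, a the terms with \<open>E7\<close> cancel,
  because \<open>p\<close> is skew in its first two indices; nine copies of the symmetric
  \<open>T7\<close> remain, and 144/9 = 16. The scale \<kappa> admits frames of either
  orientation.\<close>

lemma T7_eq:
  assumes p: "alt3 p" and B: "\<And>i j. hitchin p $ i $ j = 6 * \<kappa> * kd i j"
  shows "T7 p b x y a = 16 * \<kappa> * (kd a b * kd x y + kd x b * kd y a + kd y b * kd a x)"
proof -
  let ?P = "\<lambda>x a y. \<Sum>\<^sub>7 c. p x a c * E7 p y b c"
  have S: "144 * \<kappa> * (kd a b * kd x y) = 2 * ?P x a y + 2 * ?P y a x + 3 * T7 p b x y a" for a x y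
    using hitchin_schouten[OF p, of a b x y] by (auto simp: B kd_def split: if_splits)
  have skew: "?P a x y = - ?P x a y" for a x y
    by (simp add: alt3_swap(1)[OF p, of a x] sum_negf)
  have T: "T7 p b y a x = T7 p b x y a" "T7 p b a x y = T7 p b x y a"
    by (metis T7_symmetric)+
  show ?thesis
    using S[of a x y] S[of x y a] S[of y a x] skew[of a x y] skew[of y x a] skew[of a y x]
    unfolding T by (simp add: algebra_simps)
qed

text \<open>With the value of \<open>T7\<close> for \<kappa> = 1 inserted, the 8-index identity
  becomes a polarised inverse relation between \<open>p\<close> and \<open>E7 p\<close>; dividing by
  24 normalises the right-hand side.\<close>

lemma E7_relation:
  assumes p: "alt3 p" and B: "\<And>i j. hitchin p $ i $ j = 6 * kd i j"
  shows "(\<Sum>\<^sub>7 c. p x a c * (E7 p y b c / 24)) + (\<Sum>\<^sub>7 c. p y a c * (E7 p x b c / 24))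
    = 2 * kd a b * kd x y - kd x b * kd y a - kd y b * kd a x"
proof -
  let ?P = "\<lambda>x a y. \<Sum>\<^sub>7 c. p x a c * E7 p y b c"
  have "144 * (kd a b * kd x y) = 2 * ?P x a y + 2 * ?P y a x + 3 * T7 p b x y a"
    using hitchin_schouten[OF p, of a b x y] by (auto simp: B kd_def split: if_splits)
  then have "?P x a y + ?P y a x = 48 * (kd a b * kd x y) - 24 * (kd x b * kd y a) - 24 * (kd y b * kd a x)"
    using T7_eq[OF p, of 1 b x y a] B by (simp add: algebra_simps)
  then show ?thesis
    by (simp add: sum_divide_distrib[symmetric] add_divide_distrib[symmetric])
qed

text \<open>The 2-form that \<open>p\<close> gives for the direction x, as a matrix. For alternating
  \<open>p\<close> it sends y to minus the cross product of x and y.\<close>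

definition slot :: "(7 \<Rightarrow> 7 \<Rightarrow> 7 \<Rightarrow> real) \<Rightarrow> R7 \<Rightarrow> real^7^7" where
  "slot p x = (\<chi> a c. \<Sum>\<^sub>7 i. x $ i * p i a c)"

lemma slot_axis: "slot p (axis i 1) $ a $ c = p i a c"
  by (simp add: slot_def axis_def if_mult)

lemma slot_add: "slot p (x + y) = slot p x + slot p y"
  by (simp add: slot_def vec_eq_iff distrib_right sum.distrib)

lemma slot_skew:
  assumes "\<And>i a c. p i c a = - p i a c"
  shows "transpose (slot p x) = - slot p x"
proof -
  have *: "(\<Sum>\<^sub>7 i. x $ i * p i c a) = - (\<Sum>\<^sub>7 i. x $ i * p i a c)" for a c
    unfolding assms[of _ c a] by (simp add: sum_negf)
  show ?thesis by (simp add: slot_def vec_eq_iff transpose_def, intro allI, rule *)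
qed

definition outer :: "R7 \<Rightarrow> real^7^7" where
  "outer x = (\<chi> a b. x $ a * x $ b)"

lemma outer_mult_vec: "outer x *v y = (x \<bullet> y) *\<^sub>R x"
  by (simp add: outer_def vec_eq_iff matrix_vector_mult_def inner_vec_def sum_distrib_left mult_ac)

text \<open>The hypothesis is the identity polarised in the first indices; contracting both of them
  with x recovers twice the quadratic version.\<close>

lemma slot_product:
  assumes R: "\<And>x y a b. (\<Sum>\<^sub>7 c. p x a c * e y b c) + (\<Sum>\<^sub>7 c. p y a c * e x b c)
      = \<nu> * (2 * kd a b * kd x y - kd x b * kd y a - kd y b * kd a x)"
  shows "slot p x ** transpose (slot e x) = \<nu> *\<^sub>R ((x \<bullet> x) *\<^sub>R mat 1 - outer x)"
proof -
  have "2 * (slot p x ** transpose (slot e x)) $ a $ b = 2 * (\<nu> *\<^sub>R ((x \<bullet> x) *\<^sub>R mat 1 - outer x)) $ a $ b" for a b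
  proof -
    let ?Z = "\<lambda>i j. \<Sum>\<^sub>7 c. p i a c * e j b c"
    have "(slot p x ** transpose (slot e x)) $ a $ b = (\<Sum>\<^sub>7 c i j. x $ i * x $ j * (p i a c * e j b c))"
      unfolding slot_def matrix_matrix_mult_def transpose_def by (simp add: sum_product) (simp add: mult_ac)
    also have "\<dots> = (\<Sum>\<^sub>7 i j. x $ i * x $ j * ?Z i j)"
      by (subst sum3_rotate') (simp add: sum_distrib_left)
    finally have 1: "(slot p x ** transpose (slot e x)) $ a $ b = (\<Sum>\<^sub>7 i j. x $ i * x $ j * ?Z i j)" .
    also have "\<dots> = (\<Sum>\<^sub>7 i j. x $ i * x $ j * ?Z j i)"
      by (subst sum.swap) (simp add: mult_ac)
    finally have 2: "(slot p x ** transpose (slot e x)) $ a $ b = (\<Sum>\<^sub>7 i j. x $ i * x $ j * ?Z j i)" .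
    have "2 * (slot p x ** transpose (slot e x)) $ a $ b = (\<Sum>\<^sub>7 i j. x $ i * x $ j * (?Z i j + ?Z j i))"
      using 1 2 by (simp add: distrib_left sum.distrib)
    also have "\<dots> = (\<Sum>\<^sub>7 i j. x $ i * x $ j * (\<nu> * (2 * kd a b * kd i j - kd i b * kd j a - kd j b * kd a i)))"
      unfolding R ..
    also have "\<dots> = \<nu> * (2 * kd a b * (\<Sum>\<^sub>7 i j. x $ i * (x $ j * kd i j))
        - (\<Sum>\<^sub>7 i j. (x $ i * kd i b) * (x $ j * kd j a))
        - (\<Sum>\<^sub>7 i j. (x $ i * kd a i) * (x $ j * kd j b)))"
      by (simp only: right_diff_distrib sum_subtractf sum_distrib_left mult_ac)
    also have "\<dots> = \<nu> * (2 * kd a b * (x \<bullet> x) - 2 * (x $ a * x $ b))"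
      unfolding sum_product[symmetric] by (simp add: inner_vec_def flip: sum_distrib_left)
    also have "\<dots> = 2 * (\<nu> *\<^sub>R ((x \<bullet> x) *\<^sub>R mat 1 - outer x)) $ a $ b"
      by (simp add: outer_def mat_def kd_def algebra_simps)
    finally show ?thesis .
  qed
  then show ?thesis by (simp add: vec_eq_iff)
qed

lemma skew_form_zero:
  fixes E :: "real^7^7"
  assumes "transpose E = - E"
  shows "x \<bullet> (E *v x) = 0"
proof -
  have "x \<bullet> (E *v x) = (transpose E *v x) \<bullet> x"
    by (metis dot_lmul_matrix vector_transpose_matrix inner_commute)
  then show ?thesis using assms by (simp add: matrix_mult_uminus inner_commute)
qed

text \<open>
  By the Schouten identity the maps \<open>A = slot p\<close> and \<open>E = slot e\<close>, where \<open>e\<close> is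
  quadratic in \<open>p\<close>, are inverse to each other up to the projection \<open>|x|\<^sup>2 - x x\<^sup>T\<close>. Since both are
  linear in \<open>x\<close>, they are proportional: \<open>A = E N\<close> with a symmetric \<open>N\<close> that commutes with all \<open>E x\<close>,
  hence with all \<open>x x\<^sup>T\<close>.
\<close>

lemma inverse_slots_proportional:
  assumes p: "alt3 p" and skew: "\<And>i a c. e i c a = - e i a c"
    and R: "\<And>x y a b. (\<Sum>\<^sub>7 c. p x a c * e y b c) + (\<Sum>\<^sub>7 c. p y a c * e x b c)
      = 2 * kd a b * kd x y - kd x b * kd y a - kd y b * kd a x"
  obtains \<nu> where "\<nu> > 0" "\<And>i j k. p i j k = \<nu> * e i j k"
proof -
  let ?A = "slot p" and ?E = "slot e"
  define G where "G x = (x \<bullet> x) *\<^sub>R mat 1 - outer x" for x :: R7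
  have tA: "transpose (?A x) = - ?A x" for x
    using slot_skew[of p] alt3_swap(2)[OF p] by blast
  have tE: "transpose (?E x) = - ?E x" for x
    using slot_skew[of e] skew by blast
  have tG: "transpose (G x) = G x" for x
    by (simp add: G_def outer_def vec_eq_iff transpose_def mat_def)
  have AE: "?A x ** ?E x = - G x" for x
  proof -
    have "- (?A x ** ?E x) = G x"
      using slot_product[of p e 1 x] R by (simp add: tE G_def matrix_mult_uminus)
    then show ?thesis by (metis minus_minus)
  qed
  have EA: "?E x ** ?A x = - G x" for x
  proof -
    have "transpose (?A x ** ?E x) = ?E x ** ?A x"
      by (simp add: matrix_transpose_mul tA tE matrix_mult_uminus)
    then show ?thesis by (simp add: AE matrix_mult_uminus tG)
  qed
  \<comment> \<open>\<open>E x\<close> commutes with \<open>G x\<close>, as both products of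
    \<open>A x\<close> and \<open>E x\<close> are \<open>- G x\<close>. So \<open>G x\<close> kills
    \<open>E x\<close> applied to x; by skewness that vector is orthogonal to x, where
    \<open>G x\<close> is multiplication by |x|^2.\<close>
  have Exx: "?E x *v x = 0" for x
  proof (cases "x = 0")
    case False
    have "G x ** ?E x = ?E x ** G x"
      using matrix_mul_assoc[of "?E x" "?A x" "?E x"]
      by (simp add: AE EA matrix_mult_uminus)
    then have "G x *v (?E x *v x) = ?E x *v (G x *v x)"
      by (simp add: matrix_vector_mul_assoc)
    moreover have "G x *v x = 0"
      by (simp add: G_def matrix_vector_mult_diff_rdistrib outer_mult_vec scaleR_matrix_vector_assoc[symmetric])
    ultimately have "(x \<bullet> x) *\<^sub>R (?E x *v x) = 0"
      by (simp add: G_def matrix_vector_mult_diff_rdistrib outer_mult_vec scaleR_matrix_vector_assoc[symmetric] skew_form_zero[OF tE])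
    then show ?thesis using False by simp
  qed simp
  have alt_e: "alt3 e"
  proof -
    have "?E x *v y + ?E y *v x = 0" for x y
      using Exx[of "x + y"] Exx[of x] Exx[of y]
      by (simp add: slot_add matrix_vector_mult_add_rdistrib matrix_vector_right_distrib add.commute)
    then have "(?E (axis i 1) *v axis j 1) $ a + (?E (axis j 1) *v axis i 1) $ a = 0" for i j a
      by (metis vector_add_component zero_index)
    then have "e i a j + e j a i = 0" for i j a
      by (simp add: matrix_vector_mult_basis column_def slot_axis)
    then have "e j i k = - e i j k" for i j k
      using skew[of j k i] skew[of i k j] by (smt (verit))
    then show ?thesis using skew unfolding alt3_def by blast
  qed
  \<comment> \<open>\<open>Y\<close> is the deviation of the contraction from the identity on
    2-vectors. It is skew under the exchanges (12), (34) and (13), hence totally skew, and this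
    makes \<open>X\<close> symmetric in its two index pairs.\<close>
  define X where "X i j k l = (\<Sum>\<^sub>7 m. e i j m * p k l m)" for i j k l
  define Y where "Y i j k l = X i j k l - (kd i k * kd j l - kd i l * kd j k)" for i j k l
  have Y12: "Y j i k l = - Y i j k l" for i j k l
    unfolding Y_def X_def by (simp add: alt3_swap(1)[OF alt_e, of j i] sum_negf algebra_simps)
  have Y34: "Y i j l k = - Y i j k l" for i j k l
    unfolding Y_def X_def by (simp add: alt3_swap(1)[OF p, of l k] sum_negf algebra_simps)
  have Y13: "Y k j i l = - Y i j k l" for i j k l
    using R[of k l i j] unfolding Y_def X_def
    by (simp add: mult.commute[of "p _ _ _"] kd_commute[of k i] kd_commute[of l j] kd_commute[of k j] kd_commute[of l i] kd_commute[of l k] kd_commute[of j i] algebra_simps)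
  have X_sym: "X i j k l = X k l i j" for i j k l
  proof -
    have "Y i j k l = Y k l i j"
      using Y13[of i j k l] Y12[of k j i l] Y34[of j k i l] Y13[of j k l i] Y12[of l k j i] Y34[of k l j i]
      by linarith
    then show ?thesis
      unfolding Y_def by (simp add: kd_commute[of k i] kd_commute[of l j] kd_commute[of k j] kd_commute[of l i] algebra_simps)
  qed
  have tr: "(\<Sum>\<^sub>7 k l. e k l m * p k l n) = 6 * kd m n" for m n
  proof -
    have "2 * (\<Sum>\<^sub>7 k c. p k n c * e k m c) = (\<Sum>\<^sub>7 k. 2 * kd n m * kd k k - kd k m * kd k n - kd k m * kd n k)"
      unfolding R[symmetric] by (simp add: sum_distrib_left)
    also have "\<dots> = 12 * kd m n"
      by (simp add: sum_subtractf kd_commute[of n m])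
    finally have "(\<Sum>\<^sub>7 k c. p k n c * e k m c) = 6 * kd m n" by simp
    then show ?thesis
      by (simp add: alt3_swap(2)[OF alt_e, of _ m] alt3_swap(2)[OF p, of _ n] mult.commute)
  qed
  \<comment> \<open>Pair symmetry of \<open>X\<close> moves the contraction onto the trace just
    computed, so this Gram matrix of \<open>p\<close> satisfies p = e N; the trace 6 explains the
    divisor.\<close>
  define N where "N = (\<chi> m n. (\<Sum>\<^sub>7 k l. p k l m * p k l n) / 6)"
  have pN: "p i j n = (\<Sum>\<^sub>7 m. e i j m * N $ m $ n)" for i j n
  proof -
    have "(\<Sum>\<^sub>7 m. e i j m * N $ m $ n) = (\<Sum>\<^sub>7 m k l. e i j m * p k l m * p k l n) / 6"
      by (simp add: N_def sum_distrib_left sum_divide_distrib mult_ac)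
    also have "\<dots> = (\<Sum>\<^sub>7 k l. X i j k l * p k l n) / 6"
      by (subst sum3_rotate') (simp add: X_def sum_distrib_right)
    also have "\<dots> = (\<Sum>\<^sub>7 k l. X k l i j * p k l n) / 6"
      by (simp add: X_sym[of i j])
    also have "\<dots> = (\<Sum>\<^sub>7 k l m. p i j m * (e k l m * p k l n)) / 6"
      by (simp add: X_def sum_distrib_left sum_distrib_right mult_ac)
    also have "\<dots> = (\<Sum>\<^sub>7 m. p i j m * (6 * kd m n)) / 6"
      by (subst sum3_rotate) (simp add: sum_distrib_left[symmetric] tr)
    also have "\<dots> = p i j n" by (simp add: mult.left_commute[of _ 6] flip: sum_distrib_left)
    finally show ?thesis ..
  qed
  have N_sym: "transpose N = N"
    by (simp add: N_def vec_eq_iff transpose_def mult.commute)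
  have AN: "?A x = ?E x ** N" for x
  proof -
    have "(?E x ** N) $ a $ c = (\<Sum>\<^sub>7 m i. x $ i * (e i a m * N $ m $ c))" for a c
      by (simp add: slot_def matrix_matrix_mult_def sum_distrib_left sum_distrib_right mult_ac)
    also have "\<dots> a c = (\<Sum>\<^sub>7 i. x $ i * p i a c)" for a c
      by (subst sum.swap) (simp add: sum_distrib_left[symmetric] pN[symmetric])
    finally show ?thesis by (simp add: slot_def vec_eq_iff)
  qed
  have EN: "?E x ** N = N ** ?E x" for x
    using tA[of x] by (simp add: AN matrix_transpose_mul tE N_sym matrix_mult_uminus)
  have GN: "G x ** N = N ** G x" for x
  proof -
    have "G x = - (?E x ** (?E x ** N))" using EA[of x] by (simp add: AN)
    then show ?thesis
      by (simp add: matrix_mult_uminus matrix_mul_assoc EN)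
        (metis EN matrix_mul_assoc)
  qed
  \<comment> \<open>N commutes with the outer product of x for every x, so every vector is an
    eigenvector and N is a multiple of the identity.\<close>
  have xN: "(x \<bullet> x) *\<^sub>R (N *v x) = (x \<bullet> (N *v x)) *\<^sub>R x" for x
  proof -
    have "G x *v (N *v x) = N *v (G x *v x)"
      using GN[of x] by (simp add: matrix_vector_mul_assoc)
    moreover have "G x *v x = 0"
      by (simp add: G_def matrix_vector_mult_diff_rdistrib outer_mult_vec scaleR_matrix_vector_assoc[symmetric])
    ultimately show ?thesis
      by (simp add: G_def matrix_vector_mult_diff_rdistrib outer_mult_vec scaleR_matrix_vector_assoc[symmetric])
  qed
  define \<nu> where "\<nu> = N $ 0 $ 0"
  have off: "N $ a $ i = 0" if "a \<noteq> i" for a i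
    using arg_cong[OF xN[of "axis i 1"], of "\<lambda>v. v $ a"] that
    by (simp add: inner_axis_axis matrix_vector_mult_basis column_def) (simp add: axis_def)
  have N_axis: "N *v axis i 1 = (N $ i $ i) *\<^sub>R axis i 1" for i
    using off unfolding matrix_vector_mult_basis by (auto simp: column_def vec_eq_iff axis_def)
  have diag: "N $ i $ i = N $ j $ j" for i j
  proof (cases "i = j")
    case False
    let ?x = "axis i 1 + axis j 1 :: R7"
    have "N *v ?x = (N $ i $ i) *\<^sub>R axis i 1 + (N $ j $ j) *\<^sub>R axis j 1"
      by (simp add: matrix_vector_right_distrib N_axis)
    then have *: "2 *\<^sub>R ((N $ i $ i) *\<^sub>R axis i 1 + (N $ j $ j) *\<^sub>R axis j 1) = (N $ i $ i + N $ j $ j) *\<^sub>R ?x"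
      using xN[of ?x] False by (simp add: inner_add inner_axis_axis)
    show ?thesis
      using arg_cong[OF *, of "\<lambda>v. v $ i"] False by (simp add: axis_def)
  qed simp
  have p\<nu>: "p i j k = \<nu> * e i j k" for i j k
  proof -
    have "p i j k = (\<Sum>\<^sub>7 m. (e i j m * \<nu>) * kd m k)"
      unfolding pN[of i j k]
      by (intro sum.cong refl) (use off diag[of _ 0] in \<open>auto simp: \<nu>_def kd_def\<close>)
    then show ?thesis by simp
  qed
  have "\<nu> \<ge> 0" unfolding \<nu>_def N_def by (simp add: sum_nonneg)
  moreover have "\<nu> \<noteq> 0"
  proof
    assume "\<nu> = 0"
    then have "p i j k = 0" for i j k using p\<nu> by simp
    then show False using tr[of 0 0] by simp
  qed
  ultimately have "\<nu> > 0" by simp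
  then show thesis using that p\<nu> by blast
qed

section \<open>Adapted frames\<close>

definition pull3 :: "real^7^7 \<Rightarrow> (7 \<Rightarrow> 7 \<Rightarrow> 7 \<Rightarrow> real) \<Rightarrow> 7 \<Rightarrow> 7 \<Rightarrow> 7 \<Rightarrow> real" where
  "pull3 P p i j k = (\<Sum>\<^sub>7 a b c. P $ a $ i * P $ b $ j * P $ c $ k * p a b c)"

lemma alt3_pull3:
  assumes "alt3 p"
  shows "alt3 (pull3 P p)"
  unfolding alt3_def
proof (intro conjI allI)
  fix i j k
  have "pull3 P p j i k = (\<Sum>\<^sub>7 b a c. P $ a $ j * P $ b $ i * P $ c $ k * p a b c)"
    unfolding pull3_def by (rule sum.swap)
  also have "\<dots> = - pull3 P p i j k"
    unfolding pull3_def sum_negf[symmetric]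
    by (intro sum.cong refl) (subst alt3_swap(1)[OF assms], simp)
  finally show "pull3 P p j i k = - pull3 P p i j k" .
  have "pull3 P p i k j = (\<Sum>\<^sub>7 a c b. P $ a $ i * P $ b $ k * P $ c $ j * p a b c)"
    unfolding pull3_def by (intro sum.cong refl sum.swap)
  also have "\<dots> = - pull3 P p i j k"
    unfolding pull3_def sum_negf[symmetric]
    by (intro sum.cong refl) (subst alt3_swap(2)[OF assms], simp)
  finally show "pull3 P p i k j = - pull3 P p i j k" .
qed

lemma sum7_product:
  "(\<Sum>a\<in>A. \<Sum>b\<in>A. \<Sum>c\<in>A. \<Sum>d\<in>A. \<Sum>e\<in>A. \<Sum>f\<in>A. \<Sum>g\<in>A. F a b * G c d * H e f g)
    = (\<Sum>a\<in>A. \<Sum>b\<in>A. F a b) * (\<Sum>c\<in>A. \<Sum>d\<in>A. G c d) * (\<Sum>e\<in>A. \<Sum>f\<in>A. \<Sum>g\<in>A. H e f g :: real)"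
  by (simp only: sum_distrib_left[symmetric] sum_distrib_right[symmetric])

text \<open>Two free indices transform as a bilinear form, and the seven contracted with the symbol
  produce the determinant: the form takes values in 7-forms.\<close>

lemma hitchin_pull3: "hitchin (pull3 P p) = det P *\<^sub>R (transpose P ** hitchin p ** P)"
proof -
  define K where "K i j m = p i (m!0) (m!1) * p j (m!2) (m!3) * p (m!4) (m!5) (m!6)" for i j m
  define K' where "K' i j m = pull3 P p i (m!0) (m!1) * pull3 P p j (m!2) (m!3) * pull3 P p (m!4) (m!5) (m!6)" for i j m
  define u where "u a x y = (\<Sum>\<^sub>7 b c. P $ b $ x * P $ c $ y * p a b c)" for a x y
  have h: "24 * hitchin p $ i $ j = (\<Sum>m | length m = 7. eps m * K i j m)" for i j
    unfolding hitchin_def K_def sum_lists_7 by (simp add: eps7_def)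
  have h': "24 * hitchin (pull3 P p) $ i $ j = (\<Sum>m | length m = 7. eps m * K' i j m)" for i j
    unfolding hitchin_def K'_def sum_lists_7 by (simp add: eps7_def)
  have u: "pull3 P p i x y = (\<Sum>\<^sub>7 a. P $ a $ i * u a x y)" for i x y
    by (simp add: pull3_def u_def sum_distrib_left mult_ac)
  have uu: "u a (l!0) (l!1) * u b (l!2) (l!3) * pull3 P p (l!4) (l!5) (l!6)
      = (\<Sum>m | length m = 7. (\<Prod>k<7. P $ (m ! k) $ (l ! k)) * K a b m)" for a b l
    unfolding u_def pull3_def sum7_product[symmetric] sum_lists_7 K_def
    by (intro sum.cong refl) (simp add: lessThan_nat_numeral mult_ac)
  have K': "K' i j l = (\<Sum>\<^sub>7 a b. P $ a $ i * P $ b $ j *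
      (\<Sum>m | length m = 7. (\<Prod>k<7. P $ (m ! k) $ (l ! k)) * K a b m))" for i j l
  proof -
    have "K' i j l = (\<Sum>\<^sub>7 a. P $ a $ i * u a (l!0) (l!1)) * (\<Sum>\<^sub>7 b. P $ b $ j * u b (l!2) (l!3)) *
        pull3 P p (l!4) (l!5) (l!6)"
      unfolding K'_def u[of i] u[of j] ..
    then show ?thesis
      unfolding uu[symmetric] sum_product by (simp add: sum_distrib_left sum_distrib_right mult_ac)
  qed
  have "24 * hitchin (pull3 P p) $ i $ j = 24 * (det P *\<^sub>R (transpose P ** hitchin p ** P)) $ i $ j" for i j
  proof -
    let ?S = "\<lambda>a b l m. eps l * ((P $ a $ i * P $ b $ j) * ((\<Prod>k<7. P $ (m ! k) $ (l ! k)) * K a b m))"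
    have "24 * hitchin (pull3 P p) $ i $ j
        = (\<Sum>l | length l = 7. \<Sum>\<^sub>7 a b. \<Sum>m | length m = 7. ?S a b l m)"
      unfolding h' K' by (simp only: sum_distrib_left)
    also have "\<dots> = (\<Sum>\<^sub>7 a. \<Sum>l | length l = 7. \<Sum>\<^sub>7 b. \<Sum>m | length m = 7. ?S a b l m)"
      by (rule sum.swap)
    also have "\<dots> = (\<Sum>\<^sub>7 a b. \<Sum>l | length l = 7. \<Sum>m | length m = 7. ?S a b l m)"
      by (intro sum.cong[OF refl] sum.swap)
    also have "\<dots> = (\<Sum>\<^sub>7 a b. \<Sum>m | length m = 7. \<Sum>l | length l = 7. ?S a b l m)"
      by (rule sum.cong[OF refl], rule sum.cong[OF refl], rule sum.swap)
    also have "\<dots> = (\<Sum>\<^sub>7 a b. \<Sum>m | length m = 7. (P $ a $ i * P $ b $ j) * K a b m *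
        (\<Sum>l | length l = 7. eps l * (\<Prod>k<7. P $ (m ! k) $ (l ! k))))"
      by (simp add: sum_distrib_left mult_ac)
    also have "\<dots> = (\<Sum>\<^sub>7 a b. \<Sum>m | length m = 7. (P $ a $ i * P $ b $ j) * K a b m * (det P * eps m))"
      by (intro sum.cong refl arg_cong2[where f = "(*)"] sum_eps_prod_matrix) simp
    also have "\<dots> = (\<Sum>\<^sub>7 a b. (P $ a $ i * P $ b $ j) * det P * (\<Sum>m | length m = 7. eps m * K a b m))"
      by (simp add: sum_distrib_left mult_ac)
    also have "\<dots> = 24 * (det P *\<^sub>R (transpose P ** hitchin p ** P)) $ i $ j"
      unfolding h[symmetric] by (subst sum.swap)
        (simp add: matrix_matrix_mult_def transpose_def sum_distrib_left sum_distrib_right mult_ac)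
    finally show ?thesis .
  qed
  then show ?thesis by (simp add: vec_eq_iff)
qed

lemma forall_7: "(\<forall>i::7. Q i) \<longleftrightarrow> Q 0 \<and> Q 1 \<and> Q 2 \<and> Q 3 \<and> Q 4 \<and> Q 5 \<and> Q 6"
  by (metis UNIV_7 UNIV_I insertE emptyE)

lemma sum_7: "(\<Sum>i\<in>(UNIV::7 set). f i) = f 0 + f 1 + f 2 + f 3 + f 4 + f 5 + (f 6 :: real)"
  unfolding UNIV_7 by (simp add: add_ac)

lemma skew_inner:
  fixes J :: "real^7^7"
  assumes "transpose J = - J"
  shows "(J *v x) \<bullet> y = - (x \<bullet> (J *v y))"
proof -
  have "(J *v x) \<bullet> y = x \<bullet> (transpose J *v y)"
    by (metis dot_lmul_matrix vector_transpose_matrix transpose_transpose inner_commute)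
  then show ?thesis using assms by (simp add: matrix_mult_uminus)
qed

lemma inner_product_matrix_id: "inner_product_matrix (mat 1)"
  by (simp add: inner_product_matrix_def transpose_mat)

text \<open>On the complement of \<open>a\<close>, of complex dimension three, J is an orthogonal
  complex structure. A vector orthogonal to a J-invariant subspace stays so under J, so
  \<open>w\<close> and \<open>u\<close> can be chosen one complex line at a time. The first line
  passes through the prescribed \<open>v\<close>.\<close>

lemma complex_frame:
  fixes J :: "real^7^7"
  assumes skew: "transpose J = - J" and JJ: "J ** J = outer a - mat 1" and Ja: "J *v a = 0"
    and a: "a \<bullet> a = 1" and v: "v \<bullet> v = 1" "a \<bullet> v = 0"
  obtains r :: "7 \<Rightarrow> R7" where "\<And>i j. r i \<bullet> r j = kd i j" "r 0 = a" "r 1 = v"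
    "J *v r 1 = r 2" "J *v r 2 = - r 1" "J *v r 3 = r 4" "J *v r 4 = - r 3" "J *v r 5 = r 6" "J *v r 6 = - r 5"
proof -
  have JJv: "J *v (J *v x) = - x" if "a \<bullet> x = 0" for x
    using that JJ by (simp add: matrix_vector_mul_assoc matrix_vector_mult_diff_rdistrib outer_mult_vec)
  have Jxy: "(J *v x) \<bullet> (J *v y) = x \<bullet> y" if "a \<bullet> y = 0" for x y
    by (simp add: skew_inner[OF skew] JJv[OF that])
  have aJ: "a \<bullet> (J *v x) = 0" for x
    using skew_inner[OF skew, of a x] Ja by simp
  have xJx: "x \<bullet> (J *v x) = 0" for x by (rule skew_form_zero[OF skew])
  have xJy: "y \<bullet> (J *v x) = - (x \<bullet> (J *v y))" for x y
    using skew_inner[OF skew, of x y] by (simp add: inner_commute)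
  have card: "card {a, v, J *v v} < 7" "card {a, v, J *v v, w, J *v w} < 7" for w
    using card_length[of "[a, v, J *v v]"] card_length[of "[a, v, J *v v, w, J *v w]"] by simp_all
  obtain w where w: "w \<bullet> w = 1" "a \<bullet> w = 0" "v \<bullet> w = 0" "(J *v v) \<bullet> w = 0"
    using inner_product_matrix_orthogonal_vector[OF inner_product_matrix_id _ card(1)]
    by (metis finite.emptyI finite_insert insertCI matrix_vector_mul_lid)
  obtain u where u: "u \<bullet> u = 1" "a \<bullet> u = 0" "v \<bullet> u = 0" "(J *v v) \<bullet> u = 0" "w \<bullet> u = 0" "(J *v w) \<bullet> u = 0"
    using inner_product_matrix_orthogonal_vector[OF inner_product_matrix_id _ card(2)[of w]]
    by (metis finite.emptyI finite_insert insertCI matrix_vector_mul_lid)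
  define r where "r i = (if i = 0 then a else if i = 1 then v else if i = 2 then J *v v
    else if i = 3 then w else if i = 4 then J *v w else if i = 5 then u else J *v u)" for i :: 7
  have "\<forall>i j. r i \<bullet> r j = kd i j"
    unfolding forall_7 r_def kd_def
    using a v w u aJ xJx[of v] xJx[of w] xJx[of u] Jxy[of v v] Jxy[of w w] Jxy[of u u] Jxy[of w v] Jxy[of u v] Jxy[of u w]
      skew_inner[OF skew, of v w] skew_inner[OF skew, of v u] skew_inner[OF skew, of w u]
    by (simp add: inner_commute)
  then show thesis
    by (intro that[of r]) (use v w u in \<open>simp_all add: r_def JJv\<close>)
qed

text \<open>The polarised form of x \<times> (x \<times> y) = \<nu> (\<langle>x,y\<rangle> x - |x|^2
  y), with the scale \<nu> still open.\<close>

definition clifford3 :: "real \<Rightarrow> (7 \<Rightarrow> 7 \<Rightarrow> 7 \<Rightarrow> real) \<Rightarrow> bool" where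
  "clifford3 \<nu> p \<longleftrightarrow> alt3 p \<and> (\<forall>x y a b. (\<Sum>\<^sub>7 c. p x a c * p y b c) + (\<Sum>\<^sub>7 c. p y a c * p x b c)
      = \<nu> * (2 * kd a b * kd x y - kd x b * kd y a - kd y b * kd a x))"

lemma clifford3_slot:
  assumes "clifford3 \<nu> p"
  shows "transpose (slot p x) = - slot p x" "slot p x ** slot p x = \<nu> *\<^sub>R (outer x - (x \<bullet> x) *\<^sub>R mat 1)"
    "slot p x *v x = 0"
proof -
  have p: "alt3 p" using assms by (simp add: clifford3_def)
  show sk: "transpose (slot p x) = - slot p x"
    using slot_skew[of p] alt3_swap(2)[OF p] by blast
  show "slot p x ** slot p x = \<nu> *\<^sub>R (outer x - (x \<bullet> x) *\<^sub>R mat 1)"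
  proof -
    have "- (slot p x ** slot p x) = \<nu> *\<^sub>R ((x \<bullet> x) *\<^sub>R mat 1 - outer x)"
      using slot_product[of p p \<nu> x] assms by (simp add: sk matrix_mult_uminus clifford3_def)
    then have "slot p x ** slot p x = - (\<nu> *\<^sub>R ((x \<bullet> x) *\<^sub>R mat 1 - outer x))" by (metis minus_minus)
    then show ?thesis by (simp add: scaleR_right_diff_distrib)
  qed
  have "(slot p x *v x) $ a = (\<Sum>\<^sub>7 c i. x $ c * x $ i * p i a c)" for a
    by (simp add: slot_def matrix_vector_mult_def sum_distrib_left mult_ac)
  moreover have "\<dots> a = - (\<Sum>\<^sub>7 c i. x $ c * x $ i * p i a c)" for a
    by (subst sum.swap, subst alt3_swap(3)[OF p]) (simp add: sum_negf mult_ac)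
  ultimately have "(slot p x *v x) $ a = 0" for a by (smt (verit))
  then show "slot p x *v x = 0" by (simp add: vec_eq_iff)
qed

lemma slot_pull3: "pull3 P p i j k = column j P \<bullet> (slot p (column i P) *v column k P)"
proof -
  have "pull3 P p i j k = (\<Sum>\<^sub>7 b c a. P $ a $ i * P $ b $ j * P $ c $ k * p a b c)"
    unfolding pull3_def by (rule sum3_rotate')
  then show ?thesis
    by (simp add: slot_def column_def matrix_vector_mult_def inner_vec_def sum_distrib_left sum_distrib_right mult_ac)
qed

lemma eps7_pairs: "eps7 0 1 2 3 4 5 6 = 1" "eps7 0 1 2 5 6 3 4 = 1" "eps7 0 3 4 1 2 5 6 = 1"
  "eps7 0 3 4 5 6 1 2 = 1" "eps7 0 5 6 1 2 3 4 = 1" "eps7 0 5 6 3 4 1 2 = 1"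
proof -
  show 1: "eps7 0 1 2 3 4 5 6 = 1" using eps_idx7 by (simp add: eps7_def idx7_eq)
  show 2: "eps7 0 1 2 5 6 3 4 = 1" using eps7_move_pair(4)[of 0 1 2 5 6 3 4] 1 by simp
  show 3: "eps7 0 3 4 1 2 5 6 = 1" using eps7_move_pair(2)[of 0 3 4 1 2 5 6] 1 by simp
  show 4: "eps7 0 5 6 1 2 3 4 = 1" using eps7_move_pair(2)[of 0 5 6 1 2 3 4] 2 by simp
  show "eps7 0 3 4 5 6 1 2 = 1" using eps7_move_pair(4)[of 0 3 4 5 6 1 2] 3 by simp
  show "eps7 0 5 6 3 4 1 2 = 1" using eps7_move_pair(4)[of 0 5 6 3 4 1 2] 4 by simp
qed

lemma eps7_repeated: "eps7 a b c b d e f = 0" "eps7 a b c d e b f = 0" "eps7 a d e b c b f = 0"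
  by (simp_all add: eps7_def eps_eq_0_iff)

text \<open>Here \<open>q 0\<close> is s times the standard 2-form e12 + e34 + e56, and the
  contraction is its cube: a factor 2 for each of the three pairs and 3! orders of the planes make
  48.\<close>

lemma T7_complex_frame:
  assumes q: "\<And>i j. q 0 i j = s * (kd i 1 * kd j 2 - kd i 2 * kd j 1 + kd i 3 * kd j 4 - kd i 4 * kd j 3
      + kd i 5 * kd j 6 - kd i 6 * kd j 5)"
  shows "T7 q 0 0 0 0 = 48 * s ^ 3"
proof -
  have pair: "(\<Sum>\<^sub>7 c d. F c d * q 0 c d) = 2 * s * (F 1 2 + F 3 4 + F 5 6)"
    if "\<And>c d. F d c = - F c d" for F :: "7 \<Rightarrow> 7 \<Rightarrow> real"
  proof -
    have "(\<Sum>\<^sub>7 c d. F c d * q 0 c d)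
      = (\<Sum>\<^sub>7 c d. s * (((F c d * kd d 2) * kd c 1) - ((F c d * kd d 1) * kd c 2)
        + ((F c d * kd d 4) * kd c 3) - ((F c d * kd d 3) * kd c 4)
        + ((F c d * kd d 6) * kd c 5) - ((F c d * kd d 5) * kd c 6)))"
      unfolding q by (simp add: algebra_simps)
    also have "\<dots> = s * (F 1 2 - F 2 1 + F 3 4 - F 4 3 + F 5 6 - F 6 5)"
      by (simp only: sum_distrib_left[symmetric] sum_distrib_right[symmetric] sum.distrib sum_subtractf sum_kd)
    finally show ?thesis using that[of 2 1] that[of 4 3] that[of 6 5] by (simp add: algebra_simps)
  qed
  have "T7 q 0 0 0 0 = (\<Sum>\<^sub>7 c d. (\<Sum>\<^sub>7 e f. (\<Sum>\<^sub>7 g. \<Sum>h\<in>UNIV.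
      eps7 0 c d e f g h * q 0 g h) * q 0 e f) * q 0 c d)"
    unfolding T7_def by (simp add: sum_distrib_left sum_distrib_right mult_ac)
  also have "\<dots> = (\<Sum>\<^sub>7 c d. (\<Sum>\<^sub>7 e f. (2 * s *
      (eps7 0 c d e f 1 2 + eps7 0 c d e f 3 4 + eps7 0 c d e f 5 6)) * q 0 e f) * q 0 c d)"
    by (subst pair) (rule eps7_swap(6), rule refl)
  also have "\<dots> = (\<Sum>\<^sub>7 c d. (2 * s * (
      2 * s * (eps7 0 c d 1 2 1 2 + eps7 0 c d 1 2 3 4 + eps7 0 c d 1 2 5 6)
      + 2 * s * (eps7 0 c d 3 4 1 2 + eps7 0 c d 3 4 3 4 + eps7 0 c d 3 4 5 6)
      + 2 * s * (eps7 0 c d 5 6 1 2 + eps7 0 c d 5 6 3 4 + eps7 0 c d 5 6 5 6))) * q 0 c d)"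
  proof -
    have h: "2 * s * (eps7 0 c d f e 1 2 + eps7 0 c d f e 3 4 + eps7 0 c d f e 5 6)
        = - (2 * s * (eps7 0 c d e f 1 2 + eps7 0 c d e f 3 4 + eps7 0 c d e f 5 6))" for c d e f
      by (simp only: eps7_swap(4)[of 0 c d f e]) (simp add: algebra_simps)
    show ?thesis by (subst pair, rule h, rule refl)
  qed
  also have "\<dots> = (\<Sum>\<^sub>7 c d. (8 * s\<^sup>2 * (eps7 0 c d 1 2 3 4 + eps7 0 c d 1 2 5 6 + eps7 0 c d 3 4 5 6)) * q 0 c d)"
    by (simp add: eps7_repeated eps7_move_pair(4)[of 0 _ _ 3 4 1 2] eps7_move_pair(4)[of 0 _ _ 5 6 1 2]
        eps7_move_pair(4)[of 0 _ _ 5 6 3 4] power2_eq_square algebra_simps)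
  also have "\<dots> = 2 * s * (8 * s\<^sup>2 * (eps7 0 1 2 1 2 3 4 + eps7 0 1 2 1 2 5 6 + eps7 0 1 2 3 4 5 6)
     + 8 * s\<^sup>2 * (eps7 0 3 4 1 2 3 4 + eps7 0 3 4 1 2 5 6 + eps7 0 3 4 3 4 5 6)
     + 8 * s\<^sup>2 * (eps7 0 5 6 1 2 3 4 + eps7 0 5 6 1 2 5 6 + eps7 0 5 6 3 4 5 6))"
  proof -
    have h: "8 * s\<^sup>2 * (eps7 0 d c 1 2 3 4 + eps7 0 d c 1 2 5 6 + eps7 0 d c 3 4 5 6)
        = - (8 * s\<^sup>2 * (eps7 0 c d 1 2 3 4 + eps7 0 c d 1 2 5 6 + eps7 0 c d 3 4 5 6))" for c d
      by (simp only: eps7_swap(2)[of 0 d c]) (simp add: algebra_simps)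
    show ?thesis by (subst pair, rule h, rule refl)
  qed
  also have "\<dots> = 48 * s ^ 3"
    by (simp add: eps7_repeated eps7_pairs power2_eq_square power3_eq_cube algebra_simps)
  finally show ?thesis .
qed

text \<open>In a basis adapted to the complex structure \<open>slot p x / sqrt \<nu>\<close> on the complement of a unit
  vector \<open>x\<close>, the normalisation of \<open>hitchin p\<close> becomes \<open>\<nu>\<^sup>3 = 1\<close>.\<close>

lemma clifford3_scale:
  assumes p: "clifford3 \<nu> p" and \<nu>: "\<nu> > 0" and B: "hitchin p = 6 *\<^sub>R mat 1"
  shows "\<nu> = 1"
proof -
  let ?a = "axis 0 1 :: R7"
  let ?s = "sqrt \<nu>"
  have s: "?s > 0" "?s * ?s = \<nu>" using \<nu> by simp_all
  define J where "J = (1 / ?s) *\<^sub>R slot p ?a"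
  note sl = clifford3_slot[OF p, of ?a]
  have ax: "?a \<bullet> ?a = 1" "(axis 1 1 :: R7) \<bullet> axis 1 1 = 1" "?a \<bullet> axis 1 1 = 0" by (simp_all add: inner_axis_axis)
  have skJ: "transpose J = - J"
    using sl(1) by (simp add: J_def transpose_scalar)
  have JJ: "J ** J = outer ?a - mat 1"
  proof -
    have "J ** J = (1 / ?s * (1 / ?s)) *\<^sub>R (slot p ?a ** slot p ?a)"
      by (simp add: J_def matrix_scalar_ac scalar_matrix_assoc[symmetric] del: times_divide_eq_left)
    also have "\<dots> = outer ?a - mat 1"
      unfolding sl(2) using s by (simp add: inner_axis_axis)
    finally show ?thesis .
  qed
  have Ja: "J *v ?a = 0" using sl(3) by (simp add: J_def scaleR_matrix_vector_assoc[symmetric])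
  obtain r :: "7 \<Rightarrow> R7" where r: "\<And>i j. r i \<bullet> r j = kd i j" "r 0 = ?a" "r 1 = axis 1 1"
    "J *v r 1 = r 2" "J *v r 2 = - r 1" "J *v r 3 = r 4" "J *v r 4 = - r 3" "J *v r 5 = r 6" "J *v r 6 = - r 5"
    by (rule complex_frame[OF skJ JJ Ja ax]) (rule that, assumption+)
  define P where "P = (\<chi> b i. r i $ b)"
  have col: "column i P = r i" for i by (simp add: P_def column_def)
  have PP: "transpose P ** P = mat 1"
    using r(1) by (simp add: P_def vec_eq_iff matrix_matrix_mult_def transpose_def mat_def inner_vec_def kd_def)
  then have dP: "det P * det P = 1" by (metis det_I det_mul det_transpose)
  let ?q = "pull3 P p"
  have "hitchin ?q = (6 * det P) *\<^sub>R mat 1"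
    unfolding hitchin_pull3 B using PP
    by (simp add: matrix_scalar_ac scalar_matrix_assoc[symmetric] mult.commute)
  then have hq: "hitchin ?q $ i $ j = 6 * det P * kd i j" for i j
    by (simp add: mat_def kd_def)
  have "alt3 ?q" using p alt3_pull3 by (simp add: clifford3_def)
  \<comment> \<open>The orientation of the frame is unknown, so \<kappa> is det P; with all indices
    0 the formula gives 16 * 3 det P.\<close>
  then have T: "T7 ?q 0 0 0 0 = 48 * det P"
    using T7_eq[OF _ hq] by simp
  have sJ: "slot p ?a *v x = ?s *\<^sub>R (J *v x)" for x
    using s by (simp add: J_def scaleR_matrix_vector_assoc[symmetric])
  have J0: "J *v r 0 = 0" using sl(3) r(2) by (simp add: J_def scaleR_matrix_vector_assoc[symmetric])
  have "?q 0 i j = ?s * (r i \<bullet> (J *v r j))" for i j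
    unfolding slot_pull3 col r(2) sJ by simp
  moreover have "\<forall>j. \<forall>i. r i \<bullet> (J *v r j) = - (kd i 1 * kd j 2 - kd i 2 * kd j 1 + kd i 3 * kd j 4 - kd i 4 * kd j 3
      + kd i 5 * kd j 6 - kd i 6 * kd j 5)"
    unfolding forall_7[of "\<lambda>j. \<forall>i. _ i j"]
    by (simp add: r(4-9) r(1) J0 kd_def)
  ultimately have "?q 0 i j = (- ?s) * (kd i 1 * kd j 2 - kd i 2 * kd j 1 + kd i 3 * kd j 4 - kd i 4 * kd j 3
      + kd i 5 * kd j 6 - kd i 6 * kd j 5)" for i j
    by (simp only: mult_minus_left mult_minus_right)
  \<comment> \<open>The two evaluations of \<open>T7\<close> agree, and squaring removes the unknown
    sign of det P.\<close>
  from T7_complex_frame[of ?q, OF this] T have "(- ?s) ^ 3 = det P" by simp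
  then have "(- ?s) ^ 3 * (- ?s) ^ 3 = 1" using dP by simp
  moreover have "(- ?s) ^ 3 * (- ?s) ^ 3 = \<nu> ^ 3"
    by (simp only: power_mult_distrib[symmetric] minus_mult_minus s(2))
  ultimately have "\<nu> ^ 3 = 1" by simp
  then show "\<nu> = 1" using \<nu> power_eq_imp_eq_base[of \<nu> 3 1] by simp
qed

text \<open>Proportionality p = \<nu> e turns the inverse relation between p and e into one for p
  alone, and the volume comparison forces \<nu> = 1.\<close>

lemma clifford3_of_hitchin:
  assumes p: "alt3 p" and B: "hitchin p = 6 *\<^sub>R mat 1"
  shows "clifford3 1 p"
proof -
  have B': "hitchin p $ i $ j = 6 * kd i j" for i j by (simp add: B mat_def kd_def)
  let ?e = "\<lambda>i j k. E7 p i j k / 24"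
  obtain \<nu> where \<nu>: "\<nu> > 0" "\<And>i j k. p i j k = \<nu> * ?e i j k"
    using inverse_slots_proportional[OF p _ E7_relation[OF p B']] E7_skew by (metis minus_divide_left)
  have "clifford3 \<nu> p"
    unfolding clifford3_def
  proof (intro conjI allI p)
    fix x y a b
    have "(\<Sum>\<^sub>7 c. p x a c * p y b c) + (\<Sum>\<^sub>7 c. p y a c * p x b c)
      = \<nu> * ((\<Sum>\<^sub>7 c. p x a c * ?e y b c) + (\<Sum>\<^sub>7 c. p y a c * ?e x b c))"
      unfolding \<nu>(2)[of y b] \<nu>(2)[of x b] by (simp add: distrib_left sum_distrib_left mult_ac)
    then show "(\<Sum>\<^sub>7 c. p x a c * p y b c) + (\<Sum>\<^sub>7 c. p y a c * p x b c)
      = \<nu> * (2 * kd a b * kd x y - kd x b * kd y a - kd y b * kd a x)"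
      unfolding E7_relation[OF p B'] .
  qed
  then show ?thesis using clifford3_scale[OF _ \<nu>(1) B] by metis
qed

section \<open>Two-forms of type 14\<close>

text \<open>The trace over a = b: its right-hand side is 14 - 1 - 1 = 12, and the two sums on the
  left agree.\<close>

lemma clifford3_contraction:
  assumes "clifford3 \<nu> p"
  shows "(\<Sum>\<^sub>7 a c. p x a c * p y a c) = 6 * \<nu> * kd x y"
proof -
  have "2 * (\<Sum>\<^sub>7 a c. p x a c * p y a c)
      = (\<Sum>\<^sub>7 a. (\<Sum>\<^sub>7 c. p x a c * p y a c) + (\<Sum>\<^sub>7 c. p y a c * p x a c))"
    by (simp add: sum_distrib_left mult.commute)
  also have "\<dots> = (\<Sum>\<^sub>7 a. \<nu> * (2 * kd a a * kd x y - kd x a * kd y a - kd y a * kd a x))"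
    using assms by (simp add: clifford3_def)
  also have "\<dots> = 12 * \<nu> * kd x y"
    by (simp add: sum_distrib_left[symmetric] sum_subtractf kd_commute[of y x])
  finally show ?thesis by simp
qed

lemma sum3_cycle:
  "(\<Sum>i\<in>A. \<Sum>j\<in>A. \<Sum>k\<in>A. F j k i) = (\<Sum>i\<in>A. \<Sum>j\<in>A. \<Sum>k\<in>A. F i j k)"
  by (rule sum3_rotate[symmetric])

text \<open>A 2-form orthogonal to \<open>\<Omega>\<^sup>2\<^sub>7\<close> acts as a derivation of the cross product.\<close>

lemma omega14_derivation:
  assumes p: "clifford3 1 p" and T: "\<And>i j. T $ j $ i = - T $ i $ j"
    and c: "\<And>i. (\<Sum>\<^sub>7 j k. p i j k * T $ j $ k) = 0"
  shows "(\<Sum>\<^sub>7 l. T $ i $ l * p l j k) + (\<Sum>\<^sub>7 l. T $ j $ l * p l k i) + (\<Sum>\<^sub>7 l. T $ k $ l * p l i j) = 0"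
proof -
  have alt: "alt3 p" using p by (simp add: clifford3_def)
  define a where "a i j k = (\<Sum>\<^sub>7 l. T $ i $ l * p l j k)" for i j k
  define n where "n = (\<Sum>\<^sub>7 i j. T $ i $ j * T $ i $ j)"
  have sq: "(\<Sum>\<^sub>7 i j k. a i j k * a i j k) = 6 * n"
  proof -
    have "(\<Sum>\<^sub>7 j k. a i j k * a i j k) = 6 * (\<Sum>\<^sub>7 j. T $ i $ j * T $ i $ j)" for i
    proof -
      have "(\<Sum>\<^sub>7 j k. a i j k * a i j k)
          = (\<Sum>\<^sub>7 j k l m. T $ i $ l * T $ i $ m * (p l j k * p m j k))"
        unfolding a_def sum_product by (simp add: mult_ac)
      also have "\<dots> = (\<Sum>\<^sub>7 l m. T $ i $ l * T $ i $ m * (\<Sum>\<^sub>7 j k. p l j k * p m j k))"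
        by (subst sum4_swap_pairs) (simp add: sum_distrib_left)
      also have "\<dots> = (\<Sum>\<^sub>7 l. 6 * T $ i $ l * (\<Sum>\<^sub>7 m. T $ i $ m * kd l m))"
        unfolding clifford3_contraction[OF p] by (simp add: sum_distrib_left mult_ac)
      finally show ?thesis by (simp add: sum_distrib_left mult_ac)
    qed
    then show ?thesis by (simp add: n_def sum_distrib_left)
  qed
  have cross: "(\<Sum>\<^sub>7 i j k. a i j k * a j k i) = - 3 * n"
  proof -
    have inner: "(\<Sum>\<^sub>7 j k. p l j k * a j k i) = - 3 * T $ i $ l" for i l
    proof -
      have "(\<Sum>\<^sub>7 j k. p l j k * a j k i)
          = (\<Sum>\<^sub>7 j k m. T $ j $ m * (p l j k * p m k i))"
        by (simp add: a_def sum_distrib_left mult_ac)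
      also have "\<dots> = (\<Sum>\<^sub>7 j m. - T $ j $ m * (\<Sum>\<^sub>7 k. p l j k * p m i k))"
        by (subst sum.swap[of _ UNIV UNIV], subst alt3_swap(2)[OF alt])
          (simp add: sum_distrib_left sum_negf)
      \<comment> \<open>The Clifford relation trades this product for the one with the first indices
        exchanged. That one contains the contraction of T with \<open>p\<close>, which vanishes by
        assumption, so only Kronecker terms survive.\<close>
      also have "\<dots> = (\<Sum>\<^sub>7 j m. - T $ j $ m * (2 * kd j i * kd l m - kd l i * kd m j - kd m i * kd j l
          - (\<Sum>\<^sub>7 k. p m j k * p l i k)))"
      proof (rule sum.cong[OF refl], rule sum.cong[OF refl])
        fix j m
        have "(\<Sum>\<^sub>7 k. p l j k * p m i k) + (\<Sum>\<^sub>7 k. p m j k * p l i k)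
            = 2 * kd j i * kd l m - kd l i * kd m j - kd m i * kd j l"
          using p unfolding clifford3_def by (simp only: mult_1)
        then have "(\<Sum>\<^sub>7 k. p l j k * p m i k)
            = 2 * kd j i * kd l m - kd l i * kd m j - kd m i * kd j l - (\<Sum>\<^sub>7 k. p m j k * p l i k)"
          by linarith
        then show "- T $ j $ m * (\<Sum>\<^sub>7 k. p l j k * p m i k)
            = - T $ j $ m * (2 * kd j i * kd l m - kd l i * kd m j - kd m i * kd j l - (\<Sum>\<^sub>7 k. p m j k * p l i k))"
          by (rule arg_cong)
      qed
      also have "\<dots> = - 2 * (\<Sum>\<^sub>7 j. (\<Sum>\<^sub>7 m. T $ j $ m * kd l m) * kd j i)
          + (\<Sum>\<^sub>7 j m. T $ j $ m * kd m j) * kd l i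
          + (\<Sum>\<^sub>7 j. (\<Sum>\<^sub>7 m. T $ j $ m * kd m i) * kd j l)
          + (\<Sum>\<^sub>7 j m k. T $ j $ m * (p m j k * p l i k))"
        by (simp add: sum_distrib_left sum_distrib_right right_diff_distrib sum.distrib sum_subtractf sum_negf mult_ac del: sum_kd)
      also have "(\<Sum>\<^sub>7 j m k. T $ j $ m * (p m j k * p l i k))
          = (\<Sum>\<^sub>7 k. (\<Sum>\<^sub>7 j m. - (p k j m * T $ j $ m)) * p l i k)"
        by (subst sum3_rotate, subst alt3_swap(3)[OF alt]) (simp add: sum_distrib_left sum_distrib_right mult_ac)
      also have "\<dots> = 0" using c by (simp add: sum_negf)
      finally have *: "(\<Sum>\<^sub>7 j k. p l j k * a j k i)
        = - 2 * (\<Sum>\<^sub>7 j. (\<Sum>\<^sub>7 m. T $ j $ m * kd l m) * kd j i)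
          + (\<Sum>\<^sub>7 j m. T $ j $ m * kd m j) * kd l i
          + (\<Sum>\<^sub>7 j. (\<Sum>\<^sub>7 m. T $ j $ m * kd m i) * kd j l) + 0" .
      show ?thesis
      proof -
        have "T $ j $ j = 0" for j using T[of j j] by simp
        then show ?thesis using T[of i l] * by simp
      qed
    qed
    have "(\<Sum>\<^sub>7 i j k. a i j k * a j k i)
        = (\<Sum>\<^sub>7 i j k l. T $ i $ l * (p l j k * a j k i))"
      by (subst a_def) (simp add: sum_distrib_left sum_distrib_right mult_ac)
    also have "\<dots> = (\<Sum>\<^sub>7 i l. T $ i $ l * (\<Sum>\<^sub>7 j k. p l j k * a j k i))"
      by (rule sum.cong[OF refl], subst sum3_rotate) (simp add: sum_distrib_left)
    also have "\<dots> = - 3 * n"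
      unfolding inner n_def by (simp add: sum_distrib_left mult_ac)
    finally show ?thesis .
  qed
  \<comment> \<open>The cyclic sum vanishes because its squared norm does: three squares contribute
    6n each and three doubled cross terms -6n each.\<close>
  let ?D = "\<lambda>i j k. a i j k + a j k i + a k i j"
  have "(\<Sum>\<^sub>7 i j k. (?D i j k)\<^sup>2)
      = (\<Sum>\<^sub>7 i j k. a i j k * a i j k)
      + (\<Sum>\<^sub>7 i j k. a j k i * a j k i)
      + (\<Sum>\<^sub>7 i j k. a k i j * a k i j)
      + 2 * (\<Sum>\<^sub>7 i j k. a i j k * a j k i)
      + 2 * (\<Sum>\<^sub>7 i j k. a j k i * a k i j)
      + 2 * (\<Sum>\<^sub>7 i j k. a k i j * a i j k)"
    by (simp add: sum_distrib_left power2_eq_square algebra_simps flip: sum.distrib)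
  also have "\<dots> = 0"
    using sq cross sum3_cycle[of "\<lambda>i j k. a i j k * a i j k" UNIV] sum3_cycle[of "\<lambda>i j k. a j k i * a j k i" UNIV]
      sum3_cycle[of "\<lambda>i j k. a i j k * a j k i" UNIV] sum3_cycle[of "\<lambda>i j k. a j k i * a k i j" UNIV]
    by simp
  finally have "(\<Sum>\<^sub>7 i j k. (?D i j k)\<^sup>2) = 0" .
  then have "(?D i j k)\<^sup>2 = 0"
    by (simp add: sum_nonneg_eq_0_iff sum_nonneg)
  then show ?thesis unfolding a_def by simp
qed

text \<open>det T = (-1)^7 det T, so T is singular.\<close>

lemma skew7_kernel:
  fixes T :: "real^7^7"
  assumes "transpose T = - T"
  obtains a where "a \<bullet> a = 1" "T *v a = 0"
proof -
  have "det T = det (- 1 *\<^sub>R T)" using assms by (metis det_transpose scaleR_minus1_left)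
  then have "det T = 0" unfolding det_scaleR by simp
  then have "\<not> invertible T" by (simp add: invertible_det_nz)
  then obtain b where b: "T *v b = 0" "b \<noteq> 0"
    using matrix_left_invertible_ker[of T] invertible_left_inverse[of T] by blast
  show thesis
  proof
    show "T *v (b /\<^sub>R norm b) = 0" using b by (simp add: matrix_vector_mult_scaleR)
    show "(b /\<^sub>R norm b) \<bullet> (b /\<^sub>R norm b) = 1"
      using b by (simp add: dot_square_norm power2_eq_square field_simps)
  qed
qed

definition sq_norm :: "real^7^7 \<Rightarrow> real" where
  "sq_norm M = (\<Sum>\<^sub>7 i j. (M $ i $ j)\<^sup>2)"

lemma sq_norm_trace: "sq_norm M = trace (transpose M ** M)"
  unfolding sq_norm_def trace_def matrix_matrix_mult_def transpose_def
  by (subst sum.swap) (simp add: power2_eq_square)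

lemma trace_conjugate:
  fixes P M :: "real^7^7"
  assumes "transpose P ** P = mat 1"
  shows "trace (transpose P ** M ** P) = trace M"
proof -
  have "P ** transpose P = mat 1" using assms matrix_left_right_inverse by blast
  then show ?thesis
    by (metis matrix_mul_assoc matrix_mul_rid trace_mul_sym)
qed

lemma conjugate_mult:
  fixes P A B :: "real^7^7"
  assumes "transpose P ** P = mat 1"
  shows "(transpose P ** A ** P) ** (transpose P ** B ** P) = transpose P ** (A ** B) ** P"
proof -
  have PP: "P ** transpose P = mat 1" using assms matrix_left_right_inverse by blast
  have "(transpose P ** A ** P) ** (transpose P ** B ** P) = transpose P ** A ** (P ** transpose P) ** B ** P"
    by (simp add: matrix_mul_assoc)
  then show ?thesis by (simp add: PP matrix_mul_assoc)
qed

lemma sq_norm_conjugate: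
  assumes "transpose P ** P = mat 1"
  shows "sq_norm (transpose P ** M ** P) = sq_norm M"
proof -
  have "transpose (transpose P ** M ** P) = transpose P ** transpose M ** P"
    by (simp add: matrix_transpose_mul matrix_mul_assoc)
  then show ?thesis
    unfolding sq_norm_trace by (simp add: conjugate_mult[OF assms] trace_conjugate[OF assms])
qed

text \<open>The block form of an element of \<open>su(3)\<close>, the stabiliser of a unit vector in \<open>g\<^sub>2\<close>.\<close>

definition su3_form :: "real^7^7 \<Rightarrow> bool" where
  "su3_form t \<longleftrightarrow> t $ 0 = 0 \<and> (\<forall>i. t $ i $ 0 = 0) \<and> (\<forall>i. t $ i $ i = 0) \<and>
    t$2$1 = - t$1$2 \<and> t$2$3 = - t$1$4 \<and> t$2$4 = t$1$3 \<and> t$2$5 = - t$1$6 \<and> t$2$6 = t$1$5 \<and>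
    t$3$1 = - t$1$3 \<and> t$3$2 = t$1$4 \<and> t$4$1 = - t$1$4 \<and> t$4$2 = - t$1$3 \<and> t$4$3 = - t$3$4 \<and>
    t$4$5 = - t$3$6 \<and> t$4$6 = t$3$5 \<and> t$5$1 = - t$1$5 \<and> t$5$2 = t$1$6 \<and> t$5$3 = - t$3$5 \<and> t$5$4 = t$3$6 \<and>
    t$6$1 = - t$1$6 \<and> t$6$2 = - t$1$5 \<and> t$6$3 = - t$3$6 \<and> t$6$4 = - t$3$5 \<and> t$6$5 = - t$5$6 \<and>
    t$5$6 = - t$1$2 - t$3$4"

text \<open>Since T kills a, the derivation identity with one argument a says that T commutes with
  the cross product by a, that is, T is complex linear; the contraction with \<open>p\<close>,
  paired with a, says that its complex trace vanishes. Prescribing v lets any unit direction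
  orthogonal to a become column 1 of the frame.\<close>

lemma omega14_normal_form:
  assumes p: "clifford3 1 p" and skew: "transpose T = - T"
    and c: "\<And>i. (\<Sum>\<^sub>7 j k. p i j k * T $ j $ k) = 0"
    and Ta: "T *v a = 0" and a: "a \<bullet> a = 1" and v: "v \<bullet> v = 1" "a \<bullet> v = 0"
  obtains P t :: "real^7^7" where "transpose P ** P = mat 1" "column 1 P = v" "t = transpose P ** T ** P" "su3_form t"
proof -
  define J where "J = slot p a"
  note sl = clifford3_slot[OF p, of a, folded J_def]
  have alt: "alt3 p" using p by (simp add: clifford3_def)
  have Tij: "T $ j $ i = - T $ i $ j" for i j
    using arg_cong[OF skew, of "\<lambda>M. M $ i $ j"] by (simp add: transpose_def)
  have comm: "T *v (J *v x) = J *v (T *v x)" for x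
  proof -
    have "(T ** J) $ j $ k = (J ** T) $ j $ k" for j k
    proof -
      have "(\<Sum>\<^sub>7 i. a $ i * ((\<Sum>\<^sub>7 l. T $ i $ l * p l j k) + (\<Sum>\<^sub>7 l. T $ j $ l * p l k i)
          + (\<Sum>\<^sub>7 l. T $ k $ l * p l i j))) = 0"
        by (simp add: omega14_derivation[OF p Tij c])
      moreover have "(\<Sum>\<^sub>7 i. a $ i * (\<Sum>\<^sub>7 l. T $ i $ l * p l j k)) = 0"
      proof -
        have "(\<Sum>\<^sub>7 i. a $ i * (\<Sum>\<^sub>7 l. T $ i $ l * p l j k)) = (\<Sum>\<^sub>7 l. - (\<Sum>\<^sub>7 i. T $ l $ i * a $ i) * p l j k)"
          unfolding sum_distrib_left sum_distrib_right sum_negf[symmetric]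
          by (subst sum.swap) (intro sum.cong refl, subst Tij, simp)
        also have "\<dots> = 0"
        proof -
          have "(\<Sum>\<^sub>7 i. T $ l $ i * a $ i) = 0" for l
            using arg_cong[OF Ta, of "\<lambda>x. x $ l"] by (simp add: matrix_vector_mult_def)
          then show ?thesis by simp
        qed
        finally show ?thesis .
      qed
      moreover have "(\<Sum>\<^sub>7 i. a $ i * (\<Sum>\<^sub>7 l. T $ j $ l * p l k i)) = (T ** J) $ j $ k"
      proof -
        have "p l k i = p i l k" for l i using alt3_swap(4)[OF alt, of l k i] alt3_swap(4)[OF alt, of k i l] by simp
        then show ?thesis
          unfolding J_def slot_def matrix_matrix_mult_def sum_distrib_left by (subst sum.swap) (simp add: sum_distrib_left mult_ac)
      qed
      moreover have "(\<Sum>\<^sub>7 i. a $ i * (\<Sum>\<^sub>7 l. T $ k $ l * p l i j)) = - (J ** T) $ j $ k"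
      proof -
        have "T $ k $ l * p l i j = - (p i j l * T $ l $ k)" for l i
          using alt3_swap(4)[OF alt, of l i j] Tij[of l k] by simp
        then show ?thesis
          unfolding J_def slot_def matrix_matrix_mult_def sum_distrib_left
          by (subst sum.swap) (simp add: sum_distrib_left sum_distrib_right sum_negf mult_ac)
      qed
      ultimately show ?thesis by (simp add: distrib_left sum.distrib)
    qed
    then have "T ** J = J ** T" by (simp add: vec_eq_iff)
    then show ?thesis by (simp add: matrix_vector_mul_assoc)
  qed
  have trJT: "trace (J ** T) = 0"
  proof -
    have "trace (J ** T) = (\<Sum>\<^sub>7 j k i. a $ i * (p i j k * - T $ j $ k))"
      unfolding trace_def J_def slot_def matrix_matrix_mult_def
      by (simp add: sum_distrib_right mult.assoc) (intro sum.cong refl, subst Tij, simp)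
    also have "\<dots> = - (\<Sum>\<^sub>7 i. a $ i * (\<Sum>\<^sub>7 j k. p i j k * T $ j $ k))"
      by (subst sum3_rotate) (simp add: sum_distrib_left sum_negf)
    finally show ?thesis by (simp add: c)
  qed
  have JJ: "J ** J = outer a - mat 1" using sl(2) a by simp
  obtain r :: "7 \<Rightarrow> R7" where r: "\<And>i j. r i \<bullet> r j = kd i j" "r 0 = a" "r 1 = v"
    "J *v r 1 = r 2" "J *v r 2 = - r 1" "J *v r 3 = r 4" "J *v r 4 = - r 3" "J *v r 5 = r 6" "J *v r 6 = - r 5"
    by (rule complex_frame[OF sl(1) JJ sl(3) a v]) (rule that, assumption+)
  define P where "P = (\<chi> b i. r i $ b)"
  have PP: "transpose P ** P = mat 1"
    using r(1) by (simp add: P_def vec_eq_iff matrix_matrix_mult_def transpose_def mat_def inner_vec_def kd_def)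
  have col: "column 1 P = v" using r(3) by (simp add: P_def column_def)
  define t where "t = transpose P ** T ** P"
  have conj: "(transpose P ** M ** P) $ i $ j = r i \<bullet> (M *v r j)" for M i j
  proof -
    have "(transpose P ** (M ** P)) $ i $ j = r i \<bullet> (M *v r j)"
      by (simp add: P_def matrix_matrix_mult_def transpose_def inner_vec_def matrix_vector_mult_def)
    then show ?thesis by (simp add: matrix_mul_assoc)
  qed
  have t: "t $ i $ j = r i \<bullet> (T *v r j)" for i j by (simp add: t_def conj)
  have t_skew: "t $ j $ i = - t $ i $ j" for i j
    unfolding t using skew_inner[OF skew, of "r i" "r j"] by (simp add: inner_commute)
  have t_J: "(J *v r i) \<bullet> (T *v r j) = - (r i \<bullet> (T *v (J *v r j)))" for i j
    by (simp add: skew_inner[OF sl(1)] comm)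
  have e: "t$2$j = - (r 1 \<bullet> (T *v (J *v r j)))" "t$4$j = - (r 3 \<bullet> (T *v (J *v r j)))"
    "t$6$j = - (r 5 \<bullet> (T *v (J *v r j)))" for j
    unfolding t using t_J[of 1 j, unfolded r(4)] t_J[of 3 j, unfolded r(6)] t_J[of 5 j, unfolded r(8)] by simp_all
  have T0: "T *v r 0 = 0" using Ta r(2) by simp
  have z: "t $ i $ 0 = 0" "t $ 0 $ i = 0" "t $ i $ i = 0" for i
    using t_skew[of i 0] t_skew[of i i] by (auto simp: t T0)
  have neg: "T *v (- x) = - (T *v x)" for x
    by (simp add: matrix_vector_mult_def vec_eq_iff sum_negf)
  have rel: "t$2$3 = - t$1$4" "t$2$4 = t$1$3" "t$2$5 = - t$1$6" "t$2$6 = t$1$5" "t$4$5 = - t$3$6" "t$4$6 = t$3$5"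
    unfolding e by (simp_all add: r(4-9) t neg)
  \<comment> \<open>Up to a factor, tr (J T) is the sum of the entries (1,2), (3,4), (5,6), which
    represent the imaginary diagonal of T as a complex 3x3 matrix.\<close>
  have tr: "t$5$6 = - t$1$2 - t$3$4"
  proof -
    have "trace (transpose P ** (J ** T) ** P) = 0"
      unfolding trace_conjugate[OF PP] by (rule trJT)
    then have "(\<Sum>\<^sub>7 i. r i \<bullet> (J *v (T *v r i))) = 0"
      by (simp add: trace_def conj matrix_vector_mul_assoc)
    then have "(\<Sum>\<^sub>7 i. (J *v r i) \<bullet> (T *v r i)) = 0"
      by (simp add: skew_inner[OF sl(1)] sum_negf)
    then have "t$2$1 - t$1$2 + t$4$3 - t$3$4 + t$6$5 - t$5$6 = 0"
      unfolding sum_7 by (simp add: r(4-9) t T0)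
    then show ?thesis using t_skew[of 2 1] t_skew[of 4 3] t_skew[of 6 5] by simp
  qed
  show thesis
    by (rule that[of P t, OF PP col t_def])
      (use z rel tr t_skew[of 1 2] t_skew[of 1 3] t_skew[of 2 3] t_skew[of 1 4] t_skew[of 2 4] t_skew[of 3 4]
        t_skew[of 1 5] t_skew[of 2 5] t_skew[of 3 5] t_skew[of 4 5] t_skew[of 1 6] t_skew[of 2 6] t_skew[of 3 6]
        t_skew[of 4 6] t_skew[of 5 6] in \<open>simp add: su3_form_def vec_eq_iff\<close>)
qed

text \<open>Real parameters of a trace-free skew-Hermitian 3x3 matrix: c, d, e for the imaginary
  diagonal and (x,y), (z,w), (q,s) for the complex entries above it.\<close>

lemma su3_form_entries:
  assumes "su3_form t"
  obtains c d e x y z w q s where "c + d + e = 0"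
    "t$0$0 = 0" "t$0$1 = 0" "t$0$2 = 0" "t$0$3 = 0" "t$0$4 = 0" "t$0$5 = 0" "t$0$6 = 0"
    "t$1$0 = 0" "t$1$1 = 0" "t$1$2 = c" "t$1$3 = x" "t$1$4 = y" "t$1$5 = z" "t$1$6 = w"
    "t$2$0 = 0" "t$2$1 = - c" "t$2$2 = 0" "t$2$3 = - y" "t$2$4 = x" "t$2$5 = - w" "t$2$6 = z"
    "t$3$0 = 0" "t$3$1 = - x" "t$3$2 = y" "t$3$3 = 0" "t$3$4 = d" "t$3$5 = q" "t$3$6 = s"
    "t$4$0 = 0" "t$4$1 = - y" "t$4$2 = - x" "t$4$3 = - d" "t$4$4 = 0" "t$4$5 = - s" "t$4$6 = q"
    "t$5$0 = 0" "t$5$1 = - z" "t$5$2 = w" "t$5$3 = - q" "t$5$4 = s" "t$5$5 = 0" "t$5$6 = e"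
    "t$6$0 = 0" "t$6$1 = - w" "t$6$2 = - z" "t$6$3 = - s" "t$6$4 = - q" "t$6$5 = - e" "t$6$6 = 0"
  using assms that[of "t$1$2" "t$3$4" "t$5$6" "t$1$3" "t$1$4" "t$1$5" "t$1$6" "t$3$5" "t$3$6"]
  by (simp add: su3_form_def)

text \<open>Cayley-Hamilton in real coordinates: a trace-free 3x3 matrix satisfies A^3 = (tr A^2 /
  2) A + det A, whence tr A^4 = (tr A^2)^2 / 2. Passing to real 6x6 matrices doubles traces, which
  turns the factor 1/2 into 1/4.\<close>

lemma su3_polynomial:
  fixes c d e x y z w q s :: real
  assumes "e = - c - d"
  shows "2 * ((c\<^sup>2 + x\<^sup>2 + y\<^sup>2 + z\<^sup>2 + w\<^sup>2)\<^sup>2 + (x\<^sup>2 + y\<^sup>2 + d\<^sup>2 + q\<^sup>2 + s\<^sup>2)\<^sup>2 + (z\<^sup>2 + w\<^sup>2 + q\<^sup>2 + s\<^sup>2 + e\<^sup>2)\<^sup>2)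
     + 4 * ((- c * y - d * y - z * q - w * s)\<^sup>2 + (c * x + d * x + z * s - w * q)\<^sup>2
       + (- c * w + x * q - y * s - w * e)\<^sup>2 + (c * z + x * s + y * q + z * e)\<^sup>2
       + (- x * z - y * w - d * s - s * e)\<^sup>2 + (- x * w + y * z + d * q + q * e)\<^sup>2)
    = (2 * (c\<^sup>2 + d\<^sup>2 + e\<^sup>2) + 4 * (x\<^sup>2 + y\<^sup>2 + z\<^sup>2 + w\<^sup>2 + q\<^sup>2 + s\<^sup>2))\<^sup>2 / 4"
  unfolding assms by algebra

lemma su3_form_quartic:
  assumes "su3_form t"
  shows "sq_norm (t ** t) = (sq_norm t)\<^sup>2 / 4"
proof -
  obtain c d e x y z w q s where tr: "c + d + e = 0" and ent:
    "t$0$0 = 0" "t$0$1 = 0" "t$0$2 = 0" "t$0$3 = 0" "t$0$4 = 0" "t$0$5 = 0" "t$0$6 = 0"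
    "t$1$0 = 0" "t$1$1 = 0" "t$1$2 = c" "t$1$3 = x" "t$1$4 = y" "t$1$5 = z" "t$1$6 = w"
    "t$2$0 = 0" "t$2$1 = - c" "t$2$2 = 0" "t$2$3 = - y" "t$2$4 = x" "t$2$5 = - w" "t$2$6 = z"
    "t$3$0 = 0" "t$3$1 = - x" "t$3$2 = y" "t$3$3 = 0" "t$3$4 = d" "t$3$5 = q" "t$3$6 = s"
    "t$4$0 = 0" "t$4$1 = - y" "t$4$2 = - x" "t$4$3 = - d" "t$4$4 = 0" "t$4$5 = - s" "t$4$6 = q"
    "t$5$0 = 0" "t$5$1 = - z" "t$5$2 = w" "t$5$3 = - q" "t$5$4 = s" "t$5$5 = 0" "t$5$6 = e"
    "t$6$0 = 0" "t$6$1 = - w" "t$6$2 = - z" "t$6$3 = - s" "t$6$4 = - q" "t$6$5 = - e" "t$6$6 = 0"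
    by (rule su3_form_entries[OF assms])
  \<comment> \<open>The square is a Hermitian 3x3 matrix with real diagonal A, B, C and complex
    entries (k,l), (m,n), (f,h) above it.\<close>
  define A B C where "A = - (c\<^sup>2 + x\<^sup>2 + y\<^sup>2 + z\<^sup>2 + w\<^sup>2)" and "B = - (x\<^sup>2 + y\<^sup>2 + d\<^sup>2 + q\<^sup>2 + s\<^sup>2)"
    and "C = - (z\<^sup>2 + w\<^sup>2 + q\<^sup>2 + s\<^sup>2 + e\<^sup>2)"
  define k l m n f h where "k = - c * y - d * y - z * q - w * s" and "l = c * x + d * x + z * s - w * q"
    and "m = - c * w + x * q - y * s - w * e" and "n = c * z + x * s + y * q + z * e"
    and "f = - x * z - y * w - d * s - s * e" and "h = - x * w + y * z + d * q + q * e"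
  have S:
    "(t ** t)$0$0 = 0" "(t ** t)$0$1 = 0" "(t ** t)$0$2 = 0" "(t ** t)$0$3 = 0" "(t ** t)$0$4 = 0" "(t ** t)$0$5 = 0" "(t ** t)$0$6 = 0"
    "(t ** t)$1$0 = 0" "(t ** t)$1$1 = A" "(t ** t)$1$2 = 0" "(t ** t)$1$3 = k" "(t ** t)$1$4 = l" "(t ** t)$1$5 = m" "(t ** t)$1$6 = n"
    "(t ** t)$2$0 = 0" "(t ** t)$2$1 = 0" "(t ** t)$2$2 = A" "(t ** t)$2$3 = - l" "(t ** t)$2$4 = k" "(t ** t)$2$5 = - n" "(t ** t)$2$6 = m"
    "(t ** t)$3$0 = 0" "(t ** t)$3$1 = k" "(t ** t)$3$2 = - l" "(t ** t)$3$3 = B" "(t ** t)$3$4 = 0" "(t ** t)$3$5 = f" "(t ** t)$3$6 = h"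
    "(t ** t)$4$0 = 0" "(t ** t)$4$1 = l" "(t ** t)$4$2 = k" "(t ** t)$4$3 = 0" "(t ** t)$4$4 = B" "(t ** t)$4$5 = - h" "(t ** t)$4$6 = f"
    "(t ** t)$5$0 = 0" "(t ** t)$5$1 = m" "(t ** t)$5$2 = - n" "(t ** t)$5$3 = f" "(t ** t)$5$4 = - h" "(t ** t)$5$5 = C" "(t ** t)$5$6 = 0"
    "(t ** t)$6$0 = 0" "(t ** t)$6$1 = n" "(t ** t)$6$2 = m" "(t ** t)$6$3 = h" "(t ** t)$6$4 = f" "(t ** t)$6$5 = 0" "(t ** t)$6$6 = C"
    unfolding matrix_matrix_mult_def A_def B_def C_def k_def l_def m_def n_def f_def h_def
    by (simp_all add: sum_7 ent power2_eq_square)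
  have "sq_norm (t ** t) = 2 * (A\<^sup>2 + B\<^sup>2 + C\<^sup>2) + 4 * (k\<^sup>2 + l\<^sup>2 + m\<^sup>2 + n\<^sup>2 + f\<^sup>2 + h\<^sup>2)"
    unfolding sq_norm_def sum_7 S by simp
  also have "\<dots> = (2 * (c\<^sup>2 + d\<^sup>2 + e\<^sup>2) + 4 * (x\<^sup>2 + y\<^sup>2 + z\<^sup>2 + w\<^sup>2 + q\<^sup>2 + s\<^sup>2))\<^sup>2 / 4"
    unfolding A_def B_def C_def k_def l_def m_def n_def f_def h_def power2_minus
    using tr by (intro su3_polynomial) simp
  also have "2 * (c\<^sup>2 + d\<^sup>2 + e\<^sup>2) + 4 * (x\<^sup>2 + y\<^sup>2 + z\<^sup>2 + w\<^sup>2 + q\<^sup>2 + s\<^sup>2) = sq_norm t"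
    unfolding sq_norm_def sum_7 ent by simp
  finally show ?thesis .
qed

text \<open>After eliminating e, the difference of the two sides is one third of (c + 2d)^2 plus
  multiples of the squares of the off-diagonal parameters.\<close>

lemma su3_form_column_bound:
  assumes "su3_form t"
  shows "(\<Sum>\<^sub>7 i. (t $ i $ 1)\<^sup>2) \<le> sq_norm t / 3"
proof -
  obtain c d e x y z w q s where tr: "c + d + e = 0" and ent:
    "t$0$0 = 0" "t$0$1 = 0" "t$0$2 = 0" "t$0$3 = 0" "t$0$4 = 0" "t$0$5 = 0" "t$0$6 = 0"
    "t$1$0 = 0" "t$1$1 = 0" "t$1$2 = c" "t$1$3 = x" "t$1$4 = y" "t$1$5 = z" "t$1$6 = w"
    "t$2$0 = 0" "t$2$1 = - c" "t$2$2 = 0" "t$2$3 = - y" "t$2$4 = x" "t$2$5 = - w" "t$2$6 = z"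
    "t$3$0 = 0" "t$3$1 = - x" "t$3$2 = y" "t$3$3 = 0" "t$3$4 = d" "t$3$5 = q" "t$3$6 = s"
    "t$4$0 = 0" "t$4$1 = - y" "t$4$2 = - x" "t$4$3 = - d" "t$4$4 = 0" "t$4$5 = - s" "t$4$6 = q"
    "t$5$0 = 0" "t$5$1 = - z" "t$5$2 = w" "t$5$3 = - q" "t$5$4 = s" "t$5$5 = 0" "t$5$6 = e"
    "t$6$0 = 0" "t$6$1 = - w" "t$6$2 = - z" "t$6$3 = - s" "t$6$4 = - q" "t$6$5 = - e" "t$6$6 = 0"
    by (rule su3_form_entries[OF assms])
  have e: "e = - c - d" using tr by simp
  have "sq_norm t / 3 - (\<Sum>\<^sub>7 i. (t $ i $ 1)\<^sup>2)
      = ((c + 2 * d)\<^sup>2 + x\<^sup>2 + y\<^sup>2 + z\<^sup>2 + w\<^sup>2 + 4 * q\<^sup>2 + 4 * s\<^sup>2) / 3"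
    unfolding sq_norm_def sum_7 ent e by (simp add: power2_eq_square field_simps)
  also have "\<dots> \<ge> 0" by simp
  finally show ?thesis by simp
qed

lemma omega14_quartic:
  assumes p: "clifford3 1 p" and skew: "transpose T = - T"
    and c: "\<And>i. (\<Sum>\<^sub>7 j k. p i j k * T $ j $ k) = 0"
  shows "sq_norm (T ** T) = (sq_norm T)\<^sup>2 / 4"
proof -
  obtain a where a: "a \<bullet> a = 1" "T *v a = 0" using skew7_kernel[OF skew] .
  obtain v where v: "v \<bullet> v = 1" "a \<bullet> v = 0"
    using inner_product_matrix_orthogonal_vector[OF inner_product_matrix_id, of "{a}"]
    by (metis card_1_singleton_iff finite.emptyI finite_insert insertCI matrix_vector_mul_lid one_less_numeral_iff semiring_norm(77) One_nat_def)
  obtain P t where t: "transpose P ** P = mat 1" "column 1 P = v" "t = transpose P ** T ** P" "su3_form t"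
    by (rule omega14_normal_form[OF p skew c a(2,1) v])
  have "sq_norm (t ** t) = (sq_norm t)\<^sup>2 / 4" by (rule su3_form_quartic[OF t(4)])
  then show ?thesis
    unfolding t(3) conjugate_mult[OF t(1)] sq_norm_conjugate[OF t(1)] .
qed

text \<open>The component of x along the kernel vector only enlarges the right-hand side; the rest,
  normalised, serves as column 1 of a frame in which T has su(3) form.\<close>

lemma omega14_bound:
  assumes p: "clifford3 1 p" and skew: "transpose T = - T"
    and c: "\<And>i. (\<Sum>\<^sub>7 j k. p i j k * T $ j $ k) = 0"
  shows "(T *v x) \<bullet> (T *v x) \<le> sq_norm T / 3 * (x \<bullet> x)"
proof -
  obtain a where a: "a \<bullet> a = 1" "T *v a = 0" using skew7_kernel[OF skew] .
  define y where "y = x - (a \<bullet> x) *\<^sub>R a"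
  have ay: "a \<bullet> y = 0" using a by (simp add: y_def inner_diff_right)
  have Ty: "T *v y = T *v x" using a by (simp add: y_def matrix_vector_mult_diff_distrib matrix_vector_mult_scaleR)
  have "x = y + (a \<bullet> x) *\<^sub>R a" by (simp add: y_def)
  then have "x \<bullet> x = y \<bullet> y + (a \<bullet> x)\<^sup>2"
    using a ay by (metis (no_types, lifting) inner_add_left inner_add_right inner_commute inner_scaleR_right mult.right_neutral power2_eq_square add_0 add.right_neutral inner_scaleR_left mult_zero_right)
  then have yx: "y \<bullet> y \<le> x \<bullet> x" by simp
  have nn: "sq_norm T \<ge> 0" by (simp add: sq_norm_def sum_nonneg)
  have "(T *v y) \<bullet> (T *v y) \<le> sq_norm T / 3 * (y \<bullet> y)"
  proof (cases "y = 0")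
    case False
    define v where "v = y /\<^sub>R norm y"
    have v: "v \<bullet> v = 1" "a \<bullet> v = 0"
      using False ay by (simp_all add: v_def dot_square_norm power2_eq_square field_simps)
    obtain P t where t: "transpose P ** P = mat 1" "column 1 P = v" "t = transpose P ** T ** P" "su3_form t"
      by (rule omega14_normal_form[OF p skew c a(2,1) v])
    have PP': "P ** transpose P = mat 1" using t(1) matrix_left_right_inverse by blast
    have "(T *v v) \<bullet> (T *v v) = (\<Sum>\<^sub>7 i. (t $ i $ 1)\<^sup>2)"
    proof -
      have "column 1 t = transpose P *v (T *v v)"
        unfolding t(3) t(2)[symmetric] matrix_vector_mult_basis[symmetric]
        by (simp add: matrix_vector_mul_assoc matrix_mul_assoc)
      moreover have "(transpose P *v z) \<bullet> (transpose P *v z) = z \<bullet> z" for z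
        by (metis PP' dot_lmul_matrix matrix_vector_mul_assoc matrix_vector_mul_lid vector_transpose_matrix transpose_transpose)
      ultimately have "(T *v v) \<bullet> (T *v v) = column 1 t \<bullet> column 1 t" by simp
      then show ?thesis by (simp add: inner_vec_def column_def power2_eq_square)
    qed
    also have "\<dots> \<le> sq_norm t / 3" by (rule su3_form_column_bound[OF t(4)])
    also have "sq_norm t = sq_norm T" unfolding t(3) by (rule sq_norm_conjugate[OF t(1)])
    finally have "(y \<bullet> y) * ((T *v v) \<bullet> (T *v v)) \<le> (y \<bullet> y) * (sq_norm T / 3)"
      by (intro mult_left_mono) simp_all
    moreover have "(T *v y) \<bullet> (T *v y) = (y \<bullet> y) * ((T *v v) \<bullet> (T *v v))"
    proof -
      have "y = norm y *\<^sub>R v" using False by (simp add: v_def)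
      then have "T *v y = norm y *\<^sub>R (T *v v)" by (metis matrix_vector_mult_scaleR)
      then show ?thesis by (simp add: dot_square_norm power2_eq_square)
    qed
    ultimately show ?thesis by (simp add: mult.commute)
  qed simp
  then show ?thesis
    unfolding Ty using mult_left_mono[OF yx, of "sq_norm T / 3"] nn by linarith
qed

section \<open>Contraction identities\<close>

definition raise3 :: "real^7^7 \<Rightarrow> (7 \<Rightarrow> 7 \<Rightarrow> 7 \<Rightarrow> real) \<Rightarrow> 7 \<Rightarrow> 7 \<Rightarrow> 7 \<Rightarrow> real" where
  "raise3 q p i j k = (\<Sum>\<^sub>7 a b c. q $ i $ a * q $ j $ b * q $ k $ c * p a b c)"

lemma raise3_eq_pull3:
  assumes "transpose q = q"
  shows "raise3 q p = pull3 q p"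
proof -
  have "q $ i $ j = q $ j $ i" for i j
    using arg_cong[OF assms, of "\<lambda>M. M $ j $ i"] by (simp add: transpose_def)
  then have "q $ i $ a * q $ j $ b * q $ k $ c = q $ a $ i * q $ b $ j * q $ c $ k" for i j k a b c
    by metis
  then show ?thesis unfolding raise3_def pull3_def fun_eq_iff by simp
qed

lemma pull3_pull3: "pull3 Q (pull3 P p) = pull3 (P ** Q) p"
proof (intro ext)
  fix i j k
  define h1 where "h1 b c i = (\<Sum>\<^sub>7 a. P $ a $ i * p a b c)" for b c i
  have first: "(\<Sum>\<^sub>7 i'. Q $ i' $ i * (\<Sum>\<^sub>7 a. P $ a $ i' * F a)) = (\<Sum>\<^sub>7 a. (P ** Q) $ a $ i * F a)" for F :: "7 \<Rightarrow> real" and i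
    unfolding matrix_matrix_mult_def by (simp add: sum_distrib_left sum_distrib_right mult_ac) (rule sum.swap)
  have comm: "(\<Sum>\<^sub>7 j. Q $ j $ u * (\<Sum>\<^sub>7 a. P $ a $ w * S a j)) = (\<Sum>\<^sub>7 a. P $ a $ w * (\<Sum>\<^sub>7 j. Q $ j $ u * S a j))"
    for u w and S :: "7 \<Rightarrow> 7 \<Rightarrow> real"
    by (simp add: sum_distrib_left mult.left_commute) (rule sum.swap)
  have nest: "pull3 M p i j k = (\<Sum>\<^sub>7 a. M $ a $ i * (\<Sum>\<^sub>7 b. M $ b $ j * (\<Sum>\<^sub>7 c. M $ c $ k * p a b c)))" for M p i j k
    unfolding pull3_def by (simp add: sum_distrib_left mult_ac)
  have "pull3 Q (pull3 P p) i j k = (\<Sum>\<^sub>7 i'. Q $ i' $ i * (\<Sum>\<^sub>7 j'. Q $ j' $ j * (\<Sum>\<^sub>7 k'. Q $ k' $ k *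
     (\<Sum>\<^sub>7 a. P $ a $ i' * (\<Sum>\<^sub>7 b. P $ b $ j' * (\<Sum>\<^sub>7 c. P $ c $ k' * p a b c))))))"
    unfolding nest ..
  also have "\<dots> = (\<Sum>\<^sub>7 i'. Q $ i' $ i * (\<Sum>\<^sub>7 a. P $ a $ i' * (\<Sum>\<^sub>7 j'. Q $ j' $ j * (\<Sum>\<^sub>7 b. P $ b $ j' * (\<Sum>\<^sub>7 k'. Q $ k' $ k *
     (\<Sum>\<^sub>7 c. P $ c $ k' * p a b c))))))"
    by (simp only: comm)
  also have "\<dots> = pull3 (P ** Q) p i j k"
    unfolding first nest ..
  finally show "pull3 Q (pull3 P p) i j k = pull3 (P ** Q) p i j k" .
qed

lemma alt3_comp3:
  assumes "kcovector 3 \<phi>"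
  shows "alt3 (comp3 \<phi>)"
proof -
  have H: "\<phi> (l[a := l ! b, b := l ! a]) = - \<phi> l" if "length l = 3" "a < b" "b < 3" for l a b
    using assms that unfolding kcovector_def by blast
  show ?thesis
    unfolding alt3_def comp3_def
  proof (intro conjI allI)
    fix i j k
    show "\<phi> [j, i, k] = - \<phi> [i, j, k]" using H[of "[i,j,k]" 0 1] by simp
    show "\<phi> [i, k, j] = - \<phi> [i, j, k]" using H[of "[i,j,k]" 1 2] by simp
  qed
qed

text \<open>In an oriented orthonormal frame the Hitchin form 6 v g becomes 6 v det P times the
  identity, and v det P = 1: exactly the normalisation assumed for the cross product
  relation.\<close>

lemma positive_covector_frame:
  assumes "positive_covector \<phi>"
  obtains P where "transpose P ** G2_metric \<phi> ** P = mat 1" "matrix_inv (G2_metric \<phi>) = P ** transpose P"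
    "clifford3 1 (pull3 P (comp3 \<phi>))" "G2_metric \<phi> ** matrix_inv (G2_metric \<phi>) = mat 1" "invertible P"
proof -
  let ?g = "G2_metric \<phi>" and ?v = "vol_density \<phi>"
  note g = G2_metric_eq[OF assms]
  obtain P where P: "transpose P ** ?g ** P = mat 1" "matrix_inv ?g = P ** transpose P"
    "det P > 0" "det ?g > 0" "sqrt (det ?g) * det P = 1" "?g ** matrix_inv ?g = mat 1"
    using inner_product_matrix_frame[OF g(2)] .
  have "hitchin (comp3 \<phi>) = (6 * ?v) *\<^sub>R ?g"
    using g(1,3) by simp
  then have "hitchin (pull3 P (comp3 \<phi>)) = (6 * (?v * det P)) *\<^sub>R (transpose P ** ?g ** P)"
    by (simp add: hitchin_pull3 matrix_scalar_ac scalar_matrix_assoc[symmetric] mult_ac)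
  then have "hitchin (pull3 P (comp3 \<phi>)) = 6 *\<^sub>R mat 1"
    using P(1,5) g(4) by simp
  moreover have "alt3 (pull3 P (comp3 \<phi>))"
    using assms by (intro alt3_pull3 alt3_comp3) (simp add: positive_covector_def)
  ultimately have "clifford3 1 (pull3 P (comp3 \<phi>))" by (intro clifford3_of_hitchin)
  moreover have "invertible P" using P(3) by (simp add: invertible_det_nz)
  ultimately show thesis using that P by blast
qed

lemma pull3_outer:
  "pull3 P p i j k = (\<Sum>\<^sub>7 a. P $ a $ i * (\<Sum>\<^sub>7 b c. P $ b $ j * P $ c $ k * p a b c))"
  unfolding pull3_def by (simp add: sum_distrib_left mult_ac)

lemma raise3_frame:
  assumes "q = P ** transpose P"
  shows "raise3 q p i j k = (\<Sum>\<^sub>7 a b c. P $ i $ a * P $ j $ b * P $ k $ c * pull3 P p a b c)"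
proof -
  have q: "transpose q = q" using assms by (simp add: matrix_transpose_mul)
  have "raise3 q p = pull3 (transpose P) (pull3 P p)"
    using raise3_eq_pull3[OF q] pull3_pull3[of "transpose P" P p] assms by metis
  then show ?thesis by (simp add: pull3_def transpose_def)
qed

text \<open>The frame identity is carried back in halves. \<open>h\<close> moves only two indices of
  the 3-form to the frame; moving the third one gives P^T C = 6 P^T, and the invertible P^T
  cancels.\<close>

lemma G2_contraction:
  assumes \<phi>: "positive_covector \<phi>"
  defines "f \<equiv> comp3 \<phi>" and "q \<equiv> matrix_inv (G2_metric \<phi>)"
  shows "(\<Sum>\<^sub>7 j k. f m j k * raise3 q f n j k) = 6 * kd m n"
proof -
  obtain P where P: "q = P ** transpose P" "clifford3 1 (pull3 P f)" "invertible P"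
    using positive_covector_frame[OF \<phi>] unfolding f_def q_def by blast
  let ?F = "pull3 P f"
  define h where "h m a b = (\<Sum>\<^sub>7 j k. P $ j $ a * P $ k $ b * f m j k)" for m a b
  have F: "?F i a b = (\<Sum>\<^sub>7 m. P $ m $ i * h m a b)" for i a b
    unfolding pull3_outer h_def ..
  define C where "C = (\<chi> m n. \<Sum>\<^sub>7 j k. f m j k * raise3 q f n j k)"
  have C: "C $ m $ n = (\<Sum>\<^sub>7 i a b. P $ n $ i * ?F i a b * h m a b)" for m n
  proof -
    have "C $ m $ n = (\<Sum>\<^sub>7 j k i a. \<Sum>b\<in>UNIV.
        P $ n $ i * ?F i a b * (P $ j $ a * P $ k $ b * f m j k))"
      unfolding C_def raise3_frame[OF P(1)] by (simp add: sum_distrib_left mult_ac)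
    also have "\<dots> = (\<Sum>\<^sub>7 i j k a. \<Sum>b\<in>UNIV.
        P $ n $ i * ?F i a b * (P $ j $ a * P $ k $ b * f m j k))"
      by (rule sum3_rotate)
    also have "\<dots> = (\<Sum>\<^sub>7 i a b j k.
        P $ n $ i * ?F i a b * (P $ j $ a * P $ k $ b * f m j k))"
      by (rule sum.cong[OF refl], rule sum4_swap_pairs)
    finally show ?thesis by (simp add: h_def sum_distrib_left)
  qed
  have "transpose P ** C = 6 *\<^sub>R transpose P"
  proof -
    have "(transpose P ** C) $ l $ n = 6 * P $ n $ l" for l n
    proof -
      have "(transpose P ** C) $ l $ n = (\<Sum>\<^sub>7 m i a b. P $ m $ l * (P $ n $ i * ?F i a b * h m a b))"
        by (simp add: matrix_matrix_mult_def transpose_def C sum_distrib_left)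
      also have "\<dots> = (\<Sum>\<^sub>7 i m a b. P $ m $ l * (P $ n $ i * ?F i a b * h m a b))"
        by (rule sum.swap)
      also have "\<dots> = (\<Sum>\<^sub>7 i a b m. P $ m $ l * (P $ n $ i * ?F i a b * h m a b))"
        by (rule sum.cong[OF refl], rule sum3_rotate')
      also have "\<dots> = (\<Sum>\<^sub>7 i. P $ n $ i * (\<Sum>\<^sub>7 a b. ?F i a b * ?F l a b))"
        unfolding F[of l] by (simp add: sum_distrib_left mult_ac)
      also have "\<dots> = 6 * (\<Sum>\<^sub>7 i. P $ n $ i * kd i l)"
        unfolding clifford3_contraction[OF P(2)] by (simp add: sum_distrib_left mult_ac del: sum_kd)
      finally show ?thesis by simp
    qed
    then show ?thesis by (simp add: vec_eq_iff transpose_def)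
  qed
  then have PC: "transpose P ** C = transpose P ** (6 *\<^sub>R mat 1)"
    by (simp add: matrix_scalar_ac)
  obtain R where R: "R ** transpose P = mat 1"
    using transpose_invertible[OF P(3)] unfolding invertible_def by blast
  have "C = (R ** transpose P) ** C" by (simp add: R)
  also have "\<dots> = (R ** transpose P) ** (6 *\<^sub>R mat 1)"
    unfolding matrix_mul_assoc[symmetric] PC ..
  finally have "C = 6 *\<^sub>R mat 1" by (simp add: R)
  then have "C $ m $ n = 6 * kd m n" by (simp add: mat_def kd_def)
  then show ?thesis by (simp add: C_def)
qed

section \<open>Derivatives of the metric and the volume\<close>

lemma has_derivative_partial:
  assumes "(F has_derivative F') (at x)"
  shows "partial m F x = F' (axis m 1)"
  unfolding partial_def using frechet_derivative_at[OF assms] by simp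

lemma partial_has_derivative:
  assumes "F differentiable at x"
  shows "(F has_derivative frechet_derivative F (at x)) (at x)"
  using assms by (simp add: frechet_derivative_works)

lemma partial_mult:
  fixes F G :: "R7 \<Rightarrow> real"
  assumes "F differentiable at x" "G differentiable at x"
  shows "partial m (\<lambda>y. F y * G y) x = partial m F x * G x + F x * partial m G x"
  using has_derivative_partial[OF has_derivative_mult[OF partial_has_derivative partial_has_derivative, OF assms]]
  by (simp add: partial_def)

lemma partial_cmult:
  fixes F :: "R7 \<Rightarrow> real"
  assumes "F differentiable at x"
  shows "partial m (\<lambda>y. c * F y) x = c * partial m F x"
  using has_derivative_partial[OF has_derivative_mult_right[OF partial_has_derivative[OF assms]]]
  by (simp add: partial_def)

lemma partial_minus:
  fixes F :: "R7 \<Rightarrow> real"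
  assumes "F differentiable at x"
  shows "partial m (\<lambda>y. - F y) x = - partial m F x"
  using has_derivative_partial[OF has_derivative_minus[OF partial_has_derivative[OF assms]]]
  by (simp add: partial_def)

lemma partial_sum:
  fixes F :: "'b \<Rightarrow> R7 \<Rightarrow> real"
  assumes "\<And>i. i \<in> I \<Longrightarrow> F i differentiable at x"
  shows "partial m (\<lambda>y. \<Sum>i\<in>I. F i y) x = (\<Sum>i\<in>I. partial m (F i) x)"
  using has_derivative_partial[OF has_derivative_sum[OF partial_has_derivative, OF assms]]
  by (simp add: partial_def)

lemma partial_const: "partial m (\<lambda>y. c) x = 0"
  by (simp add: partial_def)

lemma differentiable_transform_open:
  assumes "F differentiable at x" "open U" "x \<in> U" "\<And>y. y \<in> U \<Longrightarrow> F y = G y"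
  shows "G differentiable at x"
  using assms unfolding differentiable_def by (metis has_derivative_transform_within_open)

lemma partial_transform_open:
  assumes "F differentiable at x" "open U" "x \<in> U" "\<And>y. y \<in> U \<Longrightarrow> F y = G y"
  shows "partial m G x = partial m F x"
  unfolding partial_def using frechet_derivative_transform_within_open[OF assms] by simp

lemma det_replace_row:
  fixes A :: "real^7^7"
  shows "(\<Sum>p | p permutes UNIV. of_int (sign p) * (w $ p i * (\<Prod>j\<in>UNIV - {i}. A $ j $ p j)))
    = det (\<chi> r. if r = i then w else row r A)"
  unfolding det_def
proof (intro sum.cong refl arg_cong2[where f = "(*)"])
  fix p
  show "w $ p i * (\<Prod>j\<in>UNIV - {i}. A $ j $ p j) = (\<Prod>r\<in>UNIV. (\<chi> r. if r = i then w else row r A) $ r $ p r)"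
    by (subst prod.remove[of UNIV i]) (auto simp: row_def intro!: prod.cong)
qed

lemma det_has_derivative:
  fixes M :: "R7 \<Rightarrow> real^7^7"
  assumes "\<And>i k. (\<lambda>y. M y $ i $ k) differentiable at x"
  shows "((\<lambda>y. det (M y)) has_derivative (\<lambda>h. \<Sum>p | p permutes UNIV. of_int (sign p) *
      (\<Sum>\<^sub>7 i. frechet_derivative (\<lambda>y. M y $ i $ p i) (at x) h * (\<Prod>j\<in>UNIV - {i}. M x $ j $ p j)))) (at x)"
  unfolding det_def
  by (intro has_derivative_sum has_derivative_mult_right has_derivative_prod partial_has_derivative assms)

lemma det_differentiable:
  fixes M :: "R7 \<Rightarrow> real^7^7"
  assumes "\<And>i k. (\<lambda>y. M y $ i $ k) differentiable at x"
  shows "(\<lambda>y. det (M y)) differentiable at x"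
  using det_has_derivative[of M, OF assms] by (rule differentiableI)

text \<open>Jacobi's formula. Each summand replaces row i of M by row i of its derivative D; as D =
  (D G) M, that row is a combination of the rows of M, and only its i-th coefficient counts.\<close>

lemma partial_det:
  fixes M :: "R7 \<Rightarrow> real^7^7"
  assumes M: "\<And>i k. (\<lambda>y. M y $ i $ k) differentiable at x" and G: "G ** M x = mat 1"
  shows "partial m (\<lambda>y. det (M y)) x = det (M x) * (\<Sum>\<^sub>7 i k. partial m (\<lambda>y. M y $ i $ k) x * G $ k $ i)"
proof -
  define D where "D = (\<chi> i k. partial m (\<lambda>y. M y $ i $ k) x)"
  have "partial m (\<lambda>y. det (M y)) x = (\<Sum>p | p permutes UNIV. of_int (sign p) *
      (\<Sum>\<^sub>7 i. D $ i $ p i * (\<Prod>j\<in>UNIV - {i}. M x $ j $ p j)))"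
    using has_derivative_partial[OF det_has_derivative[of M, OF M]] by (simp add: D_def partial_def)
  also have "\<dots> = (\<Sum>\<^sub>7 i. \<Sum>p | p permutes UNIV. of_int (sign p) * ((D $ i) $ p i * (\<Prod>j\<in>UNIV - {i}. M x $ j $ p j)))"
    unfolding sum_distrib_left by (rule sum.swap)
  also have "\<dots> = (\<Sum>\<^sub>7 i. det (\<chi> r. if r = i then D $ i else row r (M x)))"
    unfolding det_replace_row ..
  also have "\<dots> = (\<Sum>\<^sub>7 i. (D ** G) $ i $ i * det (M x))"
  proof (intro sum.cong refl)
    fix i
    have "D = (D ** G) ** M x" using G by (simp add: matrix_mul_assoc[symmetric])
    then have "D $ i = ((D ** G) ** M x) $ i" by simp
    also have "\<dots> = (\<Sum>\<^sub>7 k. ((D ** G) $ i) $ k *s row k (M x))"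
      by (simp add: vec_eq_iff matrix_matrix_mult_def[of "D ** G"] row_def)
    finally have w: "D $ i = (\<Sum>\<^sub>7 k. ((D ** G) $ i) $ k *s row k (M x))" .
    show "det (\<chi> r. if r = i then D $ i else row r (M x)) = (D ** G) $ i $ i * det (M x)"
      unfolding w using cramer_lemma_transpose[of i "(D ** G) $ i" "M x"] by simp
  qed
  finally show ?thesis
    by (simp add: matrix_matrix_mult_def D_def sum_distrib_left sum_distrib_right mult_ac)
qed

text \<open>The torsion at a point depends on \<phi> and its derivatives in one chart, so the
  analysis takes place on an open set of coordinates.\<close>

locale closed_G2_chart =
  fixes U :: "R7 set" and \<phi> :: "R7 \<Rightarrow> covector"
  assumes open_U: "open U"
    and positive: "y \<in> U \<Longrightarrow> positive_covector (\<phi> y)"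
    and differentiable: "y \<in> U \<Longrightarrow> (\<lambda>z. \<phi> z l) differentiable at y"
    and closed: "y \<in> U \<Longrightarrow> ext_d 3 \<phi> y l = 0"
begin

abbreviation "f y \<equiv> comp3 (\<phi> y)"
abbreviation "g y \<equiv> G2_metric (\<phi> y)"
abbreviation "q y \<equiv> matrix_inv (g y)"
abbreviation "v y \<equiv> vol_density (\<phi> y)"

text \<open>A trivector density of weight one; its coordinate divergence computes the
  codifferential.\<close>

definition dens :: "R7 \<Rightarrow> 7 \<Rightarrow> 7 \<Rightarrow> 7 \<Rightarrow> real" where
  "dens y i j k = v y * raise3 (q y) (f y) i j k"

lemma f_alt3: "y \<in> U \<Longrightarrow> alt3 (f y)"
  using positive by (intro alt3_comp3) (simp add: positive_covector_def)

lemma metric_facts: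
  assumes "y \<in> U"
  shows "g y ** q y = mat 1" "q y ** g y = mat 1" "transpose (q y) = q y" "transpose (g y) = g y" "v y > 0"
    "det (g y) = (v y)\<^sup>2" "det (q y) * (v y)\<^sup>2 = 1" "sqrt (det (g y)) = v y"
proof -
  note e = G2_metric_eq[OF positive[OF assms]]
  obtain P where P: "transpose P ** g y ** P = mat 1" "q y = P ** transpose P" "clifford3 1 (pull3 P (f y))"
    "g y ** q y = mat 1" "invertible P"
    using positive_covector_frame[OF positive[OF assms]] .
  show gq: "g y ** q y = mat 1" by fact
  then show "q y ** g y = mat 1" using matrix_left_right_inverse by blast
  show "transpose (q y) = q y" unfolding P(2) by (simp add: matrix_transpose_mul)
  show "transpose (g y) = g y" using e(2) by (simp add: inner_product_matrix_def)
  show v: "v y > 0" by fact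
  show sq: "sqrt (det (g y)) = v y" by fact
  show dg: "det (g y) = (v y)\<^sup>2" using sq v by (metis less_eq_real_def real_sqrt_gt_0_iff real_sqrt_pow2)
  have "det (g y) * det (q y) = 1" using gq by (metis det_I det_mul)
  then show "det (q y) * (v y)\<^sup>2 = 1" by (simp add: dg mult.commute)
qed

lemma f_differentiable: "y \<in> U \<Longrightarrow> (\<lambda>z. f z i j k) differentiable at y"
  unfolding comp3_def by (rule differentiable)

lemma hitchin_differentiable:
  assumes "y \<in> U"
  shows "(\<lambda>z. hitchin (f z) $ i $ j) differentiable at y"
  unfolding hitchin_def vec_lambda_beta
  by (intro differentiable_divide differentiable_sum differentiable_mult differentiable_const ballI f_differentiable[OF assms])
    simp_all

lemma v_differentiable:
  assumes "y \<in> U"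
  shows "v differentiable at y"
proof -
  have pos: "det (hitchin (f y)) / 6 ^ 7 > 0"
    using metric_facts(5)[OF assms] by (simp add: vol_density_def)
  then have "root 9 differentiable at (det (hitchin (f y)) / 6 ^ 7)"
    using DERIV_real_root[of 9 "det (hitchin (f y)) / 6 ^ 7"]
    by (intro differentiableI[OF has_field_derivative_imp_has_derivative]) auto
  moreover have "(\<lambda>z. det (hitchin (f z)) / 6 ^ 7) differentiable at y"
    by (intro differentiable_divide det_differentiable hitchin_differentiable[OF assms]) simp_all
  ultimately show ?thesis
    unfolding vol_density_def by (rule differentiable_compose)
qed

lemma g_differentiable:
  assumes "y \<in> U"
  shows "(\<lambda>z. g z $ i $ j) differentiable at y"
proof (rule differentiable_transform_open[OF _ open_U assms])
  show "(\<lambda>z. inverse (6 * v z) * hitchin (f z) $ i $ j) differentiable at y"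
    using metric_facts(5)[OF assms]
    by (intro differentiable_mult differentiable_inverse hitchin_differentiable[OF assms] v_differentiable[OF assms] differentiable_const) simp
  show "inverse (6 * v z) * hitchin (f z) $ i $ j = g z $ i $ j" if "z \<in> U" for z
    using G2_metric_eq(1)[OF positive[OF that]] by simp
qed

text \<open>Cramer's rule writes the entries of the inverse as quotients of determinants with
  differentiable entries. The formula holds on \<open>U\<close>, hence the transfer along an open
  set.\<close>

lemma q_differentiable:
  assumes "y \<in> U"
  shows "(\<lambda>z. q z $ k $ j) differentiable at y"
proof (rule differentiable_transform_open[OF _ open_U assms])
  let ?M = "\<lambda>z. (\<chi> i l. if l = k then (axis j 1 :: R7) $ i else g z $ i $ l) :: real^7^7"
  show "(\<lambda>z. det (?M z) / det (g z)) differentiable at y"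
  proof (intro differentiable_divide det_differentiable g_differentiable[OF assms])
    show "(\<lambda>z. ?M z $ i $ l) differentiable at y" for i l
      using g_differentiable[OF assms, of i l] by (cases "l = k") simp_all
    show "det (g y) \<noteq> 0" using metric_facts(5,6)[OF assms] by simp
  qed
  show "det (?M z) / det (g z) = q z $ k $ j" if "z \<in> U" for z
  proof -
    have "g z *v (q z *v axis j 1) = axis j 1"
      using metric_facts(1)[OF that] by (simp add: matrix_vector_mul_assoc)
    moreover have "det (g z) \<noteq> 0" using metric_facts(5,6)[OF that] by simp
    ultimately have "q z *v axis j 1 = (\<chi> k. det (\<chi> i l. if l = k then (axis j 1 :: R7) $ i else g z $ i $ l) / det (g z))"
      using cramer[of "g z"] by blast
    then have "(q z *v axis j 1) $ k = det (?M z) / det (g z)" by simp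
    then show ?thesis by (simp add: matrix_vector_mult_basis column_def)
  qed
qed

lemma raise3_differentiable:
  assumes "y \<in> U"
  shows "(\<lambda>z. raise3 (q z) (f z) i j k) differentiable at y"
  unfolding raise3_def
  by (intro differentiable_sum differentiable_mult ballI f_differentiable[OF assms] q_differentiable[OF assms]) simp_all

lemma dens_differentiable:
  assumes "y \<in> U"
  shows "(\<lambda>z. dens z i j k) differentiable at y"
  unfolding dens_def
  by (intro differentiable_mult v_differentiable raise3_differentiable assms)

lemma contraction:
  assumes "y \<in> U"
  shows "(\<Sum>\<^sub>7 j k. f y m j k * dens y n j k) = 6 * v y * kd m n"
  using G2_contraction[OF positive[OF assms], of m n]
  by (simp add: dens_def mult.left_commute[of _ "v y"] flip: sum_distrib_left)

lemma alt3_raise3: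
  assumes "y \<in> U"
  shows "alt3 (raise3 (q y) (f y))"
  unfolding raise3_eq_pull3[OF metric_facts(3)[OF assms]] by (rule alt3_pull3[OF f_alt3[OF assms]])

lemma alt3_dens:
  assumes "y \<in> U"
  shows "alt3 (dens y)"
  unfolding alt3_def dens_def
proof (intro conjI allI)
  note sw = alt3_swap[OF alt3_raise3[OF assms]]
  fix i j k
  show "v y * raise3 (q y) (f y) j i k = - (v y * raise3 (q y) (f y) i j k)"
    by (subst sw(1)) (rule mult_minus_right)
  show "v y * raise3 (q y) (f y) i k j = - (v y * raise3 (q y) (f y) i j k)"
    by (subst sw(2)) (rule mult_minus_right)
qed

end

lemma sum6_transpose:
  "(\<Sum>i\<in>A. \<Sum>j\<in>A. \<Sum>k\<in>A. \<Sum>a\<in>A. \<Sum>b\<in>A. \<Sum>c\<in>A. G j i k b a c)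
    = (\<Sum>i\<in>A. \<Sum>j\<in>A. \<Sum>k\<in>A. \<Sum>a\<in>A. \<Sum>b\<in>A. \<Sum>c\<in>A. G i j k a b c :: real)"
proof -
  have "(\<Sum>i\<in>A. \<Sum>j\<in>A. \<Sum>k\<in>A. \<Sum>a\<in>A. \<Sum>b\<in>A. \<Sum>c\<in>A. G j i k b a c)
      = (\<Sum>i\<in>A. \<Sum>j\<in>A. \<Sum>k\<in>A. \<Sum>a\<in>A. \<Sum>b\<in>A. \<Sum>c\<in>A. G j i k a b c)"
    by (rule sum.cong[OF refl], rule sum.cong[OF refl], rule sum.cong[OF refl], rule sum.swap)
  also have "\<dots> = (\<Sum>i\<in>A. \<Sum>j\<in>A. \<Sum>k\<in>A. \<Sum>a\<in>A. \<Sum>b\<in>A. \<Sum>c\<in>A. G i j k a b c)"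
    by (rule sum.swap)
  finally show ?thesis .
qed

lemma sum6_cycle:
  "(\<Sum>i\<in>A. \<Sum>j\<in>A. \<Sum>k\<in>A. \<Sum>a\<in>A. \<Sum>b\<in>A. \<Sum>c\<in>A. G k i j c a b)
    = (\<Sum>i\<in>A. \<Sum>j\<in>A. \<Sum>k\<in>A. \<Sum>a\<in>A. \<Sum>b\<in>A. \<Sum>c\<in>A. G i j k a b c :: real)"
proof -
  have "(\<Sum>i\<in>A. \<Sum>j\<in>A. \<Sum>k\<in>A. \<Sum>a\<in>A. \<Sum>b\<in>A. \<Sum>c\<in>A. G k i j c a b)
      = (\<Sum>i\<in>A. \<Sum>j\<in>A. \<Sum>k\<in>A. \<Sum>c\<in>A. \<Sum>a\<in>A. \<Sum>b\<in>A. G k i j c a b)"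
    by (rule sum.cong[OF refl], rule sum.cong[OF refl], rule sum.cong[OF refl], rule sum3_rotate)
  also have "\<dots> = (\<Sum>k\<in>A. \<Sum>i\<in>A. \<Sum>j\<in>A. \<Sum>c\<in>A. \<Sum>a\<in>A. \<Sum>b\<in>A. G k i j c a b)"
    by (rule sum3_rotate)
  finally show ?thesis .
qed

context closed_G2_chart
begin

lemma partial_alt3:
  assumes x: "x \<in> U" and F: "\<And>y. y \<in> U \<Longrightarrow> alt3 (F y)" and d: "\<And>i j k. (\<lambda>y. F y i j k) differentiable at x"
  shows "alt3 (\<lambda>i j k. partial m (\<lambda>y. F y i j k) x)"
  unfolding alt3_def
proof (intro conjI allI)
  fix i j k
  have "partial m (\<lambda>y. F y j i k) x = partial m (\<lambda>y. - F y i j k) x"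
    by (rule partial_transform_open[OF _ open_U x]) (use d in \<open>auto simp: alt3_swap(1)[OF F, of _ i j k]\<close>)
  then show "partial m (\<lambda>y. F y j i k) x = - partial m (\<lambda>y. F y i j k) x"
    using partial_minus[OF d] by simp
  have "partial m (\<lambda>y. F y i k j) x = partial m (\<lambda>y. - F y i j k) x"
    by (rule partial_transform_open[OF _ open_U x]) (use d in \<open>auto simp: alt3_swap(2)[OF F, of _ i j k]\<close>)
  then show "partial m (\<lambda>y. F y i k j) x = - partial m (\<lambda>y. F y i j k) x"
    using partial_minus[OF d] by simp
qed

text \<open>Differentiating \<open>\<phi>\<^sub>i\<^sub>j\<^sub>k \<phi>\<^sup>i\<^sup>j\<^sup>k = 42\<close> gives the first variation of the volume.\<close>

lemma volume_derivative:
  assumes x: "x \<in> U"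
  shows "(\<Sum>\<^sub>7 i j k. partial m (\<lambda>y. f y i j k) x * dens x i j k) = 18 * partial m v x"
proof -
  note df = f_differentiable[OF x] and dq = q_differentiable[OF x] and dv = v_differentiable[OF x]
    and dr = raise3_differentiable[OF x]
  define \<delta> where "\<delta> i j k = partial m (\<lambda>y. f y i j k) x" for i j k
  define Q where "Q i a = partial m (\<lambda>y. q y $ i $ a) x" for i a
  let ?F = "f x" and ?q = "q x"
  \<comment> \<open>The contribution of the derivative of one inverse metric factor. The three
    factors give equal sums, by relabelling and skewness of the 3-form.\<close>
  define G where "G i j k a b c = Q i a * (?F i j k * (?q $ j $ b * (?q $ k $ c * ?F a b c)))" for i j k a b c
  have F: "alt3 ?F" by (rule f_alt3[OF x])
  have qs: "?q $ i $ a = ?q $ a $ i" for i a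
    using arg_cong[OF metric_facts(3)[OF x], of "\<lambda>M. M $ a $ i"] by (simp add: transpose_def)
  have dr': "partial m (\<lambda>y. raise3 (q y) (f y) i j k) x = (\<Sum>\<^sub>7 a b. \<Sum>c\<in>UNIV.
      Q i a * ?q $ j $ b * ?q $ k $ c * ?F a b c + ?q $ i $ a * Q j b * ?q $ k $ c * ?F a b c
      + ?q $ i $ a * ?q $ j $ b * Q k c * ?F a b c + ?q $ i $ a * ?q $ j $ b * ?q $ k $ c * \<delta> a b c)" for i j k
    unfolding raise3_def
    by (simp add: partial_sum partial_mult df dq \<delta>_def Q_def algebra_simps)
  have const: "(\<Sum>\<^sub>7 i j k. f y i j k * raise3 (q y) (f y) i j k) = 42" if "y \<in> U" for y
    using G2_contraction[OF positive[OF that]] by simp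
  have "0 = partial m (\<lambda>y. \<Sum>\<^sub>7 i j k. f y i j k * raise3 (q y) (f y) i j k) x"
    using partial_transform_open[of "\<lambda>y. 42 :: real" x U _ m] open_U x const by (simp add: partial_const)
  also have "\<dots> = (\<Sum>\<^sub>7 i j k. \<delta> i j k * raise3 ?q ?F i j k
      + ?F i j k * partial m (\<lambda>y. raise3 (q y) (f y) i j k) x)"
    by (simp add: partial_sum partial_mult df dr \<delta>_def)
  also have "\<dots> = (\<Sum>\<^sub>7 i j k. \<delta> i j k * raise3 ?q ?F i j k)
      + (\<Sum>\<^sub>7 i j k a b c. G i j k a b c)
      + (\<Sum>\<^sub>7 i j k a b c. G j i k b a c)
      + (\<Sum>\<^sub>7 i j k a b c. G k i j c a b)
      + (\<Sum>\<^sub>7 i j k a b. \<Sum>c\<in>UNIV.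
          \<delta> a b c * (?q $ a $ i * ?q $ b $ j * ?q $ c $ k * ?F i j k))"
  proof -
    have 1: "?F i j k * (Q i a * ?q $ j $ b * ?q $ k $ c * ?F a b c + ?q $ i $ a * Q j b * ?q $ k $ c * ?F a b c
      + ?q $ i $ a * ?q $ j $ b * Q k c * ?F a b c + ?q $ i $ a * ?q $ j $ b * ?q $ k $ c * \<delta> a b c)
      = G i j k a b c + G j i k b a c + G k i j c a b + \<delta> a b c * (?q $ a $ i * ?q $ b $ j * ?q $ c $ k * ?F i j k)"
      for i j k a b c
      unfolding G_def alt3_swap(1)[OF F, of j i k] alt3_swap(1)[OF F, of b a c]
        alt3_swap(4)[OF F, of k i j] alt3_swap(4)[OF F, of c a b] qs[of a i] qs[of b j] qs[of c k]
      by (simp add: algebra_simps)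
    show ?thesis
      unfolding dr' sum_distrib_left 1 by (simp add: sum.distrib)
  qed
  also have "(\<Sum>\<^sub>7 i j k a b. \<Sum>c\<in>UNIV.
          \<delta> a b c * (?q $ a $ i * ?q $ b $ j * ?q $ c $ k * ?F i j k))
      = (\<Sum>\<^sub>7 a b c. \<delta> a b c * raise3 ?q ?F a b c)"
  proof -
    have "(\<Sum>\<^sub>7 i j k a b c. H i j k a b c)
        = (\<Sum>\<^sub>7 a b c i j k. H i j k a b c)"
      for H :: "7 \<Rightarrow> 7 \<Rightarrow> 7 \<Rightarrow> 7 \<Rightarrow> 7 \<Rightarrow> 7 \<Rightarrow> real"
    proof -
      have "(\<Sum>\<^sub>7 i j k a b c. H i j k a b c)
        = (\<Sum>\<^sub>7 i j a b c k. H i j k a b c)"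
        by (rule sum.cong[OF refl], rule sum.cong[OF refl])
          (subst sum.swap, rule sum.cong[OF refl], rule sum3_rotate')
      also have "\<dots> = (\<Sum>\<^sub>7 i a b c j k. H i j k a b c)"
        by (rule sum.cong[OF refl]) (subst sum.swap, rule sum.cong[OF refl], rule sum3_rotate')
      also have "\<dots> = (\<Sum>\<^sub>7 a b c i j k. H i j k a b c)"
        by (subst sum.swap, rule sum.cong[OF refl], rule sum3_rotate')
      finally show ?thesis .
    qed
    then show ?thesis unfolding raise3_def sum_distrib_left .
  qed
  also have "(\<Sum>\<^sub>7 i j k a b c. G j i k b a c)
      = (\<Sum>\<^sub>7 i j k a b c. G i j k a b c)"
    by (rule sum6_transpose)
  also have "(\<Sum>\<^sub>7 i j k a b c. G k i j c a b)
      = (\<Sum>\<^sub>7 i j k a b c. G i j k a b c)"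
    by (rule sum6_cycle)
  also have "(\<Sum>\<^sub>7 i j k a b c. G i j k a b c)
      = 6 * (\<Sum>\<^sub>7 i a. Q i a * g x $ a $ i)"
  proof -
    \<comment> \<open>Raising the remaining index turns this into the known contraction 6 \<delta>,
      so Z is 6 times the metric.\<close>
    define Z where "Z = (\<chi> i a. \<Sum>\<^sub>7 j k b c. ?F i j k * (?q $ j $ b * (?q $ k $ c * ?F a b c)))"
    have "Z ** ?q = 6 *\<^sub>R mat 1"
    proof -
      have "(Z ** ?q) $ i $ n = 6 * kd i n" for i n
      proof -
        have "(Z ** ?q) $ i $ n = (\<Sum>\<^sub>7 a j k b. \<Sum>c\<in>UNIV.
            ?F i j k * (?q $ n $ a * ?q $ j $ b * ?q $ k $ c * ?F a b c))"
          unfolding matrix_matrix_mult_def Z_def by (simp add: sum_distrib_left sum_distrib_right qs[of _ n] mult_ac)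
        also have "\<dots> = (\<Sum>\<^sub>7 j k. ?F i j k * raise3 ?q ?F n j k)"
          unfolding raise3_def sum_distrib_left by (rule sum3_rotate')
        finally show ?thesis using G2_contraction[OF positive[OF x]] by simp
      qed
      then show ?thesis by (simp add: vec_eq_iff mat_def kd_def)
    qed
    moreover have "Z = (Z ** ?q) ** g x"
      using metric_facts(2)[OF x] by (simp add: matrix_mul_assoc[symmetric])
    ultimately have "Z = (6 *\<^sub>R mat 1) ** g x" by metis
    then have "Z = 6 *\<^sub>R g x" by (simp add: scalar_matrix_assoc[symmetric])
    then have Z: "Z $ i $ a = 6 * g x $ a $ i" for i a
      using arg_cong[OF metric_facts(4)[OF x], of "\<lambda>M. M $ i $ a"] by (simp add: transpose_def)
    have "(\<Sum>\<^sub>7 i j k a b c. G i j k a b c)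
        = (\<Sum>\<^sub>7 i a j k b c. G i j k a b c)"
      by (rule sum.cong[OF refl], rule sum3_rotate)
    also have "\<dots> = (\<Sum>\<^sub>7 i a. Q i a * Z $ i $ a)"
      by (simp add: G_def Z_def sum_distrib_left)
    finally show ?thesis by (simp add: Z sum_distrib_left mult_ac)
  qed
  \<comment> \<open>The two factors of the 3-form give twice the left-hand side and the three
    inverse metrics give 3 * 6 times the trace, hence -9.\<close>
  finally have main: "(\<Sum>\<^sub>7 i j k. \<delta> i j k * raise3 ?q ?F i j k)
      = - 9 * (\<Sum>\<^sub>7 i a. Q i a * g x $ a $ i)"
    by simp
  \<comment> \<open>Differentiating det q v^2 = 1 expresses the trace of the derivative of the
    inverse metric by that of v, with the factor -2 that turns -9 into 18.\<close>
  have "0 = partial m (\<lambda>y. det (q y) * (v y * v y)) x"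
    using partial_transform_open[of "\<lambda>y. 1 :: real" x U _ m] open_U x metric_facts(7)
    by (simp add: partial_const power2_eq_square)
  also have "\<dots> = partial m (\<lambda>y. det (q y)) x * (v x)\<^sup>2 + 2 * det ?q * v x * partial m v x"
    using dv det_differentiable[of q x, OF dq] by (simp add: partial_mult power2_eq_square algebra_simps)
  also have "partial m (\<lambda>y. det (q y)) x = det ?q * (\<Sum>\<^sub>7 i a. Q i a * g x $ a $ i)"
    unfolding Q_def by (rule partial_det[OF dq metric_facts(1)[OF x]])
  finally have "0 = det ?q * v x * (v x * (\<Sum>\<^sub>7 i a. Q i a * g x $ a $ i) + 2 * partial m v x)"
    by (simp add: power2_eq_square algebra_simps)
  moreover have "det ?q * v x \<noteq> 0" using metric_facts(5,7)[OF x] by auto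
  ultimately have vQ: "v x * (\<Sum>\<^sub>7 i a. Q i a * g x $ a $ i) = - 2 * partial m v x" by simp
  have "(\<Sum>\<^sub>7 i j k. \<delta> i j k * dens x i j k)
      = v x * (\<Sum>\<^sub>7 i j k. \<delta> i j k * raise3 ?q ?F i j k)"
    by (simp add: dens_def sum_distrib_left mult_ac)
  also have "\<dots> = - 9 * (v x * (\<Sum>\<^sub>7 i a. Q i a * g x $ a $ i))"
    unfolding main by (rule mult.left_commute)
  also have "\<dots> = 18 * partial m v x"
    unfolding vQ by simp
  finally show ?thesis unfolding \<delta>_def .
qed

lemma closed_components:
  assumes x: "x \<in> U"
  shows "partial k (\<lambda>y. f y m i j) x - partial m (\<lambda>y. f y k i j) x
    + partial i (\<lambda>y. f y k m j) x - partial j (\<lambda>y. f y k m i) x = 0"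
proof -
  have "{..3::nat} = {0,1,2,3}" by auto
  then show ?thesis
    using closed[OF x, of "[k,m,i,j]"] by (simp add: ext_d_def comp3_def)
qed

text \<open>Closedness turns the divergence of \<open>\<phi>\<^sub>m\<^sub>i\<^sub>j \<phi>\<^sup>k\<^sup>i\<^sup>j = 6 \<delta>\<^sub>m\<^sup>k\<close> into the vanishing of the
  \<open>\<Omega>\<^sup>2\<^sub>7\<close>-part of the torsion.\<close>

lemma divergence_identity:
  assumes x: "x \<in> U"
  shows "(\<Sum>\<^sub>7 k i j. f x m i j * partial k (\<lambda>y. dens y k i j) x) = 0"
proof -
  note df = f_differentiable[OF x] and dd = dens_differentiable[OF x] and dv = v_differentiable[OF x]
  define \<delta> where "\<delta> n i j k = partial n (\<lambda>y. f y i j k) x" for n i j k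
  have \<delta>: "alt3 (\<delta> n)" for n
    unfolding \<delta>_def by (rule partial_alt3[OF x f_alt3 df])
  have D: "alt3 (dens x)" by (rule alt3_dens[OF x])
  \<comment> \<open>The part of the differentiated contraction in which the derivative falls on
    \<phi>; the claim amounts to S being 6 times the derivative of \<open>v\<close>.\<close>
  define S where "S = (\<Sum>\<^sub>7 k i j. \<delta> k m i j * dens x k i j)"
  have "(\<Sum>\<^sub>7 i j. \<delta> k m i j * dens x k i j) + (\<Sum>\<^sub>7 i j. f x m i j * partial k (\<lambda>y. dens y k i j) x)
      = 6 * partial k v x * kd m k" for k
  proof -
    have "partial k (\<lambda>y. \<Sum>\<^sub>7 i j. f y m i j * dens y k i j) x = partial k (\<lambda>y. (6 * kd m k) * v y) x"
      by (rule partial_transform_open[OF _ open_U x])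
        (use dv contraction in \<open>auto intro!: differentiable_mult simp: kd_commute[of k m] mult_ac\<close>)
    then show ?thesis
      using dv by (simp add: partial_sum partial_mult partial_const df dd \<delta>_def sum.distrib add.commute mult_ac)
  qed
  then have "S + (\<Sum>\<^sub>7 k i j. f x m i j * partial k (\<lambda>y. dens y k i j) x)
      = (\<Sum>\<^sub>7 k. 6 * partial k v x * kd m k)"
    unfolding S_def sum.distrib[symmetric] by simp
  then have 1: "S + (\<Sum>\<^sub>7 k i j. f x m i j * partial k (\<lambda>y. dens y k i j) x) = 6 * partial m v x"
    by simp
  have third: "(\<Sum>\<^sub>7 k i j. \<delta> i k m j * dens x k i j) = S"
  proof -
    have "(\<Sum>\<^sub>7 k i j. \<delta> i k m j * dens x k i j)
        = (\<Sum>\<^sub>7 k i j. \<delta> k i m j * dens x i k j)"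
      by (rule sum.swap)
    also have "\<dots> = S"
      unfolding S_def
      by (intro sum.cong refl) (subst alt3_swap(1)[OF \<delta>], subst alt3_swap(1)[OF D], simp)
    finally show ?thesis .
  qed
  have fourth: "(\<Sum>\<^sub>7 k i j. \<delta> j k m i * dens x k i j) = - S"
  proof -
    have "(\<Sum>\<^sub>7 k i j. \<delta> j k m i * dens x k i j)
        = (\<Sum>\<^sub>7 k i j. \<delta> k i m j * dens x i j k)"
      by (rule sum3_rotate)
    also have "\<dots> = - S"
      unfolding S_def sum_negf[symmetric]
      by (intro sum.cong refl) (subst alt3_swap(1)[OF \<delta>], subst alt3_swap(4)[OF D, symmetric], simp)
    finally show ?thesis .
  qed
  \<comment> \<open>The equation d\<phi> = 0 contracted with the density: three of its four terms
    are S after relabelling, the other one is the first variation of the volume. So 3 S is 18 times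
    the derivative of \<open>v\<close>.\<close>
  have "0 = (\<Sum>\<^sub>7 k i j. (\<delta> k m i j - \<delta> m k i j + \<delta> i k m j - \<delta> j k m i) * dens x k i j)"
    using closed_components[OF x] by (simp add: \<delta>_def)
  also have "\<dots> = S - (\<Sum>\<^sub>7 k i j. \<delta> m k i j * dens x k i j)
      + (\<Sum>\<^sub>7 k i j. \<delta> i k m j * dens x k i j)
      - (\<Sum>\<^sub>7 k i j. \<delta> j k m i * dens x k i j)"
    unfolding S_def by (simp add: left_diff_distrib distrib_right sum.distrib sum_subtractf)
  finally have "3 * S = (\<Sum>\<^sub>7 k i j. \<delta> m k i j * dens x k i j)"
    unfolding third fourth by simp
  then have "S = 6 * partial m v x"
    using volume_derivative[OF x, of m] by (simp add: \<delta>_def)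
  then show ?thesis using 1 by simp
qed

end

section \<open>The codifferential\<close>

lemma sum_lists_5: "(\<Sum>l :: 7 list | length l = 5. F l)
    = (\<Sum>\<^sub>7 a b c d e. F [a,b,c,d,e])"
  by (simp only: eval_nat_numeral BitM.simps sum_lists_Suc sum_lists_0 One_nat_def)

lemma sum_lists_append:
  "(\<Sum>l :: 7 list | length l = m + n. F l) = (\<Sum>k | length k = m. \<Sum>l | length l = n. F (k @ l))"
proof (induction m arbitrary: F)
  case (Suc m)
  then show ?case by (simp add: sum_lists_Suc)
qed simp

text \<open>Moving the differentiated index from position a to the front takes a adjacent swaps,
  whose sign cancels (-1)^a; so the five terms of an exterior derivative contribute equally.\<close>

lemma sum_eps_alternate:
  "(\<Sum>n | length n = 5. eps (n @ [u, w]) * (\<Sum>a\<le>4. (-1) ^ a * D (n ! a) (take a n @ drop (Suc a) n)))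
    = 5 * (\<Sum>\<^sub>7 k. \<Sum>m | length m = 4. eps (k # m @ [u, w]) * D k m)"
proof -
  let ?R = "\<Sum>\<^sub>7 k. \<Sum>m | length m = 4. eps (k # m @ [u, w]) * D k m"
  have R: "?R = (\<Sum>\<^sub>7 k a b c d. eps7 k a b c d u w * D k [a,b,c,d])"
    unfolding sum_lists_4 by (simp add: eps7_def)
  define S where "S i = (\<Sum>n | length n = 5. eps (n @ [u, w]) * ((-1) ^ i * D (n ! i) (take i n @ drop (Suc i) n)))" for i
  have "(\<Sum>n | length n = 5. eps (n @ [u, w]) * (\<Sum>a\<le>4. (-1) ^ a * D (n ! a) (take a n @ drop (Suc a) n))) = (\<Sum>i\<le>4. S i)"
    unfolding S_def sum_distrib_left by (rule sum.swap)
  also have "\<dots> = S 0 + S 1 + S 2 + S 3 + S 4"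
  proof -
    have "{..4::nat} = {0,1,2,3,4}" by auto
    then show ?thesis by (simp add: add_ac)
  qed
  also have "S 0 = ?R"
    unfolding S_def R sum_lists_5 by (simp add: eps7_def)
  also have "S 1 = ?R"
  proof -
    have "S 1 = (\<Sum>\<^sub>7 a k b c d. - eps7 a k b c d u w * D k [a,b,c,d])"
      unfolding S_def sum_lists_5 by (simp add: eps7_def)
    also have "\<dots> = (\<Sum>\<^sub>7 k a b c d. - eps7 a k b c d u w * D k [a,b,c,d])"
      by (rule sum.swap)
    also have "\<dots> = ?R"
      unfolding R by (intro sum.cong refl) (subst eps7_swap(1), simp)
    finally show ?thesis .
  qed
  also have "S 2 = ?R"
  proof -
    have "S 2 = (\<Sum>\<^sub>7 a b k c d. eps7 a b k c d u w * D k [a,b,c,d])"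
      unfolding S_def sum_lists_5 by (simp add: eps7_def numeral_2_eq_2)
    also have "\<dots> = (\<Sum>\<^sub>7 k a b c d. eps7 a b k c d u w * D k [a,b,c,d])"
      by (rule sum3_rotate)
    also have "\<dots> = ?R"
      unfolding R by (intro sum.cong refl) (subst eps7_swap(2), subst eps7_swap(1), simp)
    finally show ?thesis .
  qed
  also have "S 3 = ?R"
  proof -
    have "S 3 = (\<Sum>\<^sub>7 a b c k d. - eps7 a b c k d u w * D k [a,b,c,d])"
      unfolding S_def sum_lists_5 by (simp add: eps7_def numeral_3_eq_3)
    also have "\<dots> = (\<Sum>\<^sub>7 a k b c d. - eps7 a b c k d u w * D k [a,b,c,d])"
      by (rule sum.cong[OF refl], rule sum3_rotate)
    also have "\<dots> = (\<Sum>\<^sub>7 k a b c d. - eps7 a b c k d u w * D k [a,b,c,d])"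
      by (rule sum.swap)
    also have "\<dots> = ?R"
      unfolding R by (intro sum.cong refl) (subst eps7_swap(3), subst eps7_swap(2), subst eps7_swap(1), simp)
    finally show ?thesis .
  qed
  also have "S 4 = ?R"
  proof -
    have "S 4 = (\<Sum>\<^sub>7 a b c d k. eps7 a b c d k u w * D k [a,b,c,d])"
      unfolding S_def sum_lists_5 by (simp add: eps7_def)
    also have "\<dots> = (\<Sum>\<^sub>7 a b k c d. eps7 a b c d k u w * D k [a,b,c,d])"
      by (rule sum.cong[OF refl], rule sum.cong[OF refl], rule sum3_rotate)
    also have "\<dots> = (\<Sum>\<^sub>7 k a b c d. eps7 a b c d k u w * D k [a,b,c,d])"
      by (rule sum3_rotate)
    also have "\<dots> = ?R"
      unfolding R by (intro sum.cong refl) (subst eps7_swap(4), subst eps7_swap(3), subst eps7_swap(2), subst eps7_swap(1), simp)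
    finally show ?thesis .
  qed
  finally show ?thesis by simp
qed

text \<open>Supplies the alternation hypothesis of \<open>eps_contraction\<close>, which speaks of
  lists and permutations of positions.\<close>

lemma alt3_permute_list:
  fixes p :: "7 \<Rightarrow> 7 \<Rightarrow> 7 \<Rightarrow> real"
  assumes p: "alt3 p" and i: "length i = 3" and s: "\<sigma> permutes {..<3}"
  shows "p (permute_list \<sigma> i ! 0) (permute_list \<sigma> i ! 1) (permute_list \<sigma> i ! 2)
    = sign \<sigma> * p (i ! 0) (i ! 1) (i ! 2)"
proof -
  have "p (h (\<sigma> 0)) (h (\<sigma> 1)) (h (\<sigma> 2)) = sign \<sigma> * p (h 0) (h 1) (h 2)" for h :: "nat \<Rightarrow> 7"
    using s finite_lessThan
  proof (induction arbitrary: h rule: permutes_induct)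
    case id
    then show ?case by simp
  next
    case (swap a b r)
    let ?t = "Transposition.transpose a b"
    have tr: "p (h (?t 0)) (h (?t 1)) (h (?t 2)) = - p (h 0) (h 1) (h 2)"
    proof -
      have "(a = 0 \<or> a = 1 \<or> a = 2) \<and> (b = 0 \<or> b = 1 \<or> b = 2)" using swap(1,2) by auto
      then show ?thesis
        using swap(3) alt3_swap(1)[OF p, of "h 1" "h 0" "h 2"] alt3_swap(2)[OF p, of "h 0" "h 2" "h 1"]
          alt3_swap(3)[OF p, of "h 2" "h 1" "h 0"]
        by (auto simp: Transposition.transpose_def)
    qed
    have "permutation r" using swap permutation_permutes finite_lessThan by blast
    then have "sign (?t \<circ> r) = - sign r"
      using swap(3) by (simp add: sign_compose permutation_swap_id sign_swap_id)
    then show ?case using swap.IH[of "h \<circ> ?t"] tr by (simp add: comp_def)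
  qed
  from this[of "(!) i"] show ?thesis
    using i s by (simp add: permute_list_nth)
qed

context closed_G2_chart
begin

lemma raise_all_3: "raise_all (g y) 3 (\<phi> y) i = raise3 (q y) (f y) (i ! 0) (i ! 1) (i ! 2)"
  unfolding raise_all_def raise3_def sum_lists_3
  by (simp add: comp3_def lessThan_nat_numeral mult_ac)

definition star :: "R7 \<Rightarrow> covector" where
  "star y = hodge (g y) 3 (\<phi> y)"

lemma star_eq:
  assumes "y \<in> U" "length m = 4"
  shows "star y m = (\<Sum>i | length i = 3. (eps (i @ m) / 6) * dens y (i ! 0) (i ! 1) (i ! 2))"
  unfolding star_def hodge_def raise_all_3 metric_facts(8)[OF assms(1)]
  using assms(2) by (simp add: fact_numeral dens_def sum_divide_distrib mult_ac)

text \<open>The volume factor of the star is absorbed in \<open>dens\<close> and the symbol is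
  constant, so only \<open>dens\<close> is differentiated.\<close>

lemma partial_star:
  assumes x: "x \<in> U" and m: "length m = 4"
  shows "partial k (\<lambda>y. star y m) x
    = (\<Sum>i | length i = 3. eps (i @ m) / 6 * partial k (\<lambda>y. dens y (i ! 0) (i ! 1) (i ! 2)) x)"
proof -
  have "partial k (\<lambda>y. star y m) x
      = partial k (\<lambda>y. \<Sum>i | length i = 3. (eps (i @ m) / 6) * dens y (i ! 0) (i ! 1) (i ! 2)) x"
  proof (rule partial_transform_open[OF _ open_U x])
    show "(\<lambda>y. \<Sum>i | length i = 3. (eps (i @ m) / 6) * dens y (i ! 0) (i ! 1) (i ! 2)) differentiable at x"
      by (intro differentiable_sum finite_lists7 ballI differentiable_mult differentiable_const dens_differentiable[OF x])
  qed (simp add: star_eq[OF _ m])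
  also have "\<dots> = (\<Sum>i | length i = 3. partial k (\<lambda>y. (eps (i @ m) / 6) * dens y (i ! 0) (i ! 1) (i ! 2)) x)"
    by (rule partial_sum) (intro differentiable_mult differentiable_const dens_differentiable[OF x])
  also have "\<dots> = (\<Sum>i | length i = 3. eps (i @ m) / 6 * partial k (\<lambda>y. dens y (i ! 0) (i ! 1) (i ! 2)) x)"
    by (intro sum.cong refl partial_cmult dens_differentiable[OF x])
  finally show ?thesis .
qed

definition torsion :: "R7 \<Rightarrow> covector" where
  "torsion = codiff g 3 \<phi>"

lemma torsion_eq: "torsion x l = - hodge (g x) 5 (ext_d 4 star x) l"
  unfolding torsion_def codiff_def star_def by simp

lemma torsion_skew: "torsion x [b, a] = - torsion x [a, b]"
proof -
  have "eps (m @ [b, a]) = - eps (m @ [a, b])" if "length m = 5" for m :: "7 list"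
    using eps_transpose[of 5 "m @ [a, b]" 6] that by (simp add: nth_append list_update_append)
  then show ?thesis
    unfolding torsion_eq hodge_def by (simp add: sum_negf)
qed

text \<open>120 = 5 * 24: five equal terms of the exterior derivative, and 144 from the double
  contraction of symbols over the 3! of the star.\<close>

lemma sum_eps_ext_d_star:
  assumes x: "x \<in> U"
  shows "(\<Sum>n | length n = 5. eps (n @ [u, w]) * ext_d 4 star x n)
    = 120 * (\<Sum>\<^sub>7 k. partial k (\<lambda>y. dens y k u w) x)"
proof -
  have "(\<Sum>n | length n = 5. eps (n @ [u, w]) * ext_d 4 star x n)
      = (\<Sum>n | length n = 5. eps (n @ [u, w]) *
          (\<Sum>a\<le>4. (-1) ^ a * partial (n ! a) (\<lambda>y. star y (take a n @ drop (Suc a) n)) x))"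
    by (intro sum.cong refl) (simp add: ext_d_def)
  also have "\<dots> = 5 * (\<Sum>\<^sub>7 k. \<Sum>m | length m = 4. eps (k # m @ [u, w]) * partial k (\<lambda>y. star y m) x)"
    by (rule sum_eps_alternate)
  also have "\<dots> = 5 * (\<Sum>\<^sub>7 k. 24 * partial k (\<lambda>y. dens y k u w) x)"
  proof (intro arg_cong[where f = "(*) 5"] sum.cong refl)
    fix k
    define \<Phi> where "\<Phi> i = partial k (\<lambda>y. dens y (i ! 0) (i ! 1) (i ! 2)) x" for i :: "7 list"
    have alt: "alt3 (\<lambda>a b c. partial k (\<lambda>y. dens y a b c) x)"
      by (rule partial_alt3[OF x alt3_dens dens_differentiable[OF x]])
    have "(\<Sum>m | length m = 4. eps (k # m @ [u, w]) * partial k (\<lambda>y. star y m) x)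
        = (\<Sum>m | length m = 4. \<Sum>i | length i = 3. eps ([k, u, w] @ m) * eps (i @ m) * \<Phi> i / 6)"
    proof (intro sum.cong refl)
      fix m :: "7 list" assume "m \<in> {m. length m = 4}"
      then obtain a b c d where m: "m = [a, b, c, d]"
        by (auto simp: length_Suc_conv eval_nat_numeral)
      \<comment> \<open>The pair u, w passes the four entries of \<open>m\<close> without a
        sign.\<close>
      have "eps (k # m @ [u, w]) = eps ([k, u, w] @ m)"
        using eps7_move_pair(2)[of k a b u w c d] eps7_move_pair(3)[of k a u w b c d]
          eps7_move_pair(4)[of k a b c d u w] eps7_move_pair(2)[of k u w a b c d]
        unfolding m eps7_def by simp
      then show "eps (k # m @ [u, w]) * partial k (\<lambda>y. star y m) x
          = (\<Sum>i | length i = 3. eps ([k, u, w] @ m) * eps (i @ m) * \<Phi> i / 6)"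
        unfolding partial_star[OF x, of m k, unfolded m, simplified, folded m]
        by (simp add: \<Phi>_def sum_distrib_left mult_ac)
    qed
    also have "\<dots> = (\<Sum>m | length m = 4. \<Sum>i | length i = 3. eps ([k, u, w] @ m) * eps (i @ m) * \<Phi> i) / 6"
      by (simp add: sum_divide_distrib)
    also have "(\<Sum>m | length m = 4. \<Sum>i | length i = 3. eps ([k, u, w] @ m) * eps (i @ m) * \<Phi> i) = 144 * \<Phi> [k, u, w]"
      unfolding \<Phi>_def by (rule eps_contraction) (use alt3_permute_list[OF alt] in simp_all)
    finally show "(\<Sum>m | length m = 4. eps (k # m @ [u, w]) * partial k (\<lambda>y. star y m) x)
        = 24 * partial k (\<lambda>y. dens y k u w) x"
      by (simp add: \<Phi>_def)
  qed
  finally show ?thesis by (simp add: sum_distrib_left)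
qed

text \<open>The classical divergence formula for the codifferential. The inverse metrics of the two
  free indices complete the five in the star to det q, and v det q = 1/v.\<close>

lemma torsion_raised:
  assumes x: "x \<in> U"
  shows "(\<Sum>\<^sub>7 a b. q x $ u $ a * q x $ w $ b * torsion x [a, b])
    = - (\<Sum>\<^sub>7 k. partial k (\<lambda>y. dens y k u w) x) / v x"
proof -
  let ?q = "q x" and ?\<omega> = "ext_d 4 star x"
  have qs: "?q $ i $ a = ?q $ a $ i" for i a
    using arg_cong[OF metric_facts(3)[OF x], of "\<lambda>M. M $ a $ i"] by (simp add: transpose_def)
  have h: "hodge (g x) 5 ?\<omega> [a, b]
      = (\<Sum>m | length m = 5. \<Sum>n | length n = 5. (\<Prod>k<5. ?q $ (m ! k) $ (n ! k)) * ?\<omega> n * (v x * eps (m @ [a, b]))) / 120" for a b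
    unfolding hodge_def raise_all_def metric_facts(8)[OF x]
    by (simp add: fact_numeral sum_distrib_right)
  have inner: "(\<Sum>m | length m = 5. \<Sum>\<^sub>7 a b. eps (m @ [a, b]) *
      ((\<Prod>k<5. ?q $ (m ! k) $ (n ! k)) * ?q $ a $ u * ?q $ b $ w)) = det ?q * eps (n @ [u, w])"
    if n: "length n = 5" for n
  proof -
    have "(\<Sum>m | length m = 5. \<Sum>\<^sub>7 a b. eps (m @ [a, b]) *
        ((\<Prod>k<5. ?q $ (m ! k) $ (n ! k)) * ?q $ a $ u * ?q $ b $ w))
      = (\<Sum>m | length m = 5. \<Sum>l | length l = 2. eps (m @ l) * (\<Prod>k<7. ?q $ ((m @ l) ! k) $ ((n @ [u, w]) ! k)))"
      unfolding sum_lists_2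
    proof (intro sum.cong refl arg_cong2[where f = "(*)"])
      fix m :: "7 list" and a b assume "m \<in> {m. length m = 5}"
      then have m: "length m = 5" by simp
      have "{..<7::nat} = insert 5 (insert 6 {..<5})" by auto
      then show "(\<Prod>k<5. ?q $ (m ! k) $ (n ! k)) * ?q $ a $ u * ?q $ b $ w
          = (\<Prod>k<7. ?q $ ((m @ [a, b]) ! k) $ ((n @ [u, w]) ! k))"
        using m n by (simp add: nth_append mult_ac)
    qed
    also have "\<dots> = (\<Sum>l | length l = 5 + 2. eps l * (\<Prod>k<7. ?q $ (l ! k) $ ((n @ [u, w]) ! k)))"
      by (rule sum_lists_append[symmetric])
    also have "\<dots> = det ?q * eps (n @ [u, w])"
      using sum_eps_prod_matrix'[of "n @ [u, w]" ?q] n by simp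
    finally show ?thesis .
  qed
  let ?S = "\<lambda>a b m n. (v x / 120 * ?\<omega> n) * (eps (m @ [a, b]) * ((\<Prod>k<5. ?q $ (m ! k) $ (n ! k)) * ?q $ a $ u * ?q $ b $ w))"
  have "(\<Sum>\<^sub>7 a b. ?q $ u $ a * ?q $ w $ b * hodge (g x) 5 ?\<omega> [a, b])
      = (\<Sum>\<^sub>7 a b. \<Sum>m | length m = 5. \<Sum>n | length n = 5. ?S a b m n)"
    unfolding h qs[of u] qs[of w] by (simp add: sum_distrib_left sum_divide_distrib mult_ac)
  also have "\<dots> = (\<Sum>n | length n = 5. \<Sum>m | length m = 5. \<Sum>\<^sub>7 a b. ?S a b m n)"
  proof -
    have "(\<Sum>\<^sub>7 a b. \<Sum>m | length m = 5. \<Sum>n | length n = 5. ?S a b m n)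
      = (\<Sum>\<^sub>7 a. \<Sum>m | length m = 5. \<Sum>n | length n = 5. \<Sum>\<^sub>7 b. ?S a b m n)"
      by (rule sum.cong[OF refl], subst sum.swap, rule sum.cong[OF refl], rule sum.swap)
    also have "\<dots> = (\<Sum>m | length m = 5. \<Sum>n | length n = 5. \<Sum>\<^sub>7 a b. ?S a b m n)"
      by (subst sum.swap, rule sum.cong[OF refl], rule sum.swap)
    also have "\<dots> = (\<Sum>n | length n = 5. \<Sum>m | length m = 5. \<Sum>\<^sub>7 a b. ?S a b m n)"
      by (rule sum.swap)
    finally show ?thesis .
  qed
  also have "\<dots> = (\<Sum>n | length n = 5. (v x / 120 * ?\<omega> n) * (det ?q * eps (n @ [u, w])))"
    by (intro sum.cong refl) (simp only: sum_distrib_left[symmetric] inner mem_Collect_eq)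
  also have "\<dots> = v x / 120 * det ?q * (\<Sum>n | length n = 5. eps (n @ [u, w]) * ?\<omega> n)"
    by (simp add: sum_distrib_left mult_ac)
  also have "\<dots> = v x * det ?q * (\<Sum>\<^sub>7 k. partial k (\<lambda>y. dens y k u w) x)"
    unfolding sum_eps_ext_d_star[OF x] by simp
  also have "v x * det ?q = 1 / v x"
    using metric_facts(5,7)[OF x] by (simp add: field_simps power2_eq_square)
  finally show ?thesis by (simp add: torsion_eq sum_negf)
qed

text \<open>The raised torsion is -1/v times the divergence of \<open>dens\<close>, so the
  divergence identity applies: the component of \<tau> in the 7-dimensional summand of the 2-forms
  vanishes.\<close>

lemma torsion_contraction:
  assumes x: "x \<in> U"
  shows "(\<Sum>\<^sub>7 u w. f x m u w * (\<Sum>\<^sub>7 a b. q x $ u $ a * q x $ w $ b * torsion x [a, b])) = 0"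
proof -
  have "(\<Sum>\<^sub>7 u w. f x m u w * (\<Sum>\<^sub>7 a b. q x $ u $ a * q x $ w $ b * torsion x [a, b]))
      = - (\<Sum>\<^sub>7 u w k. f x m u w * partial k (\<lambda>y. dens y k u w) x) / v x"
    unfolding torsion_raised[OF x] by (simp add: sum_distrib_left sum_divide_distrib sum_negf)
  also have "(\<Sum>\<^sub>7 u w k. f x m u w * partial k (\<lambda>y. dens y k u w) x) = 0"
    using divergence_identity[OF x, of m] by (subst sum3_rotate)
  finally show ?thesis by simp
qed

end

section \<open>Eigenvalues of the torsion\<close>

lemma sum_product_trace:
  fixes A B :: "real^7^7"
  shows "(\<Sum>\<^sub>7 i j. A $ i $ j * B $ i $ j) = trace (transpose A ** B)"
  unfolding trace_def matrix_matrix_mult_def transpose_def by simp (rule sum.swap)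

text \<open>Eigenvectors of a symmetric matrix for different eigenvalues are orthogonal, and a
  pairwise orthogonal set of vectors is finite.\<close>

lemma eigenvalues_finite:
  fixes S :: "real^7^7"
  assumes "transpose S = S"
  shows "finite {\<mu>. \<exists>w. w \<noteq> 0 \<and> S *v w = \<mu> *\<^sub>R w}"
proof -
  let ?E = "{\<mu>. \<exists>w. w \<noteq> 0 \<and> S *v w = \<mu> *\<^sub>R w}"
  define w where "w \<mu> = (SOME w. w \<noteq> 0 \<and> S *v w = \<mu> *\<^sub>R w)" for \<mu>
  have w: "w \<mu> \<noteq> 0 \<and> S *v w \<mu> = \<mu> *\<^sub>R w \<mu>" if "\<mu> \<in> ?E" for \<mu>
    unfolding w_def by (rule someI_ex) (use that in blast)
  have sym: "(S *v x) \<bullet> y = x \<bullet> (S *v y)" for x y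
    using assms by (metis dot_lmul_matrix vector_transpose_matrix inner_commute)
  have inj: "inj_on w ?E"
  proof (rule inj_onI)
    fix \<mu> \<nu> assume a: "\<mu> \<in> ?E" "\<nu> \<in> ?E" "w \<mu> = w \<nu>"
    have "\<mu> *\<^sub>R w \<mu> = S *v w \<mu>" using w[OF a(1)] by simp
    also have "\<dots> = \<nu> *\<^sub>R w \<mu>" using w[OF a(2)] a(3) by simp
    finally show "\<mu> = \<nu>" using w[OF a(1)] by simp
  qed
  have "pairwise orthogonal (w ` ?E)"
  proof (rule pairwiseI)
    fix x y assume "x \<in> w ` ?E" "y \<in> w ` ?E" "x \<noteq> y"
    then obtain \<mu> \<nu> where m: "x = w \<mu>" "y = w \<nu>" "\<mu> \<in> ?E" "\<nu> \<in> ?E" by blast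
    then have "\<mu> * (x \<bullet> y) = \<nu> * (x \<bullet> y)"
      using sym[of x y] w[OF m(3)] w[OF m(4)] by simp
    then show "orthogonal x y" using \<open>x \<noteq> y\<close> m by (auto simp: orthogonal_def)
  qed
  then have "finite (w ` ?E)" by (rule pairwise_orthogonal_imp_finite)
  then show ?thesis using inj by (rule finite_imageD)
qed

lemma closed_G2_chartI:
  assumes "oriented_manifold7 X \<A>" "closed_G2_structure \<A> \<phi>" "c \<in> \<A>"
  shows "closed_G2_chart (chart_image c) (\<phi> c)"
proof
  show U: "open (chart_image c)"
    using assms(1,3) unfolding oriented_manifold7_def oriented_atlas_def is_chart_def by blast
  show "positive_covector (\<phi> c y)" "ext_d 3 (\<phi> c) y l = 0" if "y \<in> chart_image c" for y l
    using assms(2,3) that unfolding closed_G2_structure_def by blast+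
  show "(\<lambda>z. \<phi> c z l) differentiable at y" if "y \<in> chart_image c" for y l
  proof -
    have "smooth_fun_on (chart_image c) (\<lambda>x. \<phi> c x l)"
      using assms(2,3) unfolding closed_G2_structure_def smooth_form_def by blast
    then have "Ck_on (Suc 0) (chart_image c) (\<lambda>x. \<phi> c x l)" unfolding smooth_fun_on_def by blast
    then have "(\<lambda>x. \<phi> c x l) differentiable_on chart_image c" by simp
    then have "(\<lambda>x. \<phi> c x l) differentiable (at y within chart_image c)"
      using that unfolding differentiable_on_def by blast
    then show ?thesis unfolding at_within_open[OF that U] .
  qed
qed

text \<open>\<open>Max\<close> and \<open>Min\<close> are meaningful for finite nonempty sets, so
  both properties belong to the conclusion. In an orthonormal frame the torsion is a skew matrix T
  and the symmetric tensor is T^2, which reduces every claim to the type 14 estimates.\<close>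

theorem theorem2p23:
  fixes X :: "'a topology" and \<A> :: "'a chart set" and \<phi> :: "'a diff_form"
    and p :: 'a and c :: "'a chart" and g :: "real ^ 7 ^ 7" and \<tau> :: covector
  assumes "oriented_manifold7 X \<A>" and "compact_space X"
    and "closed_G2_structure \<A> \<phi>"
    and "p \<in> topspace X" and "c \<in> \<A>" and "p \<in> chart_dom c"
    and "g = G2_metric (\<phi> c (chart_map c p))"
    and "\<tau> = G2_torsion \<phi> c (chart_map c p)"
  shows "- j_op g \<tau> = (\<chi> i j. \<Sum>l\<in>UNIV. comp_du g \<tau> i l * comp_dd \<tau> l j)
    \<and> neg_semidefinite (- j_op g \<tau>)
    \<and> finite (eigenvalues_wrt g (- j_op g \<tau>)) \<and> eigenvalues_wrt g (- j_op g \<tau>) \<noteq> {}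
    \<and> Max (eigenvalues_wrt g (- j_op g \<tau>)) = 0
    \<and> Min (eigenvalues_wrt g (- j_op g \<tau>)) \<ge> - (2/3) * (form_norm g 2 \<tau>)\<^sup>2
    \<and> (\<Sum>i\<in>UNIV. \<Sum>j\<in>UNIV. \<Sum>l\<in>UNIV. \<Sum>r\<in>UNIV.
         comp_du g \<tau> i l * comp_dd \<tau> l j * comp_uu g \<tau> i r * comp_du g \<tau> r j)
        = (form_norm g 2 \<tau>) ^ 4"
proof -
  define x where "x = chart_map c p"
  interpret closed_G2_chart "chart_image c" "\<phi> c"
    by (rule closed_G2_chartI[OF assms(1,3,5)])
  have x: "x \<in> chart_image c" using assms by (simp add: x_def chart_image_def)
  have \<tau>: "\<tau> = torsion x" using assms(8) by (simp add: G2_torsion_def torsion_def x_def)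
  have g: "g = G2_metric (\<phi> c x)" using assms(7) by (simp add: x_def)
  define q where "q = matrix_inv g"
  define F where "F = comp3 (\<phi> c x)"
  note mf = metric_facts[OF x, folded g, folded q_def]
  obtain P where P: "transpose P ** g ** P = mat 1" "q = P ** transpose P" "clifford3 1 (pull3 P F)"
    using positive_covector_frame[OF positive[OF x]] unfolding g q_def F_def by blast
  define t where "t = (\<chi> i j. \<tau> [i, j])"
  define T where "T = transpose P ** t ** P"
  have tij: "t $ i $ j = - t $ j $ i" for i j
    unfolding t_def \<tau> vec_lambda_beta by (rule torsion_skew)
  have t_skew: "transpose t = - t"
    by (simp add: vec_eq_iff transpose_def) (blast intro: tij)
  have T_skew: "transpose T = - T"
    unfolding T_def by (simp add: matrix_transpose_mul t_skew matrix_mult_uminus matrix_mul_assoc)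
  have qij: "q $ i $ j = q $ j $ i" for i j
    using arg_cong[OF mf(3), of "\<lambda>M. M $ j $ i"] by (simp add: transpose_def)
  \<comment> \<open>Each inverse metric in the coordinate identity splits as P P^T; one factor goes
    to the 3-form, the other to the torsion.\<close>
  have contr: "(\<Sum>\<^sub>7 j k. pull3 P F i j k * T $ j $ k) = 0" for i
  proof -
    have Tjk: "T $ j $ k = (\<Sum>\<^sub>7 d e. P $ d $ j * P $ e $ k * t $ d $ e)" for j k
      unfolding T_def matrix_matrix_mult_def transpose_def
      by (subst sum.swap) (simp add: sum_distrib_left sum_distrib_right mult_ac)
    have qbd: "q $ b $ d = (\<Sum>\<^sub>7 j. P $ b $ j * P $ d $ j)" for b d
      by (simp add: P(2) matrix_matrix_mult_def transpose_def)
    have u: "(\<Sum>\<^sub>7 j k. (\<Sum>\<^sub>7 b c. P $ b $ j * P $ c $ k * F a b c) * T $ j $ k) = 0" for a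
    proof -
      have "(\<Sum>\<^sub>7 j k. (\<Sum>\<^sub>7 b c. P $ b $ j * P $ c $ k * F a b c) * T $ j $ k)
        = (\<Sum>\<^sub>7 j k b c d. \<Sum>e\<in>UNIV.
            F a b c * t $ d $ e * ((P $ b $ j * P $ d $ j) * (P $ c $ k * P $ e $ k)))"
        unfolding Tjk sum_distrib_right unfolding sum_distrib_left by (simp add: mult_ac)
      also have "\<dots> = (\<Sum>\<^sub>7 b c j k d. \<Sum>e\<in>UNIV.
            F a b c * t $ d $ e * ((P $ b $ j * P $ d $ j) * (P $ c $ k * P $ e $ k)))"
        by (rule sum4_swap_pairs)
      also have "\<dots> = (\<Sum>\<^sub>7 b c d e j. \<Sum>k\<in>UNIV.
            F a b c * t $ d $ e * ((P $ b $ j * P $ d $ j) * (P $ c $ k * P $ e $ k)))"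
        by (rule sum.cong[OF refl], rule sum.cong[OF refl], rule sum4_swap_pairs)
      also have "\<dots> = (\<Sum>\<^sub>7 b c. F a b c * (\<Sum>\<^sub>7 d e. q $ b $ d * q $ c $ e * t $ d $ e))"
        unfolding qbd sum_product by (simp add: sum_distrib_left sum_distrib_right mult_ac)
      also have "\<dots> = 0"
        using torsion_contraction[OF x, of a] by (simp add: F_def t_def \<tau> q_def g)
      finally show ?thesis .
    qed
    have "(\<Sum>\<^sub>7 j k. pull3 P F i j k * T $ j $ k)
        = (\<Sum>\<^sub>7 j k a. P $ a $ i * ((\<Sum>\<^sub>7 b c. P $ b $ j * P $ c $ k * F a b c) * T $ j $ k))"
      unfolding pull3_outer by (simp add: sum_distrib_right mult.assoc)
    also have "\<dots> = (\<Sum>\<^sub>7 a. P $ a $ i * (\<Sum>\<^sub>7 j k. (\<Sum>\<^sub>7 b c. P $ b $ j * P $ c $ k * F a b c) * T $ j $ k))"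
      by (subst sum3_rotate) (simp add: sum_distrib_left)
    finally show ?thesis unfolding u by simp
  qed
  define H where "H = t ** q ** t"
  have du: "comp_du g \<tau> i j = (t ** q) $ i $ j" for i j
    by (simp add: comp_du_def comp_dd_def t_def q_def matrix_matrix_mult_def)
  have dd: "comp_dd \<tau> i j = t $ i $ j" for i j by (simp add: comp_dd_def t_def)
  have uu: "comp_uu g \<tau> i j = (q ** t ** q) $ i $ j" for i j
  proof -
    have "comp_uu g \<tau> i j = (\<Sum>\<^sub>7 a b. q $ i $ a * t $ a $ b * q $ b $ j)"
      unfolding comp_uu_def comp_dd_def q_def[symmetric] t_def
      by (intro sum.cong refl) (subst qij, simp)
    also have "\<dots> = (q ** t ** q) $ i $ j"
      unfolding matrix_matrix_mult_def by (subst sum.swap) (simp add: sum_distrib_right)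
    finally show ?thesis .
  qed
  have H_eq: "(\<chi> i j. \<Sum>\<^sub>7 l. comp_du g \<tau> i l * comp_dd \<tau> l j) = H"
    unfolding du dd H_def by (simp add: vec_eq_iff matrix_matrix_mult_def)
  have j_op: "- j_op g \<tau> = H"
  proof -
    have "j_op g \<tau> = t ** transpose (t ** q)"
      by (simp add: j_op_def du dd vec_eq_iff matrix_matrix_mult_def transpose_def)
    also have "\<dots> = - H"
      by (simp add: matrix_transpose_mul mf(3) t_skew matrix_mult_uminus H_def matrix_mul_assoc)
    finally show ?thesis by simp
  qed
  have H_sym: "transpose H = H"
    by (simp add: H_def matrix_transpose_mul mf(3) t_skew matrix_mult_uminus matrix_mul_assoc)
  have TT: "transpose P ** H ** P = T ** T"
    by (simp add: T_def H_def P(2) matrix_mul_assoc)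
  have TT_sym: "transpose (T ** T) = T ** T"
    by (simp add: matrix_transpose_mul T_skew matrix_mult_uminus)
  have TT_inner: "w \<bullet> (T ** T *v w) = - ((T *v w) \<bullet> (T *v w))" for w
    using skew_inner[OF T_skew, of w "T *v w"] by (simp add: matrix_vector_mul_assoc)
  \<comment> \<open>R is the inverse of P; the substitution w = R z turns H z = \<mu> g z into the
    ordinary eigenvalue equation of T^2.\<close>
  define R where "R = transpose P ** g"
  have PR: "P ** R = mat 1" using mf(2) by (simp add: R_def P(2) matrix_mul_assoc)
  have RP: "R ** P = mat 1" using P(1) by (simp add: R_def)
  have TR: "transpose R ** transpose P = mat 1" using PR by (metis matrix_transpose_mul transpose_mat)
  have PRv: "P *v (R *v z) = z" for z by (simp add: matrix_vector_mul_assoc PR)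
  have neg: "neg_semidefinite H"
    unfolding neg_semidefinite_def
  proof (intro conjI allI H_sym)
    fix z :: R7
    let ?w = "R *v z"
    have "z \<bullet> (H *v z) = (P *v ?w) \<bullet> (H *v (P *v ?w))" by (simp add: PRv)
    also have "\<dots> = ?w \<bullet> (transpose P *v (H *v (P *v ?w)))"
      by (metis dot_lmul_matrix vector_transpose_matrix inner_commute transpose_transpose)
    also have "\<dots> = ?w \<bullet> (T ** T *v ?w)" by (simp add: matrix_vector_mul_assoc matrix_mul_assoc TT)
    finally show "z \<bullet> (H *v z) \<le> 0" unfolding TT_inner by simp
  qed
  let ?E = "eigenvalues_wrt g H"
  have eig: "\<exists>w. w \<noteq> 0 \<and> T ** T *v w = \<mu> *\<^sub>R w" if \<mu>: "\<mu> \<in> ?E" for \<mu>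
  proof -
    from \<mu> have "\<exists>z. z \<noteq> 0 \<and> H *v z = \<mu> *\<^sub>R (g *v z)" unfolding eigenvalues_wrt_def mem_Collect_eq .
    then obtain z where z: "z \<noteq> 0" "H *v z = \<mu> *\<^sub>R (g *v z)" by (elim exE conjE)
    have "R *v z \<noteq> 0" using PRv[of z] z(1) by (metis matrix_vector_mult_0_right)
    moreover have "T ** T *v (R *v z) = transpose P *v (H *v (P *v (R *v z)))"
      by (simp add: TT[symmetric] matrix_vector_mul_assoc matrix_mul_assoc)
    then have "T ** T *v (R *v z) = transpose P *v (\<mu> *\<^sub>R (g *v z))"
      unfolding PRv z(2) .
    then have "T ** T *v (R *v z) = \<mu> *\<^sub>R (R *v z)"
      unfolding R_def matrix_vector_mult_scaleR by (simp add: matrix_vector_mul_assoc)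
    ultimately show ?thesis by blast
  qed
  have fin: "finite ?E"
    using eigenvalues_finite[OF TT_sym] by (rule rev_finite_subset) (use eig in blast)
  \<comment> \<open>A kernel vector of T, which exists in odd dimension, carried back by P.\<close>
  have zero: "0 \<in> ?E"
  proof -
    obtain a where a: "a \<bullet> a = 1" "T *v a = 0" using skew7_kernel[OF T_skew] .
    have "P *v a \<noteq> 0"
    proof
      assume "P *v a = 0"
      then have "(R ** P) *v a = 0" by (simp add: matrix_vector_mul_assoc[symmetric])
      then show False using a(1) by (simp add: RP)
    qed
    moreover have "t *v (P *v a) = (transpose R ** transpose P) *v (t *v (P *v a))" by (simp add: TR)
    then have "t *v (P *v a) = transpose R *v (T *v a)"
      by (simp add: T_def matrix_vector_mul_assoc matrix_mul_assoc)
    then have "H *v (P *v a) = 0"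
      using a(2) by (simp add: H_def matrix_vector_mul_assoc[symmetric])
    ultimately show ?thesis unfolding eigenvalues_wrt_def by auto
  qed
  have bounds: "\<mu> \<le> 0 \<and> - (sq_norm T / 3) \<le> \<mu>" if \<mu>: "\<mu> \<in> ?E" for \<mu>
  proof -
    obtain w where w: "w \<noteq> 0" "T ** T *v w = \<mu> *\<^sub>R w" using eig[OF \<mu>] by blast
    have e: "\<mu> * (w \<bullet> w) = - ((T *v w) \<bullet> (T *v w))" using TT_inner[of w] w(2) by simp
    have pos: "w \<bullet> w > 0" using w(1) by simp
    have "\<mu> * (w \<bullet> w) \<le> 0 * (w \<bullet> w)" using e by simp
    moreover have "- (sq_norm T / 3) * (w \<bullet> w) \<le> \<mu> * (w \<bullet> w)"
      using e omega14_bound[OF P(3) T_skew contr, of w] by simp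
    ultimately show ?thesis using pos mult_le_cancel_right_pos by metis
  qed
  have tr_conj: "trace (transpose P ** M ** P) = trace (M ** q)" for M
    unfolding P(2) by (metis trace_mul_sym matrix_mul_assoc)
  \<comment> \<open>The factor 1/2! of the inner product of 2-forms enters here: it turns the bound
    \<open>sq_norm T / 3\<close> into 2/3 |\<tau>|^2.\<close>
  have norm: "(form_norm g 2 \<tau>)\<^sup>2 = sq_norm T / 2"
  proof -
    have "form_inner g 2 \<tau> \<tau> = (\<Sum>\<^sub>7 i j. t $ i $ j * (q ** t ** q) $ i $ j) / 2"
    proof -
      have "(\<Sum>\<^sub>7 a b. q $ i $ a * q $ j $ b * t $ a $ b) = (q ** t ** q) $ i $ j" for i j
      proof -
        have "(\<Sum>\<^sub>7 a b. q $ i $ a * q $ j $ b * t $ a $ b) = comp_uu g \<tau> i j"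
          unfolding comp_uu_def comp_dd_def q_def[symmetric]
          by (intro sum.cong refl) (simp add: t_def qij[of i] qij[of j] mult_ac)
        then show ?thesis unfolding uu .
      qed
      then show ?thesis
        unfolding form_inner_def raise_all_def sum_lists_2
        by (simp add: t_def q_def lessThan_nat_numeral mult_ac fact_2)
    qed
    also have "(\<Sum>\<^sub>7 i j. t $ i $ j * (q ** t ** q) $ i $ j) = - trace (H ** q)"
      unfolding sum_product_trace t_skew H_def
      by (simp add: matrix_mult_uminus matrix_mul_assoc trace_def sum_negf)
    also have "\<dots> = sq_norm T"
      unfolding tr_conj[symmetric] TT sq_norm_trace T_skew
      by (simp add: matrix_mult_uminus trace_def sum_negf)
    finally have "form_inner g 2 \<tau> \<tau> = sq_norm T / 2" .
    moreover have "sq_norm T \<ge> 0" by (simp add: sq_norm_def sum_nonneg)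
    ultimately show ?thesis by (simp add: form_norm_def)
  qed
  \<comment> \<open>The sums over l and r produce H and H with both indices raised, so the
    contraction is tr (H q H q) = tr T^4.\<close>
  have quartic: "(\<Sum>\<^sub>7 i j l. \<Sum>r\<in>UNIV.
         comp_du g \<tau> i l * comp_dd \<tau> l j * comp_uu g \<tau> i r * comp_du g \<tau> r j) = (form_norm g 2 \<tau>) ^ 4"
  proof -
    have "(\<Sum>\<^sub>7 l r. comp_du g \<tau> i l * comp_dd \<tau> l j * comp_uu g \<tau> i r * comp_du g \<tau> r j)
        = H $ i $ j * (q ** H ** q) $ i $ j" for i j
    proof -
      have "(\<Sum>\<^sub>7 l r. comp_du g \<tau> i l * comp_dd \<tau> l j * comp_uu g \<tau> i r * comp_du g \<tau> r j)
          = (\<Sum>\<^sub>7 l. (t ** q) $ i $ l * t $ l $ j) * (\<Sum>\<^sub>7 r. (q ** t ** q) $ i $ r * (t ** q) $ r $ j)"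
        unfolding du dd uu sum_product by (simp add: mult.assoc)
      also have "(\<Sum>\<^sub>7 l. (t ** q) $ i $ l * t $ l $ j) = H $ i $ j"
        unfolding H_def by (simp add: matrix_matrix_mult_def[of "t ** q" t])
      also have "(\<Sum>\<^sub>7 r. (q ** t ** q) $ i $ r * (t ** q) $ r $ j) = ((q ** t ** q) ** (t ** q)) $ i $ j"
        by (simp add: matrix_matrix_mult_def[of "q ** t ** q" "t ** q"])
      also have "(q ** t ** q) ** (t ** q) = q ** H ** q" by (simp add: H_def matrix_mul_assoc)
      finally show ?thesis .
    qed
    then have "(\<Sum>\<^sub>7 i j l. \<Sum>r\<in>UNIV.
         comp_du g \<tau> i l * comp_dd \<tau> l j * comp_uu g \<tau> i r * comp_du g \<tau> r j) = trace (H ** (q ** H ** q))"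
      by (simp add: sum_product_trace H_sym)
    also have "\<dots> = trace ((H ** q ** H) ** q)" by (simp add: matrix_mul_assoc)
    also have "\<dots> = trace ((T ** T) ** (T ** T))"
      unfolding tr_conj[symmetric] TT[symmetric] by (simp add: P(2) matrix_mul_assoc)
    also have "\<dots> = sq_norm (T ** T)" unfolding sq_norm_trace TT_sym ..
    also have "\<dots> = (sq_norm T)\<^sup>2 / 4" by (rule omega14_quartic[OF P(3) T_skew contr])
    also have "\<dots> = ((form_norm g 2 \<tau>)\<^sup>2)\<^sup>2" unfolding norm by (simp add: power2_eq_square)
    finally show ?thesis by simp
  qed
  have "Max ?E = 0" using fin zero bounds by (intro Max_eqI) auto
  moreover have "- (2/3) * (form_norm g 2 \<tau>)\<^sup>2 \<le> Min ?E"
    unfolding norm using fin zero bounds by (subst Min_ge_iff) auto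
  ultimately show ?thesis
    unfolding j_op H_eq using neg fin zero quartic by blast
qed

end
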